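(* Suppose that for each $n$ the alternative $H_{1n}(\rho)$ holds, i.e. the innovations $\{\varepsilon_t\}$ are i.i.d. with distribution function $A_n(x)=(1-\rho_n)G_0(x)+\rho_nH(x)$, $\rho_n=\min(1,\rho n^{-1/2})$. Suppose that random variables with distribution functions $G_0$ and $H$ have zero means and finite variances, and that $G_0$ and $H$ are twice differentiable with bounded second derivatives; let $g_0=G_0'$. Let $\hat\mu_n$ and $\hat{\boldsymbol{\beta}}_n$ be any estimators such that $n^{1/2}(\hat\mu_n-\mu)=O_P(1)$ and $n^{1/2}(\hat{\boldsymbol{\beta}}_n-\boldsymbol{\beta})=O_P(1)$ as $n\to\infty$ under $H_{1n}(\rho)$, uniformly in $\gamma\le\Gamma$, $\rho\le R$, for any finite $\Gamma,R\ge0$. Then for all finite $\Gamma\ge0$, $R\ge0$, every $x\in\mathbb{R}$ and every $\delta>0$, $$ \sup_{0\le\gamma\le\Gamma,\;0\le\rho\le R}\mathsf{P}\Big(\big|n^{1/2}[\hat G_n(x)-G_n(x)]-g_0(x)\,\hat\delta_n\,n^{1/2}(\hat\mu_n-\mu)-\gamma\Delta(x,\Pi)\big|>\delta\Big)\to0,\qquad n\to\infty, $$ where $$ \Delta(x,\Pi)=\sum_{j=0}^p\big[\mathsf{E}\,G_0(x+\beta_j\xi_1)-G_0(x)\big],\quad\beta_0=-1,\qquad \hat\delta_n=1-\hat\beta_{1n}-\dots-\hat\beta_{pn}. $$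
   Context: Model. Fix $p\ge1$, $\boldsymbol{\beta}=(\beta_1,\dots,\beta_p)^T\in\mathbb{R}^p$ such that all roots of the characteristic equation $\lambda^p-\beta_1\lambda^{p-1}-\dots-\beta_p=0$ are less than one in modulus, and $\nu\in\mathbb{R}$. Let $\{v_t\}_{t\in\mathbb{Z}}$ be the stationary solution of $v_t=\beta_1v_{t-1}+\dots+\beta_pv_{t-p}+\nu+\varepsilon_t$, where the innovations $\{\varepsilon_t\}$ are i.i.d. with zero mean and finite positive variance. Let $\mu$ be defined by $\nu=(1-\beta_1-\dots-\beta_p)\mu$. Outliers. $\{z_t^{\gamma_n}\}$ are i.i.d. random variables taking value $1$ with probability $\gamma_n=\min(1,\gamma n^{-1/2})$ and $0$ with probability $1-\gamma_n$, where $\gamma\ge0$; $\{\xi_t\}$ are i.i.d. with an arbitrary distribution $\Pi$ on $\mathbb{R}$. The sequences $\{\varepsilon_t\}$, $\{z_t^{\gamma_n}\}$, $\{\xi_t\}$ are mutually independent. The observations are $y_t=v_t+z_t^{\gamma_n}\xi_t$, $t=1-p,\dots,n$. $G_0$ and $H$ are fixed distribution functions, $\rho\ge0$. Under $H_{1n}(\rho)$ the innovations (hence $v_t$) depend on $n$ through their distribution $A_n$; $\mathsf{P}$ is the probability in the model with parameters $n,\gamma,\rho$. Estimators and residuals. $\hat\mu_n$ is a real-valued and $\hat{\boldsymbol{\beta}}_n=(\hat\beta_{1n},\dots,\hat\beta_{pn})^T$ an $\mathbb{R}^p$-valued sequence of estimators constructed from the observations. "$X_n=O_P(1)$ uniformly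 in $\gamma\le\Gamma,\rho\le R$" means $\lim_{C\to\infty}\limsup_{n\to\infty}\sup_{0\le\gamma\le\Gamma,0\le\rho\le R}\mathsf{P}(|X_n|>C)=0$. Put $\hat u_t=y_t-\hat\mu_n$ for $t=1-p,\dots,n$, and define the residuals $\hat\varepsilon_t=\hat u_t-\hat\beta_{1n}\hat u_{t-1}-\dots-\hat\beta_{pn}\hat u_{t-p}$, $t=1,\dots,n$. With $I(\cdot)$ the indicator of an event, the residual empirical distribution function and the empirical distribution function of the innovations are $$\hat G_n(x)=n^{-1}\sum_{t=1}^nI(\hat\varepsilon_t\le x),\qquad G_n(x)=n^{-1}\sum_{t=1}^nI(\varepsilon_t\le x).$$ *)

theory Defs
  imports "HOL-Probability.Probability"
begin

text \<open>
  The vectors of \<open>\<real>\<^sup>p\<close> are functions \<open>nat \<Rightarrow> real\<close> of which only the entries \<open>1..p\<close> are used.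
  Stochastic processes are functions \<open>int \<Rightarrow> 'w \<Rightarrow> real\<close>.
\<close>

definition roots_inside_unit_disc :: "nat \<Rightarrow> (nat \<Rightarrow> real) \<Rightarrow> bool" where
  "roots_inside_unit_disc p \<beta> \<longleftrightarrow>
     (\<forall>z::complex. z ^ p - (\<Sum>j=1..p. complex_of_real (\<beta> j) * z ^ (p - j)) = 0 \<longrightarrow> cmod z < 1)"

definition path :: "(int \<Rightarrow> 'w \<Rightarrow> real) \<Rightarrow> 'w \<Rightarrow> int \<Rightarrow> real" where
  "path X \<omega> = (\<lambda>t. X t \<omega>)"

definition strictly_stationary :: "'w measure \<Rightarrow> (int \<Rightarrow> 'w \<Rightarrow> real) \<Rightarrow> bool" where
  "strictly_stationary M X \<longleftrightarrow>
     (\<forall>t. X t \<in> borel_measurable M) \<and>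
     (\<forall>h. distr M (\<Pi>\<^sub>M t\<in>UNIV. borel) (path (\<lambda>t. X (t + h)))
        = distr M (\<Pi>\<^sub>M t\<in>UNIV. borel) (path X))"

definition iid :: "'w measure \<Rightarrow> (int \<Rightarrow> 'w \<Rightarrow> real) \<Rightarrow> bool" where
  "iid M X \<longleftrightarrow>
     prob_space.indep_vars M (\<lambda>_. borel) X UNIV \<and>
     (\<forall>s t. distr M borel (X s) = distr M borel (X t))"

text \<open>
  The recursion below has exactly one strictly stationary solution up to null sets when
  \<open>roots_inside_unit_disc p \<beta>\<close> holds and the innovations are as in \<open>contaminated_ar\<close>,
  so this predicate determines \<open>v\<close> almost surely.
\<close>

definition stationary_ar_solution ::
  "'w measure \<Rightarrow> nat \<Rightarrow> (nat \<Rightarrow> real) \<Rightarrow> real \<Rightarrow> (int \<Rightarrow> 'w \<Rightarrow> real) \<Rightarrow> (int \<Rightarrow> 'w \<Rightarrow> real) \<Rightarrow> bool"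
where
  "stationary_ar_solution M p \<beta> \<nu> \<epsilon> v \<longleftrightarrow>
     strictly_stationary M v \<and>
     (\<forall>t. AE \<omega> in M. v t \<omega> = (\<Sum>j=1..p. \<beta> j * v (t - int j) \<omega>) + \<nu> + \<epsilon> t \<omega>)"

definition rate :: "real \<Rightarrow> nat \<Rightarrow> real" where
  "rate c n = min 1 (c / sqrt (real n))"

text \<open>
  \<open>q\<close> is the contamination probability, \<open>A\<close> the distribution function of the innovations and
  \<open>Q\<close> the law of the outlier sizes \<open>\<xi>\<close>.
\<close>

definition contaminated_ar ::
  "nat \<Rightarrow> (nat \<Rightarrow> real) \<Rightarrow> real \<Rightarrow> (real \<Rightarrow> real) \<Rightarrow> real \<Rightarrow> real measure \<Rightarrow> 'w measure \<Rightarrow>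
   (int \<Rightarrow> 'w \<Rightarrow> real) \<Rightarrow> (int \<Rightarrow> 'w \<Rightarrow> real) \<Rightarrow> (int \<Rightarrow> 'w \<Rightarrow> real) \<Rightarrow> (int \<Rightarrow> 'w \<Rightarrow> real) \<Rightarrow> bool"
where
  "contaminated_ar p \<beta> \<nu> A q Q M \<epsilon> z \<xi> v \<longleftrightarrow>
     prob_space M \<and>
     iid M \<epsilon> \<and>
     (\<forall>t. integrable M (\<epsilon> t) \<and> prob_space.expectation M (\<epsilon> t) = 0 \<and>
          integrable M (\<lambda>\<omega>. (\<epsilon> t \<omega>)\<^sup>2) \<and> prob_space.variance M (\<epsilon> t) > 0 \<and>
          (\<forall>x. cdf (distr M borel (\<epsilon> t)) x = A x)) \<and>
     iid M z \<and>
     (\<forall>t. measure M {\<omega> \<in> space M. z t \<omega> = 1} = q \<and>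
          measure M {\<omega> \<in> space M. z t \<omega> = 0} = 1 - q) \<and>
     iid M \<xi> \<and>
     (\<forall>t. distr M borel (\<xi> t) = Q) \<and>
     prob_space.indep_vars M (\<lambda>_. \<Pi>\<^sub>M t\<in>UNIV. borel)
       (\<lambda>k. [path \<epsilon>, path z, path \<xi>] ! k) {..<3} \<and>
     stationary_ar_solution M p \<beta> \<nu> \<epsilon> v"

definition mixture_cdf :: "(real \<Rightarrow> real) \<Rightarrow> (real \<Rightarrow> real) \<Rightarrow> real \<Rightarrow> real \<Rightarrow> real" where
  "mixture_cdf G H r x = (1 - r) * G x + r * H x"

definition twice_diff_bounded :: "(real \<Rightarrow> real) \<Rightarrow> bool" where
  "twice_diff_bounded F \<longleftrightarrow>
     (\<forall>x. F differentiable at x) \<and> (\<forall>x. deriv F differentiable at x) \<and>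
     bounded (range (deriv (deriv F)))"

definition zero_mean_finite_variance :: "real measure \<Rightarrow> bool" where
  "zero_mean_finite_variance P \<longleftrightarrow>
     integrable P (\<lambda>x. x) \<and> (\<integral>x. x \<partial>P) = 0 \<and> integrable P (\<lambda>x. x\<^sup>2)"

definition sample :: "nat \<Rightarrow> nat \<Rightarrow> (int \<Rightarrow> 'w \<Rightarrow> real) \<Rightarrow> 'w \<Rightarrow> int \<Rightarrow> real" where
  "sample p n y \<omega> = (\<lambda>t\<in>{1 - int p..int n}. y t \<omega>)"

definition residual :: "nat \<Rightarrow> real \<Rightarrow> (nat \<Rightarrow> real) \<Rightarrow> (int \<Rightarrow> real) \<Rightarrow> int \<Rightarrow> real" where
  "residual p m b y t = (y t - m) - (\<Sum>j=1..p. b j * (y (t - int j) - m))"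

definition edf :: "nat \<Rightarrow> (int \<Rightarrow> real) \<Rightarrow> real \<Rightarrow> real" where
  "edf n e x = (\<Sum>t=1..int n. of_bool (e t \<le> x)) / real n"

definition Delta :: "nat \<Rightarrow> (nat \<Rightarrow> real) \<Rightarrow> (real \<Rightarrow> real) \<Rightarrow> real \<Rightarrow> real measure \<Rightarrow> real" where
  "Delta p \<beta> G x Q =
     (\<Sum>j=0..p. ((\<integral>u. G (x + (if j = 0 then -1 else \<beta> j) * u) \<partial>Q) - G x))"

text \<open>
  In the next two definitions \<open>M n \<gamma> \<rho>\<close> is the probability space of the model with parameters
  \<open>n, \<gamma>, \<rho>\<close>, and \<open>X n \<gamma> \<rho>\<close> is a random variable on it.
\<close>

definition sup_prob_gt ::
  "(nat \<Rightarrow> real \<Rightarrow> real \<Rightarrow> 'w measure) \<Rightarrow> (nat \<Rightarrow> real \<Rightarrow> real \<Rightarrow> 'w \<Rightarrow> real) \<Rightarrow>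
   real \<Rightarrow> real \<Rightarrow> real \<Rightarrow> nat \<Rightarrow> real"
where
  "sup_prob_gt M X \<Gamma> R C n =
     (SUP (\<gamma>, \<rho>) \<in> {0..\<Gamma>} \<times> {0..R}.
        measure (M n \<gamma> \<rho>) {\<omega> \<in> space (M n \<gamma> \<rho>). \<bar>X n \<gamma> \<rho> \<omega>\<bar> > C})"

definition OP1_uniformly ::
  "(nat \<Rightarrow> real \<Rightarrow> real \<Rightarrow> 'w measure) \<Rightarrow> (nat \<Rightarrow> real \<Rightarrow> real \<Rightarrow> 'w \<Rightarrow> real) \<Rightarrow>
   real \<Rightarrow> real \<Rightarrow> bool"
where
  "OP1_uniformly M X \<Gamma> R \<longleftrightarrow>
     ((\<lambda>C. limsup (\<lambda>n. ereal (sup_prob_gt M X \<Gamma> R C n))) \<longlongrightarrow> 0) at_top"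

end

theory Submission
  imports Defs "HOL-Complex_Analysis.Complex_Analysis"
begin

text \<open>
  Put \<open>h = n\<^sup>-\<^sup>1\<^sup>/\<^sup>2\<close>, \<open>\<tau>\<^sub>j = (\<beta>h\<^sub>j - \<beta>\<^sub>j) / h\<close> for \<open>j \<ge> 1\<close> and \<open>\<tau>\<^sub>0 = (1 - \<Sum>\<beta>h\<^sub>j) (\<mu>h - \<mu>) / h\<close>.
  A residual is at most \<open>x\<close> iff \<open>\<epsilon>\<^sub>t \<le> x + h s\<^sub>t + a\<^sub>t\<close>, where \<open>s\<^sub>t\<close> is the linear combination with
  coefficients \<open>\<tau>\<close> of \<open>1\<close> and the lagged centred observations, and \<open>a\<^sub>t\<close> is the effect of the outliers
  in the window \<open>t - p, \<dots>, t\<close>. By causality of the stationary solution this threshold is independent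
  of \<open>\<epsilon>\<^sub>t\<close> for each fixed \<open>\<tau>\<close>, so the centred indicators are orthogonal martingale differences with
  small second moment. The compensator splits according to the number of outliers in the window: none gives
  the drift \<open>g\<^sub>0(x) \<tau>\<^sub>0\<close> (the lagged observations average out), exactly one gives \<open>\<gamma> \<Delta>(x, \<Pi>)\<close> by a law of
  large numbers, and two or more occur only boundedly often in mean. The random \<open>\<tau>\<close> is handled by a finite
  grid: adding \<open>\<plusminus>\<eta> \<Sum>|\<cdot>|\<close> to the threshold at a grid point sandwiches all nearby \<open>\<tau>\<close>, because indicators
  are monotone in the threshold.
\<close>

section \<open>Distribution functions and the autoregressive recursion\<close>

text \<open>The estimators may depend on the whole sample, so at the random \<tau> a threshold need
  not be independent of the innovation it is compared with. This is why the martingale argument runs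
  at deterministic coefficients and the passage to \<tau> is pathwise. The law of the outlier sizes
  has no moments, so an outlier in a lagged regressor is never averaged: its effect on a
  distribution function is truncated at 1, and only dominated convergence makes it vanish. All
  estimates are explicit bounds for one sample size whose constants involve the two parameters only
  through \<Gamma> and R, so uniformity requires nothing further. The choices are made in a fixed
  order: tightness gives the cube that contains \<tau>, then the mesh \<eta> is taken small enough
  for the drift error, and only then does n grow, with the grid fixed.\<close>

lemma twice_diff_bounded_cdf_bounds:
  fixes F :: "real \<Rightarrow> real"
  assumes F: "twice_diff_bounded F" and F01: "\<And>x. 0 \<le> F x" "\<And>x. F x \<le> 1"
  obtains L where "L \<ge> 0" "\<And>x. \<bar>deriv F x\<bar> \<le> L" "\<And>x y. \<bar>F x - F y\<bar> \<le> L * \<bar>x - y\<bar>"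
    "\<And>x d. \<bar>F (x + d) - F x - deriv F x * d\<bar> \<le> L * d\<^sup>2"
proof -
  have dF: "(F has_field_derivative deriv F x) (at x)" for x
    using F by (auto simp: twice_diff_bounded_def DERIV_deriv_iff_real_differentiable)
  have ddF: "(deriv F has_field_derivative deriv (deriv F) x) (at x)" for x
    using F by (auto simp: twice_diff_bounded_def DERIV_deriv_iff_real_differentiable)
  from F obtain B where B: "\<And>x. \<bar>deriv (deriv F) x\<bar> \<le> B"
    by (auto simp: twice_diff_bounded_def bounded_iff)
  have B0: "B \<ge> 0" using B[of 0] by linarith
  \<comment> \<open>Mean value theorem for increments of either sign. The case d = 0 is included,
    hence only a weak inequality for the distance of the intermediate point.\<close>
  have mvt: "\<exists>\<xi>. \<bar>\<xi> - x\<bar> \<le> \<bar>d\<bar> \<and> f (x + d) - f x = f' \<xi> * d"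
    if "\<And>x. (f has_field_derivative f' x) (at x)" for f f' :: "real \<Rightarrow> real" and x d
  proof (cases d "0::real" rule: linorder_cases)
    case less
    have "\<exists>z>x + d. z < x \<and> f x - f (x + d) = (x - (x + d)) * f' z"
      by (rule MVT2) (use that less in auto)
    then obtain z where "x + d < z" "z < x" "f x - f (x + d) = (x - (x + d)) * f' z"
      by blast
    then show ?thesis using less by (intro exI[of _ z]) (auto simp: algebra_simps)
  next
    case greater
    have "\<exists>z>x. z < x + d \<and> f (x + d) - f x = ((x + d) - x) * f' z"
      by (rule MVT2) (use that greater in auto)
    then obtain z where "x < z" "z < x + d" "f (x + d) - f x = ((x + d) - x) * f' z"
      by blast
    then show ?thesis using greater by (intro exI[of _ z]) (auto simp: algebra_simps)
  qed (auto intro: exI[of _ x])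
  have lip': "\<bar>deriv F (x + d) - deriv F x\<bar> \<le> B * \<bar>d\<bar>" for x d
    using mvt[of "deriv F", OF ddF, of x d] B by (auto simp: abs_mult intro!: mult_right_mono)
  \<comment> \<open>F grows by at most 1 over a unit interval, so its derivative is at most 1 in
    modulus somewhere within distance 1 of any point, and it varies by at most B over that distance.
    The same constant then serves for the second-order error.\<close>
  define L where "L = 1 + B"
  have bd: "\<bar>deriv F x\<bar> \<le> L" for x
  proof -
    obtain \<xi> where \<xi>: "\<bar>\<xi> - x\<bar> \<le> 1" "F (x + 1) - F x = deriv F \<xi>"
      using mvt[of F, OF dF, of x 1] by auto
    have "\<bar>deriv F \<xi> - deriv F x\<bar> \<le> B * 1"
      using lip'[of x "\<xi> - x"] mult_left_mono[OF \<xi>(1) B0] by auto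
    moreover have "\<bar>deriv F \<xi>\<bar> \<le> 1" using \<xi>(2) F01[of x] F01[of "x+1"] by linarith
    ultimately show ?thesis unfolding L_def by linarith
  qed
  show thesis
  proof
    show "L \<ge> 0" using B0 by (simp add: L_def)
    show "\<bar>deriv F x\<bar> \<le> L" for x by (rule bd)
    show "\<bar>F x - F y\<bar> \<le> L * \<bar>x - y\<bar>" for x y
      using mvt[of F, OF dF, of y "x - y"] bd by (auto simp: abs_mult intro!: mult_right_mono)
    show "\<bar>F (x + d) - F x - deriv F x * d\<bar> \<le> L * d\<^sup>2" for x d
    proof -
      obtain \<xi> where \<xi>: "\<bar>\<xi> - x\<bar> \<le> \<bar>d\<bar>" "F (x + d) - F x = deriv F \<xi> * d"
        using mvt[of F, OF dF, of x d] by auto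
      have "\<bar>deriv F \<xi> - deriv F x\<bar> \<le> B * \<bar>d\<bar>"
        using lip'[of x "\<xi> - x"] mult_left_mono[OF \<xi>(1) B0] by auto
      then have "\<bar>deriv F \<xi> - deriv F x\<bar> * \<bar>d\<bar> \<le> B * \<bar>d\<bar> * \<bar>d\<bar>"
        by (intro mult_right_mono) auto
      also have "\<dots> \<le> L * d\<^sup>2" by (simp add: L_def power2_eq_square mult.assoc algebra_simps)
      finally show ?thesis using \<xi>(2) by (simp add: abs_mult[symmetric] algebra_simps)
    qed
  qed
qed

text \<open>A zero z of 1 minus the sum would make 1/z a root of the characteristic equation outside
  the open unit disc; z = 0 has no reciprocal and is treated apart.\<close>

lemma ar_polynomial_nonzero:
  assumes "roots_inside_unit_disc p \<beta>" "cmod z \<le> 1"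
  shows "(\<Sum>j=1..p. complex_of_real (\<beta> j) * z ^ j) \<noteq> 1"
proof (cases "z = 0")
  case True
  then show ?thesis by (simp add: power_0_left)
next
  case False
  define w where "w = inverse z"
  have w: "cmod w \<ge> 1" using assms(2) False by (simp add: w_def norm_inverse one_le_inverse)
  have "w ^ p - (\<Sum>j=1..p. complex_of_real (\<beta> j) * w ^ (p - j)) \<noteq> 0"
    using assms(1) w by (auto simp: roots_inside_unit_disc_def)
  moreover have "(\<Sum>j=1..p. complex_of_real (\<beta> j) * w ^ (p - j))
      = w ^ p * (\<Sum>j=1..p. complex_of_real (\<beta> j) * z ^ j)"
    unfolding sum_distrib_left
    by (intro sum.cong) (auto simp: w_def power_diff False divide_simps)
  ultimately show ?thesis by (auto simp: algebra_simps)
qed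

text \<open>The numbers c k are the power series coefficients of the reciprocal of 1 minus the
  autoregressive polynomial. The zeros of that polynomial form a closed set disjoint from the closed
  unit disc, hence at positive distance d from it, so the reciprocal has radius of convergence at
  least 1 + d and its coefficients are absolutely summable. Integer indices with c = 0 on the
  negatives let one recursion cover small k as well.\<close>

lemma ar_impulse_response:
  assumes "roots_inside_unit_disc p \<beta>"
  obtains c :: "int \<Rightarrow> real" where
    "\<And>k. k < 0 \<Longrightarrow> c k = 0" "c 0 = 1"
    "\<And>k. k > 0 \<Longrightarrow> c k = (\<Sum>j=1..p. \<beta> j * c (k - int j))"
    "summable (\<lambda>k. \<bar>c (int k)\<bar>)"
proof -
  define F :: "complex fps" where
    "F = Abs_fps (\<lambda>k. if k = 0 then 1 else if k \<le> p then - complex_of_real (\<beta> k) else 0)"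
  \<comment> \<open>F is a polynomial, so its radius of convergence is infinite and the radius of
    the reciprocal is governed by the zeros alone.\<close>
  have Fp: "F = fps_of_poly (\<Sum>k\<le>p. monom (fps_nth F k) k)"
    by (rule fps_ext) (auto simp: coeff_sum F_def if_distrib cong: if_cong)
  have rad: "fps_conv_radius F = \<infinity>"
    by (subst Fp) simp
  have eval: "eval_fps F z = 1 - (\<Sum>j=1..p. complex_of_real (\<beta> j) * z ^ j)" for z
  proof -
    have "eval_fps F z = (\<Sum>k\<le>p. fps_nth F k * z ^ k)"
      unfolding eval_fps_def by (rule suminf_finite) (auto simp: F_def)
    also have "\<dots> = (\<Sum>k\<in>insert 0 {1..p}. fps_nth F k * z ^ k)"
      by (intro sum.cong) auto
    also have "\<dots> = 1 + (\<Sum>k=1..p. fps_nth F k * z ^ k)" by (simp add: F_def)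
    also have "(\<Sum>k=1..p. fps_nth F k * z ^ k) = (\<Sum>k=1..p. - (complex_of_real (\<beta> k) * z ^ k))"
      by (intro sum.cong) (auto simp: F_def)
    finally show ?thesis by (simp add: sum_negf)
  qed
  have "closed {z. eval_fps F z = 0}"
    unfolding eval by (intro closed_Collect_eq continuous_intros)
  moreover have "cball 0 1 \<inter> {z. eval_fps F z = 0} = {}"
    using ar_polynomial_nonzero[OF assms] by (auto simp: eval)
  ultimately obtain d where d: "d > 0" "\<And>x y. cmod x \<le> 1 \<Longrightarrow> eval_fps F y = 0 \<Longrightarrow> d \<le> dist x y"
    using separate_compact_closed[of "cball 0 1" "{z. eval_fps F z = 0}"] by auto
  have nz: "eval_fps F z \<noteq> 0" if "ereal (norm z) < ereal (1 + d)" for z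
  proof
    assume z: "eval_fps F z = 0"
    have z1: "cmod z > 1" using d(2)[of z z] d(1) z by force
    then have z0: "cmod z \<noteq> 0" by linarith
    \<comment> \<open>Radial projection onto the unit circle: a zero of modulus below 1 + d would be
      closer than d to this point of the disc.\<close>
    define x where "x = z /\<^sub>R cmod z"
    have "dist x z = cmod ((inverse (cmod z) - 1) *\<^sub>R z)"
      unfolding x_def dist_norm scaleR_left_diff_distrib by simp
    also have "\<dots> = cmod z - 1" 
    proof -
      have "inverse (cmod z) \<le> 1" using z1 by (simp add: inverse_le_1_iff)
      then have "\<bar>inverse (cmod z) - 1\<bar> * cmod z = cmod z - inverse (cmod z) * cmod z"
        by (simp add: algebra_simps)
      then show ?thesis unfolding norm_scaleR using left_inverse[OF z0] by linarith
    qed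
    finally have "dist x z < d" using that by simp
    moreover have "cmod x \<le> 1" unfolding x_def norm_scaleR abs_inverse abs_norm_cancel
      by (simp only: left_inverse[OF z0] order.refl)
    ultimately show False using d(2)[of x z] z by simp
  qed
  define C where "C = inverse F"
  have "fps_conv_radius C \<ge> ereal (1 + d)"
    using fps_conv_radius_inverse[of "ereal (1 + d)" F] nz rad by (simp add: C_def)
  then have "ereal (1 + d) \<le> conv_radius (fps_nth C)" by (simp only: fps_conv_radius_def)
  moreover have "ereal (norm (1::complex)) < ereal (1 + d)" using d(1) by simp
  ultimately have "ereal (norm (1::complex)) < conv_radius (fps_nth C)" by order
  then have summ: "summable (\<lambda>k. norm (fps_nth C k))"
    using abs_summable_in_conv_radius[of 1 "fps_nth C"] by simp
  have FC: "F * C = 1"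
    unfolding C_def by (rule inverse_mult_eq_1') (simp add: F_def)
  \<comment> \<open>The coefficients of F are real, so real parts commute with the convolution and
    satisfy the same recursion.\<close>
  define c where "c k = (if k < 0 then 0 else Re (fps_nth C (nat k)))" for k :: int
  show thesis
  proof
    show "c k = 0" if "k < 0" for k using that by (simp add: c_def)
    have "fps_nth (F * C) 0 = 1" by (simp add: FC)
    then show "c 0 = 1" by (simp add: c_def F_def fps_mult_nth)
    show "c k = (\<Sum>j=1..p. \<beta> j * c (k - int j))" if "k > 0" for k
    proof -
      define m where "m = nat k"
      have m: "k = int m" "m > 0" using that by (auto simp: m_def)
      have "0 = Re (fps_nth (F * C) m)" using m by (simp add: FC)
      also have "\<dots> = (\<Sum>i=0..m. Re (fps_nth F i * fps_nth C (m - i)))"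
        by (simp add: fps_mult_nth)
      also have "\<dots> = (\<Sum>i=0..m. (if i = 0 then 1 else if i \<le> p then - \<beta> i else 0) * c (int m - int i))"
        by (intro sum.cong) (auto simp: F_def c_def nat_diff_distrib)
      also have "{0..m} = insert 0 {1..m}" by auto
      also have "(\<Sum>i\<in>insert 0 {1..m}. (if i = 0 then 1 else if i \<le> p then - \<beta> i else 0) * c (int m - int i))
         = c (int m) + (\<Sum>i=1..m. (if i \<le> p then - \<beta> i else 0) * c (int m - int i))"
        by (simp add: if_distrib cong: if_cong)
      \<comment> \<open>Extending the range to m + p adds only values of c at negative arguments;
        cutting it back to p then drops only zero coefficients of F. The detour treats m < p and m >
        p alike.\<close>
      also have "(\<Sum>i=1..m. (if i \<le> p then - \<beta> i else 0) * c (int m - int i))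
          = (\<Sum>i\<in>{1..m+p}. (if i \<le> p then - \<beta> i else 0) * c (int m - int i))"
        by (intro sum.mono_neutral_left) (auto simp: c_def)
      also have "\<dots> = (\<Sum>i=1..p. (if i \<le> p then - \<beta> i else 0) * c (int m - int i))"
        by (intro sum.mono_neutral_right) auto
      also have "\<dots> = - (\<Sum>i=1..p. \<beta> i * c (int m - int i))"
        by (simp add: sum_negf[symmetric])
      finally show ?thesis by (simp add: m)
    qed
    show "summable (\<lambda>k. \<bar>c (int k)\<bar>)"
      by (rule summable_comparison_test'[OF summ, of 0]) (auto simp: c_def abs_Re_le_cmod)
  qed
qed

text \<open>Repeated substitution of the recursion into itself. The remainder consists of p (p + 1)
  / 2 terms however large N is, each weighted by a value of c near N, so it disappears in the limit
  when c tends to zero.\<close>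

lemma ar_iterated_recursion:
  fixes c :: "int \<Rightarrow> real" and X e :: "int \<Rightarrow> real"
  assumes c: "\<And>k. k < 0 \<Longrightarrow> c k = 0" "c 0 = 1"
    "\<And>k. k > 0 \<Longrightarrow> c k = (\<Sum>j=1..p. \<beta> j * c (k - int j))"
    and X: "\<And>t. X t = (\<Sum>j=1..p. \<beta> j * X (t - int j)) + e t"
  shows "X t = (\<Sum>k\<le>N. c (int k) * e (t - int k)) +
    (\<Sum>j=1..p. \<beta> j * (\<Sum>i<j. c (int N - int i) * X (t - int N + int i - int j)))"
proof (induction N)
  case 0
  have "(\<Sum>i<j. c (- int i) * X (t + int i - int j)) = X (t - int j)" if "j \<in> {1..p}" for j
  proof -
    have "(\<Sum>i<j. c (- int i) * X (t + int i - int j)) = (\<Sum>i\<in>{0}. c (- int i) * X (t + int i - int j))"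
      using that by (intro sum.mono_neutral_right) (auto simp: c(1))
    then show ?thesis by (simp add: c(2))
  qed
  then show ?case using X[of t] by (simp add: c(2))
next
  case (Suc N)
  \<comment> \<open>Both sides are the sum over i \<le> j at N + 1, with the last or the first term
    split off. Summed against \<beta>, the last terms combine by the recursion of c and the first
    ones by the recursion of X; what remains is the new innovation term.\<close>
  have tel: "(\<Sum>i<j. c (int (Suc N) - int i) * X (t - int (Suc N) + int i - int j)) + c (int (Suc N) - int j) * X (t - int (Suc N))
    = c (int (Suc N)) * X (t - int (Suc N) - int j) + (\<Sum>i<j. c (int N - int i) * X (t - int N + int i - int j))" for j
  proof -
    have "(\<Sum>i<j. c (int (Suc N) - int i) * X (t - int (Suc N) + int i - int j)) + c (int (Suc N) - int j) * X (t - int (Suc N))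
      = (\<Sum>i<Suc j. c (int (Suc N) - int i) * X (t - int (Suc N) + int i - int j))" by simp
    also have "\<dots> = c (int (Suc N)) * X (t - int (Suc N) - int j)
      + (\<Sum>i<j. c (int (Suc N) - int (Suc i)) * X (t - int (Suc N) + int (Suc i) - int j))"
      by (subst sum.lessThan_Suc_shift) simp
    finally show ?thesis by (simp add: algebra_simps)
  qed
  have "(\<Sum>j=1..p. \<beta> j * (\<Sum>i<j. c (int (Suc N) - int i) * X (t - int (Suc N) + int i - int j)))
    = (\<Sum>j=1..p. c (int (Suc N)) * (\<beta> j * X (t - int (Suc N) - int j)) + \<beta> j * (\<Sum>i<j. c (int N - int i) * X (t - int N + int i - int j))
       - \<beta> j * c (int (Suc N) - int j) * X (t - int (Suc N)))"
  proof (intro sum.cong refl)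
    fix j
    show "\<beta> j * (\<Sum>i<j. c (int (Suc N) - int i) * X (t - int (Suc N) + int i - int j))
      = c (int (Suc N)) * (\<beta> j * X (t - int (Suc N) - int j)) + \<beta> j * (\<Sum>i<j. c (int N - int i) * X (t - int N + int i - int j))
       - \<beta> j * c (int (Suc N) - int j) * X (t - int (Suc N))" (is "_ * ?S = ?a * (_ * ?b) + _ * ?T - _ * ?u * ?v")
    proof -
      have S: "?S = ?a * ?b + ?T - ?u * ?v"
        using tel[of j] by linarith
      show ?thesis unfolding S by (simp only: algebra_simps)
    qed
  qed
  also have "\<dots> = c (int (Suc N)) * (\<Sum>j=1..p. \<beta> j * X (t - int (Suc N) - int j))
      + (\<Sum>j=1..p. \<beta> j * (\<Sum>i<j. c (int N - int i) * X (t - int N + int i - int j)))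
      - (\<Sum>j=1..p. \<beta> j * c (int (Suc N) - int j)) * X (t - int (Suc N))"
    by (simp only: sum.distrib sum_subtractf sum_distrib_left sum_distrib_right)
  also have "(\<Sum>j=1..p. \<beta> j * c (int (Suc N) - int j)) = c (int (Suc N))"
    using c(3)[of "int (Suc N)"] by simp
  also have "(\<Sum>j=1..p. \<beta> j * X (t - int (Suc N) - int j)) = X (t - int (Suc N)) - e (t - int (Suc N))"
    using X[of "t - int (Suc N)"] by simp
  finally show ?case using Suc.IH by (simp add: algebra_simps)
qed

section \<open>Independence of past and present\<close>

text \<open>Finitely many coordinate events are grouped by family. Within a family they form one
  cylinder event of the path, so the independence of the paths factorises over families, and the
  independence inside each family then factorises over times.\<close>

lemma (in prob_space) indep_vars_blocks:
  fixes X :: "'k \<Rightarrow> 'i \<Rightarrow> 'a \<Rightarrow> 'b::topological_space"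
  assumes blocks: "indep_vars (\<lambda>_. \<Pi>\<^sub>M i\<in>UNIV. borel) (\<lambda>k \<omega> i. X k i \<omega>) K"
    and within: "\<And>k. k \<in> K \<Longrightarrow> indep_vars (\<lambda>_. borel) (X k) UNIV"
  shows "indep_vars (\<lambda>_. borel) (\<lambda>(k, i). X k i) (K \<times> UNIV)"
  unfolding indep_vars_def2
proof (intro conjI ballI)
  fix j assume "j \<in> K \<times> (UNIV :: 'i set)"
  then show "random_variable borel (case j of (k, i) \<Rightarrow> X k i)"
    using within by (auto simp: indep_vars_def2)
next
  have rv: "random_variable borel (X k i)" if "k \<in> K" for k i
    using within[OF that] by (auto simp: indep_vars_def2)
  show "indep_sets (\<lambda>j. {(case j of (k, i) \<Rightarrow> X k i) -` A \<inter> space M |A. A \<in> sets borel}) (K \<times> UNIV)"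
    unfolding indep_sets_def
  proof (intro conjI ballI allI impI)
    fix j assume "j \<in> K \<times> (UNIV :: 'i set)"
    then show "{(case j of (k, i) \<Rightarrow> X k i) -` A \<inter> space M |A. A \<in> sets borel} \<subseteq> events"
      using rv by (auto intro: measurable_sets)
  next
    fix J A assume J: "J \<subseteq> K \<times> (UNIV :: 'i set)" "J \<noteq> {}" "finite J"
      and A: "A \<in> (\<Pi> j\<in>J. {(case j of (k, i) \<Rightarrow> X k i) -` A \<inter> space M |A. A \<in> sets borel})"
    have "\<forall>j\<in>J. \<exists>B. B \<in> sets borel \<and> A j = X (fst j) (snd j) -` B \<inter> space M"
      using A by (fastforce simp: Pi_iff split_beta)
    then obtain B where B: "\<And>j. j \<in> J \<Longrightarrow> B j \<in> sets borel"
      "\<And>j. j \<in> J \<Longrightarrow> A j = X (fst j) (snd j) -` B j \<inter> space M"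
      by metis
    define S where "S k = {i. (k, i) \<in> J}" for k
    define E where "E k = {w. \<forall>i\<in>S k. w i \<in> B (k, i)}" for k
    have finS: "finite (S k)" for k
      using finite_vimageI[OF J(3), of "Pair k"] by (auto simp: S_def vimage_def inj_on_def)
    have Jeq: "J = (SIGMA k:fst ` J. S k)" by (force simp: S_def)
    have E: "E k \<in> sets (\<Pi>\<^sub>M i\<in>UNIV. borel)" for k
    proof -
      have "{w \<in> space (\<Pi>\<^sub>M i\<in>UNIV. borel). \<forall>i\<in>S k. w i \<in> B (k, i)} \<in> sets (\<Pi>\<^sub>M i\<in>UNIV. borel)"
      proof (rule sets.sets_Collect_finite_All[OF _ finS])
        fix i assume "i \<in> S k"
        then have "B (k, i) \<in> sets borel" using B(1) by (auto simp: S_def)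
        then show "{w \<in> space (\<Pi>\<^sub>M i\<in>UNIV. borel). w i \<in> B (k, i)} \<in> sets (\<Pi>\<^sub>M i\<in>UNIV. borel)"
          by measurable
      qed
      then show ?thesis by (simp add: E_def space_PiM PiE_def)
    qed
    have "(\<Inter>j\<in>J. A j) = (\<Inter>k\<in>fst ` J. (\<lambda>\<omega> i. X k i \<omega>) -` E k \<inter> space M)" (is "?L = ?R")
    proof -
      have "?L = {\<omega> \<in> space M. \<forall>j\<in>J. X (fst j) (snd j) \<omega> \<in> B j}"
        using J(2) by (simp add: B(2)) blast
      also have "\<dots> = {\<omega> \<in> space M. \<forall>k\<in>fst ` J. \<forall>i\<in>S k. X k i \<omega> \<in> B (k, i)}"
        by (force simp: S_def)
      also have "\<dots> = ?R"
        using J(2) by (simp add: E_def) blast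
      finally show ?thesis .
    qed
    then have "prob (\<Inter>j\<in>J. A j) = prob (\<Inter>k\<in>fst ` J. (\<lambda>\<omega> i. X k i \<omega>) -` E k \<inter> space M)"
      by simp
    also have "\<dots> = (\<Prod>k\<in>fst ` J. prob ((\<lambda>\<omega> i. X k i \<omega>) -` E k \<inter> space M))"
      by (rule indep_varsD[OF blocks]) (use J E in auto)
    also have "\<dots> = (\<Prod>k\<in>fst ` J. \<Prod>i\<in>S k. prob (A (k, i)))"
    proof (intro prod.cong refl)
      fix k assume k: "k \<in> fst ` J"
      then have ne: "S k \<noteq> {}" and kK: "k \<in> K" using J(1) by (auto simp: S_def)
      have "prob ((\<lambda>\<omega> i. X k i \<omega>) -` E k \<inter> space M) = prob (\<Inter>i\<in>S k. X k i -` B (k, i) \<inter> space M)"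
        using ne by (intro arg_cong[where f=prob]) (auto simp: E_def)
      also have "\<dots> = (\<Prod>i\<in>S k. prob (X k i -` B (k, i) \<inter> space M))"
        by (rule indep_varsD[OF within[OF kK]]) (use ne finS B(1) in \<open>auto simp: S_def\<close>)
      finally show "prob ((\<lambda>\<omega> i. X k i \<omega>) -` E k \<inter> space M) = (\<Prod>i\<in>S k. prob (A (k, i)))"
        by (simp add: B(2) S_def)
    qed
    also have "\<dots> = (\<Prod>j\<in>J. prob (A j))"
    proof -
      have "(\<Prod>k\<in>fst ` J. \<Prod>i\<in>S k. prob (A (k, i))) = (\<Prod>(k, i)\<in>(SIGMA k:fst ` J. S k). prob (A (k, i)))"
        by (rule prod.Sigma) (use J(3) finS in auto)
      then show ?thesis unfolding Jeq[symmetric] by (simp add: split_beta)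
    qed
    finally show "prob (\<Inter>j\<in>J. A j) = (\<Prod>j\<in>J. prob (A j))" .
  qed
qed

text \<open>Encoded as a pull-back of the product algebra: its sets are then literally preimages
  under the restricted family, the form in which independence of disjoint subfamilies is
  available.\<close>

definition generated_algebra :: "'a measure \<Rightarrow> ('i \<Rightarrow> 'a \<Rightarrow> real) \<Rightarrow> 'i set \<Rightarrow> 'a measure" where
  "generated_algebra M X S =
     vimage_algebra (space M) (\<lambda>\<omega>. restrict (\<lambda>i. X i \<omega>) S) (\<Pi>\<^sub>M i\<in>S. borel)"

lemma space_generated_algebra [simp]: "space (generated_algebra M X S) = space M"
  by (simp add: generated_algebra_def)

lemma measurable_generated_algebra:
  assumes "i \<in> S"
  shows "X i \<in> borel_measurable (generated_algebra M X S)"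
proof -
  have "(\<lambda>\<omega>. restrict (\<lambda>i. X i \<omega>) S) \<in> generated_algebra M X S \<rightarrow>\<^sub>M (\<Pi>\<^sub>M i\<in>S. borel)"
    unfolding generated_algebra_def
    by (rule measurable_vimage_algebra1) (auto simp: space_PiM)
  from measurable_compose[OF this measurable_component_singleton[OF assms]]
  show ?thesis using assms by simp
qed

lemma sets_generated_algebra:
  "sets (generated_algebra M X S) =
    {(\<lambda>\<omega>. restrict (\<lambda>i. X i \<omega>) S) -` A \<inter> space M | A. A \<in> sets (\<Pi>\<^sub>M i\<in>S. borel)}"
  unfolding generated_algebra_def
  by (rule sets_vimage_algebra2) (auto simp: space_PiM)

lemma sets_generated_algebra_subset:
  assumes "\<And>i. i \<in> S \<Longrightarrow> X i \<in> borel_measurable M"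
  shows "sets (generated_algebra M X S) \<subseteq> sets M"
proof -
  have "(\<lambda>\<omega>. restrict (\<lambda>i. X i \<omega>) S) \<in> M \<rightarrow>\<^sub>M (\<Pi>\<^sub>M i\<in>S. borel)"
    using assms by (rule measurable_restrict)
  then show ?thesis by (auto simp: sets_generated_algebra intro: measurable_sets)
qed

lemma measurable_generated_algebra_subset:
  assumes "f \<in> generated_algebra M X S \<rightarrow>\<^sub>M N" "\<And>i. i \<in> S \<Longrightarrow> X i \<in> borel_measurable M"
  shows "f \<in> M \<rightarrow>\<^sub>M N"
proof (rule measurableI)
  show "f \<omega> \<in> space N" if "\<omega> \<in> space M" for \<omega>
    using measurable_space[OF assms(1)] that by simp
  show "f -` A \<inter> space M \<in> sets M" if "A \<in> sets N" for A
    using measurable_sets[OF assms(1) that] sets_generated_algebra_subset[of S X M, OF assms(2)]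
    by auto
qed

text \<open>Subfamilies over disjoint index sets are independent, and preimages under f and g
  already lie in the algebras these subfamilies generate. With identity maps for f and g this is
  independence of the two algebras themselves.\<close>

lemma (in prob_space) indep_var_generated_algebra:
  assumes X: "indep_vars (\<lambda>_. borel) X I" and AB: "A \<inter> B = {}" "A \<subseteq> I" "B \<subseteq> I"
    and f: "f \<in> generated_algebra M X A \<rightarrow>\<^sub>M (N1 :: 'c measure)" and g: "g \<in> generated_algebra M X B \<rightarrow>\<^sub>M N2"
  shows "indep_var N1 f N2 g"
proof -
  have rv: "X i \<in> borel_measurable M" if "i \<in> I" for i
    using X that by (auto simp: indep_vars_def2)
  have *: "indep_set
      (sigma_sets (space M) {(\<lambda>\<omega>. restrict (\<lambda>i. X i \<omega>) A) -` S \<inter> space M | S. S \<in> sets (\<Pi>\<^sub>M i\<in>A. borel)})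
      (sigma_sets (space M) {(\<lambda>\<omega>. restrict (\<lambda>i. X i \<omega>) B) -` S \<inter> space M | S. S \<in> sets (\<Pi>\<^sub>M i\<in>B. borel)})"
    using indep_var_restrict[OF X AB] unfolding indep_var_eq by auto
  have sub: "sigma_sets (space M) {h -` S \<inter> space M | S. S \<in> sets N}
     \<subseteq> sigma_sets (space M) {(\<lambda>\<omega>. restrict (\<lambda>i. X i \<omega>) C) -` S \<inter> space M | S. S \<in> sets (\<Pi>\<^sub>M i\<in>C. borel)}"
    if "h \<in> generated_algebra M X C \<rightarrow>\<^sub>M N" for h C and N :: "'z measure"
    unfolding sets_generated_algebra[symmetric]
    using measurable_sets[OF that] by (intro sigma_sets_mono') auto
  show ?thesis
    unfolding indep_var_eq
  proof (intro conjI)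
    show "random_variable N1 f" "random_variable N2 g"
      using measurable_generated_algebra_subset[OF f] measurable_generated_algebra_subset[OF g] AB rv
      by auto
    show "indep_set (sigma_sets (space M) {f -` A \<inter> space M |A. A \<in> sets N1})
     (sigma_sets (space M) {g -` A \<inter> space M |A. A \<in> sets N2})"
      using * unfolding indep_set_def
      by (rule indep_sets_mono_sets) (use sub[OF f] sub[OF g] in \<open>auto split: bool.splits\<close>)
  qed
qed

text \<open>
  Both arguments of \<^const>\<open>prob_space.indep_var\<close> must have the same type, so the independence of a
  random variable from a sub-\<open>\<sigma>\<close>-algebra is expressed through two identity maps.
\<close>

lemma (in prob_space) expectation_indicator_le_past:
  fixes X T g :: "'a \<Rightarrow> real"
  assumes indep: "indep_var F (\<lambda>\<omega>. \<omega>) G (\<lambda>\<omega>. \<omega>)" and X: "X \<in> borel_measurable G"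
    and T: "T \<in> borel_measurable F" and g: "g \<in> borel_measurable F" and bnd: "\<And>\<omega>. \<bar>g \<omega>\<bar> \<le> C"
  shows "expectation (\<lambda>\<omega>. g \<omega> * of_bool (X \<omega> \<le> T \<omega>))
       = expectation (\<lambda>\<omega>. g \<omega> * cdf (distr M borel X) (T \<omega>))"
proof -
  note [measurable] = T g X
  have F: "(\<lambda>\<omega>. \<omega>) \<in> M \<rightarrow>\<^sub>M F" and G: "(\<lambda>\<omega>. \<omega>) \<in> M \<rightarrow>\<^sub>M G"
    using indep_var_rv1[OF indep] indep_var_rv2[OF indep] by auto
  have XM: "X \<in> borel_measurable M" using measurable_compose[OF G X] by simp
  \<comment> \<open>Independence of the two algebras says that the diagonal map carries the
    probability to a product measure, which opens the way to Fubini.\<close>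
  have eq: "distr M F (\<lambda>\<omega>. \<omega>) \<Otimes>\<^sub>M distr M G (\<lambda>\<omega>. \<omega>) = distr M (F \<Otimes>\<^sub>M G) (\<lambda>\<omega>. (\<omega>, \<omega>))"
    using indep unfolding indep_var_distribution_eq by auto
  interpret D1: prob_space "distr M F (\<lambda>\<omega>. \<omega>)" by (rule prob_space_distr[OF F])
  interpret D2: prob_space "distr M G (\<lambda>\<omega>. \<omega>)" by (rule prob_space_distr[OF G])
  interpret P: pair_prob_space "distr M F (\<lambda>\<omega>. \<omega>)" "distr M G (\<lambda>\<omega>. \<omega>)" ..
  define f where "f = (\<lambda>(\<omega>, \<omega>'). g \<omega> * of_bool (X \<omega>' \<le> T \<omega>))"
  have f[measurable]: "f \<in> borel_measurable (F \<Otimes>\<^sub>M G)"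
    unfolding f_def of_bool_def by measurable
  have pm: "(\<lambda>\<omega>. (\<omega>, \<omega>)) \<in> M \<rightarrow>\<^sub>M (F \<Otimes>\<^sub>M G)"
    using F G by (rule measurable_Pair)
  have fb: "\<bar>f w\<bar> \<le> \<bar>C\<bar>" for w
    using bnd[of "fst w"] by (auto simp: f_def split_beta)
  have int: "integrable (distr M F (\<lambda>\<omega>. \<omega>) \<Otimes>\<^sub>M distr M G (\<lambda>\<omega>. \<omega>)) f"
    by (rule P.integrable_const_bound[of _ "\<bar>C\<bar>"]) (use fb f in auto)
  have "expectation (\<lambda>\<omega>. g \<omega> * of_bool (X \<omega> \<le> T \<omega>)) = expectation (\<lambda>\<omega>. f (\<omega>, \<omega>))"
    by (simp add: f_def)
  also have "\<dots> = (\<integral>w. f w \<partial>(distr M (F \<Otimes>\<^sub>M G) (\<lambda>\<omega>. (\<omega>, \<omega>))))"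
    by (rule integral_distr[symmetric, OF pm f])
  \<comment> \<open>Freeze the past in the outer integral: T and g become constants, and the inner
    integral is the distribution function of X at a fixed point.\<close>
  also have "\<dots> = (\<integral>\<omega>. (\<integral>\<omega>'. f (\<omega>, \<omega>') \<partial>distr M G (\<lambda>\<omega>. \<omega>)) \<partial>distr M F (\<lambda>\<omega>. \<omega>))"
    unfolding eq[symmetric] by (rule P.integral_fst'[symmetric, OF int])
  also have "\<dots> = (\<integral>\<omega>. g \<omega> * cdf (distr M borel X) (T \<omega>) \<partial>distr M F (\<lambda>\<omega>. \<omega>))"
  proof (intro Bochner_Integration.integral_cong refl)
    fix \<omega>
    have "(\<integral>\<omega>'. f (\<omega>, \<omega>') \<partial>distr M G (\<lambda>\<omega>. \<omega>)) = expectation (\<lambda>\<omega>'. g \<omega> * of_bool (X \<omega>' \<le> T \<omega>))"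
      unfolding f_def prod.case by (rule integral_distr[OF G]) (simp add: of_bool_def)
    also have "\<dots> = g \<omega> * expectation (indicator {\<omega>' \<in> space M. X \<omega>' \<le> T \<omega>})"
      by (subst integral_mult_right_zero[symmetric])
         (auto intro!: Bochner_Integration.integral_cong simp: indicator_def)
    also have "\<dots> = g \<omega> * cdf (distr M borel X) (T \<omega>)"
      using XM by (auto simp: cdf_def measure_distr vimage_def Int_def conj_commute)
    finally show "(\<integral>\<omega>'. f (\<omega>, \<omega>') \<partial>distr M G (\<lambda>\<omega>. \<omega>)) = g \<omega> * cdf (distr M borel X) (T \<omega>)" .
  qed
  also have "\<dots> = expectation (\<lambda>\<omega>. g \<omega> * cdf (distr M borel X) (T \<omega>))"
  proof (rule integral_distr[OF F])
    interpret R: real_distribution "distr M borel X" by (rule real_distribution_distr) (rule XM)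
    have [measurable]: "cdf (distr M borel X) \<in> borel_measurable borel"
      by (intro borel_measurable_mono) (auto simp: mono_def R.cdf_nondecreasing)
    show "(\<lambda>\<omega>. g \<omega> * cdf (distr M borel X) (T \<omega>)) \<in> borel_measurable F" by measurable
  qed
  finally show ?thesis .
qed

section \<open>Second moments and moving averages\<close>

text \<open>A Bernoulli choice between the two laws has the mixture distribution function and so
  equals D by uniqueness; integrals against this kernel split. The purpose is a second-moment bound
  for the innovations that is uniform in r.\<close>

lemma nn_integral_mixture_cdf:
  assumes P0: "real_distribution P0" and PH: "real_distribution PH" and D: "real_distribution D"
    and cdf: "\<And>x. cdf D x = mixture_cdf (cdf P0) (cdf PH) r x"
    and r: "0 \<le> r" "r \<le> 1" and f: "f \<in> borel_measurable borel"
  shows "(\<integral>\<^sup>+x. f x \<partial>D) = ennreal (1 - r) * (\<integral>\<^sup>+x. f x \<partial>P0) + ennreal r * (\<integral>\<^sup>+x. f x \<partial>PH)"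
proof -
  interpret P0: real_distribution P0 by fact
  interpret PH: real_distribution PH by fact
  interpret D: real_distribution D by fact
  define K where "K b = (if b then PH else P0)" for b
  define N where "N = measure_pmf (bernoulli_pmf r) \<bind> K"
  have K: "K \<in> measure_pmf (bernoulli_pmf r) \<rightarrow>\<^sub>M subprob_algebra borel"
  proof -
    have "K b \<in> space (subprob_algebra borel)" for b
      unfolding space_subprob_algebra K_def using P0.prob_space_axioms PH.prob_space_axioms
      by (auto intro: prob_space_imp_subprob_space simp del: P0.space_eq_univ PH.space_eq_univ)
    then show ?thesis by simp
  qed
  have N: "sets N = sets borel" unfolding N_def by (rule sets_bind) (auto simp: K_def P0.events_eq_borel PH.events_eq_borel)
  have em: "emeasure N A = ennreal (1 - r) * emeasure P0 A + ennreal r * emeasure PH A" if "A \<in> sets borel" for A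
    unfolding N_def using that r by (subst emeasure_bind[OF _ K]) (auto simp: K_def mult.commute add.commute)
  have prob: "prob_space N"
  proof
    show "emeasure N (space N) = 1"
      using em[of UNIV] P0.emeasure_space_1 PH.emeasure_space_1 r
      by (simp add: sets_eq_imp_space_eq[OF N] flip: ennreal_plus)
  qed
  have Nd: "real_distribution N"
    using prob N by (simp add: real_distribution_def real_distribution_axioms_def)
  have "D = N"
  proof (rule cdf_unique[OF D Nd], rule ext)
    fix x
    have "ennreal (cdf N x) = emeasure N {..x}"
      unfolding cdf_def by (rule finite_measure.emeasure_eq_measure[symmetric]) (simp add: prob_space.finite_measure prob)
    also have "\<dots> = ennreal ((1 - r) * cdf P0 x + r * cdf PH x)"
      using r by (simp add: em cdf_def P0.emeasure_eq_measure PH.emeasure_eq_measure ennreal_mult ennreal_plus)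
    finally have e: "ennreal (cdf N x) = ennreal ((1 - r) * cdf P0 x + r * cdf PH x)" .
    have "cdf N x = (1 - r) * cdf P0 x + r * cdf PH x"
      using e by (rule ennreal_inj[THEN iffD1, rotated 2]) (use r in \<open>simp_all add: cdf_def\<close>)
    then show "cdf D x = cdf N x" by (simp add: cdf mixture_cdf_def)
  qed
  then have "(\<integral>\<^sup>+x. f x \<partial>D) = (\<integral>\<^sup>+b. \<integral>\<^sup>+x. f x \<partial>K b \<partial>measure_pmf (bernoulli_pmf r))"
    unfolding N_def using nn_integral_bind[OF f K] by simp
  also have "\<dots> = ennreal (1 - r) * (\<integral>\<^sup>+x. f x \<partial>P0) + ennreal r * (\<integral>\<^sup>+x. f x \<partial>PH)"
    using r by (simp add: K_def mult.commute add.commute)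
  finally show ?thesis .
qed

lemma (in prob_space) expectation_abs_le_sqrt:
  fixes Y :: "'a \<Rightarrow> real"
  assumes Y: "integrable M Y" "integrable M (\<lambda>\<omega>. (Y \<omega>)\<^sup>2)"
  shows "expectation (\<lambda>\<omega>. \<bar>Y \<omega>\<bar>) \<le> sqrt (expectation (\<lambda>\<omega>. (Y \<omega>)\<^sup>2))"
proof -
  have "0 \<le> variance (\<lambda>\<omega>. \<bar>Y \<omega>\<bar>)" by (rule variance_positive)
  also have "\<dots> = expectation (\<lambda>\<omega>. (Y \<omega>)\<^sup>2) - (expectation (\<lambda>\<omega>. \<bar>Y \<omega>\<bar>))\<^sup>2"
    using Y by (subst variance_eq) auto
  finally show ?thesis by (intro real_le_rsqrt) simp
qed

lemma (in prob_space) expectation_sum_orthogonal: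
  fixes Y :: "int \<Rightarrow> 'a \<Rightarrow> real"
  assumes I: "finite I" and int: "\<And>s t. s \<in> I \<Longrightarrow> t \<in> I \<Longrightarrow> integrable M (\<lambda>\<omega>. Y s \<omega> * Y t \<omega>)"
    and orth: "\<And>s t. s \<in> I \<Longrightarrow> t \<in> I \<Longrightarrow> s < t \<Longrightarrow> expectation (\<lambda>\<omega>. Y s \<omega> * Y t \<omega>) = 0"
  shows "expectation (\<lambda>\<omega>. (\<Sum>t\<in>I. Y t \<omega>)\<^sup>2) = (\<Sum>t\<in>I. expectation (\<lambda>\<omega>. (Y t \<omega>)\<^sup>2))"
    and "integrable M (\<lambda>\<omega>. (\<Sum>t\<in>I. Y t \<omega>)\<^sup>2)"
proof -
  have sq: "(\<Sum>t\<in>I. Y t \<omega>)\<^sup>2 = (\<Sum>s\<in>I. \<Sum>t\<in>I. Y s \<omega> * Y t \<omega>)" for \<omega>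
    by (simp add: power2_eq_square sum_product)
  show "integrable M (\<lambda>\<omega>. (\<Sum>t\<in>I. Y t \<omega>)\<^sup>2)"
    unfolding sq by (intro Bochner_Integration.integrable_sum int)
  have "expectation (\<lambda>\<omega>. (\<Sum>t\<in>I. Y t \<omega>)\<^sup>2) = (\<Sum>s\<in>I. \<Sum>t\<in>I. expectation (\<lambda>\<omega>. Y s \<omega> * Y t \<omega>))"
    unfolding sq by (simp add: int)
  also have "\<dots> = (\<Sum>s\<in>I. expectation (\<lambda>\<omega>. (Y s \<omega>)\<^sup>2))"
  proof (intro sum.cong refl)
    fix s assume s: "s \<in> I"
    have "expectation (\<lambda>\<omega>. Y s \<omega> * Y t \<omega>) = 0" if "t \<in> I - {s}" for t
      using orth[of s t] orth[of t s] that s by (cases s t rule: linorder_cases) (auto simp: mult.commute)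
    then show "(\<Sum>t\<in>I. expectation (\<lambda>\<omega>. Y s \<omega> * Y t \<omega>)) = expectation (\<lambda>\<omega>. (Y s \<omega>)\<^sup>2)"
      using s I by (subst sum.remove[of _ s]) (auto simp: power2_eq_square)
  qed
  finally show "expectation (\<lambda>\<omega>. (\<Sum>t\<in>I. Y t \<omega>)\<^sup>2) = (\<Sum>t\<in>I. expectation (\<lambda>\<omega>. (Y t \<omega>)\<^sup>2))" .
qed

text \<open>Cauchy-Schwarz for the factorisation of d k * e k into
  \<open>sgn (d k) * sqrt \<bar>d k\<bar>\<close> and \<open>sqrt \<bar>d k\<bar> * e k\<close>,
  first for partial sums and then in the limit.\<close>

lemma suminf_weighted_square_le:
  fixes d e :: "nat \<Rightarrow> real"
  assumes d: "summable (\<lambda>k. \<bar>d k\<bar>)" and de: "summable (\<lambda>k. \<bar>d k\<bar> * (e k)\<^sup>2)"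
  shows "summable (\<lambda>k. d k * e k)" "(\<Sum>k. d k * e k)\<^sup>2 \<le> (\<Sum>k. \<bar>d k\<bar>) * (\<Sum>k. \<bar>d k\<bar> * (e k)\<^sup>2)"
proof -
  have "\<bar>x\<bar> \<le> 1 + x\<^sup>2" for x :: real
    using zero_le_power2[of "\<bar>x\<bar> - 1"] by (simp add: power2_eq_square algebra_simps)
  then have *: "norm (d k * e k) \<le> \<bar>d k\<bar> + \<bar>d k\<bar> * (e k)\<^sup>2" for k
    using mult_left_mono[of "\<bar>e k\<bar>" "1 + (e k)\<^sup>2" "\<bar>d k\<bar>"] by (simp add: abs_mult algebra_simps)
  show sm: "summable (\<lambda>k. d k * e k)"
    by (rule summable_comparison_test'[OF summable_add[OF d de], of 0]) (use * in auto)
  show "(\<Sum>k. d k * e k)\<^sup>2 \<le> (\<Sum>k. \<bar>d k\<bar>) * (\<Sum>k. \<bar>d k\<bar> * (e k)\<^sup>2)"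
  proof (rule LIMSEQ_le_const2)
    show "(\<lambda>n. (\<Sum>k<n. d k * e k)\<^sup>2) \<longlonglongrightarrow> (\<Sum>k. d k * e k)\<^sup>2"
      by (intro tendsto_power summable_LIMSEQ sm)
    show "\<exists>N. \<forall>n\<ge>N. (\<Sum>k<n. d k * e k)\<^sup>2 \<le> (\<Sum>k. \<bar>d k\<bar>) * (\<Sum>k. \<bar>d k\<bar> * (e k)\<^sup>2)"
    proof (intro exI allI impI)
      fix n :: nat
      have "(\<Sum>k<n. d k * e k)\<^sup>2 = (\<Sum>k<n. (sgn (d k) * sqrt \<bar>d k\<bar>) * (sqrt \<bar>d k\<bar> * e k))\<^sup>2"
      proof -
        have "(sgn x * sqrt \<bar>x\<bar>) * (sqrt \<bar>x\<bar> * y) = sgn x * (sqrt \<bar>x\<bar> * sqrt \<bar>x\<bar>) * y" for x y :: real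
          by (simp only: mult.assoc)
        then show ?thesis by (simp only: real_sqrt_mult_self abs_idempotent sgn_mult_abs)
      qed
      also have "\<dots> \<le> (\<Sum>k<n. (sgn (d k) * sqrt \<bar>d k\<bar>)\<^sup>2) * (\<Sum>k<n. (sqrt \<bar>d k\<bar> * e k)\<^sup>2)"
        by (rule Cauchy_Schwarz_ineq_sum)
      also have "(\<Sum>k<n. (sgn (d k) * sqrt \<bar>d k\<bar>)\<^sup>2) = (\<Sum>k<n. \<bar>d k\<bar>)"
        by (intro sum.cong) (auto simp: power_mult_distrib sgn_if)
      also have "(\<Sum>k<n. (sqrt \<bar>d k\<bar> * e k)\<^sup>2) = (\<Sum>k<n. \<bar>d k\<bar> * (e k)\<^sup>2)"
        by (intro sum.cong) (auto simp: power_mult_distrib)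
      also have "(\<Sum>k<n. \<bar>d k\<bar>) * (\<Sum>k<n. \<bar>d k\<bar> * (e k)\<^sup>2) \<le> (\<Sum>k. \<bar>d k\<bar>) * (\<Sum>k. \<bar>d k\<bar> * (e k)\<^sup>2)"
        by (intro mult_mono sum_le_suminf d de suminf_nonneg sum_nonneg) auto
      finally show "(\<Sum>k<n. d k * e k)\<^sup>2 \<le> (\<Sum>k. \<bar>d k\<bar>) * (\<Sum>k. \<bar>d k\<bar> * (e k)\<^sup>2)" .
    qed
  qed
qed

text \<open>The sum of |d k| times the squared e k has finite mean and is thus almost surely finite,
  after which the weighted Cauchy-Schwarz inequality applies pathwise. Only a common second-moment
  bound on e enters, so the same lemma applies to the innovations and to their partial sums over
  time.\<close>

lemma (in prob_space) AE_summable_moving_average: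
  fixes d :: "nat \<Rightarrow> real" and e :: "nat \<Rightarrow> 'a \<Rightarrow> real"
  assumes d: "summable (\<lambda>k. \<bar>d k\<bar>)" and e[measurable]: "\<And>k. e k \<in> borel_measurable M"
    and S: "\<And>k. (\<integral>\<^sup>+\<omega>. ennreal ((e k \<omega>)\<^sup>2) \<partial>M) \<le> ennreal S" "S \<ge> 0"
  shows "AE \<omega> in M. summable (\<lambda>k. d k * e k \<omega>)"
    and "(\<integral>\<^sup>+\<omega>. ennreal ((\<Sum>k. d k * e k \<omega>)\<^sup>2) \<partial>M) \<le> ennreal ((\<Sum>k. \<bar>d k\<bar>)\<^sup>2 * S)"
proof -
  define D where "D = (\<Sum>k. \<bar>d k\<bar>)"
  have D: "D \<ge> 0" unfolding D_def by (intro suminf_nonneg d) auto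
  have "(\<integral>\<^sup>+\<omega>. (\<Sum>k. ennreal (\<bar>d k\<bar> * (e k \<omega>)\<^sup>2)) \<partial>M) = (\<Sum>k. \<integral>\<^sup>+\<omega>. ennreal (\<bar>d k\<bar> * (e k \<omega>)\<^sup>2) \<partial>M)"
    by (rule nn_integral_suminf) measurable
  also have "\<dots> = (\<Sum>k. ennreal \<bar>d k\<bar> * (\<integral>\<^sup>+\<omega>. ennreal ((e k \<omega>)\<^sup>2) \<partial>M))"
    by (intro suminf_cong) (simp add: ennreal_mult nn_integral_cmult)
  also have "\<dots> \<le> (\<Sum>k. ennreal (\<bar>d k\<bar> * S))"
    using S by (intro suminf_le) (auto simp: ennreal_mult intro!: mult_left_mono)
  also have "\<dots> = ennreal (D * S)"
    unfolding D_def using d S(2) by (subst suminf_ennreal2) (auto intro!: summable_mult2 simp: suminf_mult2)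
  finally have bound: "(\<integral>\<^sup>+\<omega>. (\<Sum>k. ennreal (\<bar>d k\<bar> * (e k \<omega>)\<^sup>2)) \<partial>M) \<le> ennreal (D * S)" .
  have "(\<integral>\<^sup>+\<omega>. (\<Sum>k. ennreal (\<bar>d k\<bar> * (e k \<omega>)\<^sup>2)) \<partial>M) \<noteq> \<infinity>"
    using order.strict_trans1[OF bound ennreal_less_top] by auto
  then have "AE \<omega> in M. (\<Sum>k. ennreal (\<bar>d k\<bar> * (e k \<omega>)\<^sup>2)) \<noteq> \<infinity>"
    by (intro nn_integral_PInf_AE) auto
  then have sm: "AE \<omega> in M. summable (\<lambda>k. \<bar>d k\<bar> * (e k \<omega>)\<^sup>2)"
    by eventually_elim (auto intro!: summable_suminf_not_top)
  then show "AE \<omega> in M. summable (\<lambda>k. d k * e k \<omega>)"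
    by eventually_elim (rule suminf_weighted_square_le(1)[OF d])
  have "(\<integral>\<^sup>+\<omega>. ennreal ((\<Sum>k. d k * e k \<omega>)\<^sup>2) \<partial>M)
      \<le> (\<integral>\<^sup>+\<omega>. ennreal D * (\<Sum>k. ennreal (\<bar>d k\<bar> * (e k \<omega>)\<^sup>2)) \<partial>M)"
  proof (rule nn_integral_mono_AE, use sm in eventually_elim)
    fix \<omega> assume *: "summable (\<lambda>k. \<bar>d k\<bar> * (e k \<omega>)\<^sup>2)"
    have "ennreal ((\<Sum>k. d k * e k \<omega>)\<^sup>2) \<le> ennreal (D * (\<Sum>k. \<bar>d k\<bar> * (e k \<omega>)\<^sup>2))"
      unfolding D_def by (intro ennreal_leI suminf_weighted_square_le(2)[OF d *])
    also have "\<dots> = ennreal D * (\<Sum>k. ennreal (\<bar>d k\<bar> * (e k \<omega>)\<^sup>2))"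
    proof -
      have "(\<Sum>k. ennreal (\<bar>d k\<bar> * (e k \<omega>)\<^sup>2)) = ennreal (\<Sum>k. \<bar>d k\<bar> * (e k \<omega>)\<^sup>2)"
        by (rule suminf_ennreal2) (use * in auto)
      then show ?thesis by (simp only: ennreal_mult'[OF D])
    qed
    finally show "ennreal ((\<Sum>k. d k * e k \<omega>)\<^sup>2) \<le> ennreal D * (\<Sum>k. ennreal (\<bar>d k\<bar> * (e k \<omega>)\<^sup>2))" .
  qed
  also have "\<dots> \<le> ennreal D * ennreal (D * S)"
    using bound by (subst nn_integral_cmult) (auto intro: mult_left_mono)
  also have "\<dots> = ennreal (D\<^sup>2 * S)"
    using D S(2) by (simp add: ennreal_mult[symmetric] power2_eq_square mult.assoc)
  finally show "(\<integral>\<^sup>+\<omega>. ennreal ((\<Sum>k. d k * e k \<omega>)\<^sup>2) \<partial>M) \<le> ennreal ((\<Sum>k. \<bar>d k\<bar>)\<^sup>2 * S)"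
    unfolding D_def .
qed

section \<open>Causal representation of the stationary solution\<close>

lemma strictly_stationary_distr_eq:
  assumes "strictly_stationary M X"
  shows "distr M borel (X t) = distr M borel (X 0)"
proof -
  have [measurable]: "X s \<in> borel_measurable M" for s
    using assms by (auto simp: strictly_stationary_def)
  have pm: "path (\<lambda>s. X (s + h)) \<in> M \<rightarrow>\<^sub>M (\<Pi>\<^sub>M t\<in>UNIV. borel)" for h
    unfolding path_def by (rule measurable_PiM_single') auto
  have "distr (distr M (\<Pi>\<^sub>M t\<in>UNIV. borel) (path (\<lambda>s. X (s + h)))) borel (\<lambda>w. w 0) = distr M borel (X h)" for h
    by (subst distr_distr[OF _ pm]) (auto simp: comp_def path_def)
  from this[of t] this[of 0] show ?thesis
    using assms by (simp add: strictly_stationary_def)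
qed

text \<open>The truncation \<open>min 1 \<bar>_\<bar>\<close> measures convergence in probability.
  Its subadditivity allows the remainder of the recursion to be treated term by term although no
  moments of the solution are known yet.\<close>

lemma min_1_abs_sum_le:
  fixes f :: "'i \<Rightarrow> real"
  shows "min 1 \<bar>sum f I\<bar> \<le> (\<Sum>i\<in>I. min 1 \<bar>f i\<bar>)"
proof (induction I rule: infinite_finite_induct)
  case (insert i I)
  then show ?case by (auto simp: min_def abs_if split: if_splits)
qed auto

text \<open>The remainder of the iterated recursion has finitely many terms, and since all X s share
  one law, the truncated mean of each depends only on its vanishing coefficient. The partial sums
  therefore tend to X t in probability, while they tend to the full series almost surely.\<close>

lemma (in prob_space) ar_solution_eq_moving_average:
  fixes X e :: "int \<Rightarrow> 'a \<Rightarrow> real" and c :: "int \<Rightarrow> real"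
  assumes c: "\<And>k. k < 0 \<Longrightarrow> c k = 0" "c 0 = 1"
    "\<And>k. k > 0 \<Longrightarrow> c k = (\<Sum>j=1..p. \<beta> j * c (k - int j))"
    "summable (\<lambda>k. \<bar>c (int k)\<bar>)"
    and X[measurable]: "\<And>t. X t \<in> borel_measurable M"
    and e[measurable]: "\<And>t. e t \<in> borel_measurable M"
    and distr: "\<And>t. distr M borel (X t) = distr M borel (X 0)"
    and rec: "AE \<omega> in M. \<forall>t. X t \<omega> = (\<Sum>j=1..p. \<beta> j * X (t - int j) \<omega>) + e t \<omega>"
    and summ: "\<And>t. AE \<omega> in M. summable (\<lambda>k. c (int k) * e (t - int k) \<omega>)"
  shows "AE \<omega> in M. X t \<omega> = (\<Sum>k. c (int k) * e (t - int k) \<omega>)"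
proof -
  define V where "V \<omega> = (\<Sum>k. c (int k) * e (t - int k) \<omega>)" for \<omega>
  have [measurable]: "V \<in> borel_measurable M" unfolding V_def by measurable
  define S where "S N \<omega> = (\<Sum>k\<le>N. c (int k) * e (t - int k) \<omega>)" for N \<omega>
  have [measurable]: "S N \<in> borel_measurable M" for N unfolding S_def by measurable
  \<comment> \<open>Finite for any random variable, and it tends to 0 with a by dominated
    convergence.\<close>
  define \<phi> where "\<phi> a = expectation (\<lambda>\<omega>. min 1 \<bar>a * X 0 \<omega>\<bar>)" for a :: real
  have bounded_int: "integrable M (\<lambda>\<omega>. min 1 \<bar>Y \<omega>\<bar>)" if [measurable]: "Y \<in> borel_measurable M" for Y :: "'a \<Rightarrow> real"
    by (rule integrable_const_bound[of _ 1]) auto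
  have \<phi>_shift: "expectation (\<lambda>\<omega>. min 1 \<bar>a * X s \<omega>\<bar>) = \<phi> a" for a s
  proof -
    have "expectation (\<lambda>\<omega>. min 1 \<bar>a * X s \<omega>\<bar>) = (\<integral>x. min 1 \<bar>a * x\<bar> \<partial>distr M borel (X s))" for s
      by (subst integral_distr) auto
    from this[of s] this[of 0] show ?thesis using distr[of s] by (simp add: \<phi>_def)
  qed
  have int_term: "integrable M (\<lambda>\<omega>. min 1 \<bar>a * X s \<omega>\<bar>)" for a s
    by (rule bounded_int) measurable
  have \<phi>_lim: "(\<lambda>N. \<phi> (a N)) \<longlonglongrightarrow> 0" if a: "a \<longlonglongrightarrow> 0" for a
  proof -
    have "(\<lambda>N. \<phi> (a N)) \<longlonglongrightarrow> expectation (\<lambda>\<omega>. 0)"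
      unfolding \<phi>_def
    proof (rule integral_dominated_convergence[where w="\<lambda>_. 1"])
      show "AE \<omega> in M. (\<lambda>N. min 1 \<bar>a N * X 0 \<omega>\<bar>) \<longlonglongrightarrow> 0"
      proof (rule AE_I2)
        fix \<omega>
        have "(\<lambda>N. min 1 \<bar>a N * X 0 \<omega>\<bar>) \<longlonglongrightarrow> min 1 \<bar>0 * X 0 \<omega>\<bar>"
          by (intro tendsto_intros a)
        then show "(\<lambda>N. min 1 \<bar>a N * X 0 \<omega>\<bar>) \<longlonglongrightarrow> 0" by simp
      qed
    qed auto
    then show ?thesis by simp
  qed
  have c_lim: "(\<lambda>N. c (int N - int i)) \<longlonglongrightarrow> 0" for i
  proof -
    have "(\<lambda>k. c (int k)) \<longlonglongrightarrow> 0"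
      using summable_LIMSEQ_zero[OF c(4)] by (simp add: tendsto_rabs_zero_iff)
    then have "(\<lambda>N. c (int (N + i) - int i)) \<longlonglongrightarrow> 0" by simp
    then show ?thesis by (rule LIMSEQ_offset)
  qed
  have le: "expectation (\<lambda>\<omega>. min 1 \<bar>X t \<omega> - S N \<omega>\<bar>)
      \<le> (\<Sum>j=1..p. \<Sum>i<j. \<phi> (\<beta> j * c (int N - int i)))" for N
  proof -
    have "expectation (\<lambda>\<omega>. min 1 \<bar>X t \<omega> - S N \<omega>\<bar>)
      \<le> expectation (\<lambda>\<omega>. \<Sum>j=1..p. \<Sum>i<j. min 1 \<bar>\<beta> j * c (int N - int i) * X (t - int N + int i - int j) \<omega>\<bar>)"
    proof (rule integral_mono_AE)
      show "AE \<omega> in M. min 1 \<bar>X t \<omega> - S N \<omega>\<bar>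
         \<le> (\<Sum>j=1..p. \<Sum>i<j. min 1 \<bar>\<beta> j * c (int N - int i) * X (t - int N + int i - int j) \<omega>\<bar>)"
        using rec
      proof eventually_elim
        fix \<omega> assume r: "\<forall>t. X t \<omega> = (\<Sum>j=1..p. \<beta> j * X (t - int j) \<omega>) + e t \<omega>"
        have "X t \<omega> = (\<Sum>k\<le>N. c (int k) * e (t - int k) \<omega>) +
            (\<Sum>j=1..p. \<beta> j * (\<Sum>i<j. c (int N - int i) * X (t - int N + int i - int j) \<omega>))"
          by (rule ar_iterated_recursion[of c \<beta> p "\<lambda>t. X t \<omega>" "\<lambda>t. e t \<omega>", OF c(1,2,3)])
             (use r in blast)+
        moreover have "(\<Sum>j=1..p. \<beta> j * (\<Sum>i<j. c (int N - int i) * X (t - int N + int i - int j) \<omega>))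
            = (\<Sum>j=1..p. \<Sum>i<j. \<beta> j * c (int N - int i) * X (t - int N + int i - int j) \<omega>)"
          by (simp only: sum_distrib_left mult.assoc)
        ultimately have *: "X t \<omega> - S N \<omega> =
            (\<Sum>j=1..p. \<Sum>i<j. \<beta> j * c (int N - int i) * X (t - int N + int i - int j) \<omega>)"
          unfolding S_def by linarith
        show "min 1 \<bar>X t \<omega> - S N \<omega>\<bar>
         \<le> (\<Sum>j=1..p. \<Sum>i<j. min 1 \<bar>\<beta> j * c (int N - int i) * X (t - int N + int i - int j) \<omega>\<bar>)"
          unfolding * by (intro order.trans[OF min_1_abs_sum_le] sum_mono min_1_abs_sum_le)
      qed
      show "integrable M (\<lambda>\<omega>. min 1 \<bar>X t \<omega> - S N \<omega>\<bar>)"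
        by (rule bounded_int) measurable
      show "integrable M (\<lambda>\<omega>. \<Sum>j=1..p. \<Sum>i<j. min 1 \<bar>\<beta> j * c (int N - int i) * X (t - int N + int i - int j) \<omega>\<bar>)"
        by (intro Bochner_Integration.integrable_sum int_term)
    qed
    also have "\<dots> = (\<Sum>j=1..p. \<Sum>i<j. \<phi> (\<beta> j * c (int N - int i)))"
      by (simp add: Bochner_Integration.integral_sum Bochner_Integration.integrable_sum int_term \<phi>_shift)
    finally show ?thesis .
  qed
  have "(\<lambda>N. \<Sum>j=1..p. \<Sum>i<j. \<phi> (\<beta> j * c (int N - int i))) \<longlonglongrightarrow> 0"
    by (intro tendsto_null_sum \<phi>_lim tendsto_mult_right_zero c_lim)
  moreover have "norm (expectation (\<lambda>\<omega>. min 1 \<bar>X t \<omega> - S N \<omega>\<bar>))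
      \<le> (\<Sum>j=1..p. \<Sum>i<j. \<phi> (\<beta> j * c (int N - int i)))" for N
  proof -
    have "0 \<le> expectation (\<lambda>\<omega>. min 1 \<bar>X t \<omega> - S N \<omega>\<bar>)" by (rule integral_nonneg_AE) auto
    with le[of N] show ?thesis by (simp only: real_norm_def abs_of_nonneg)
  qed
  ultimately have "(\<lambda>N. expectation (\<lambda>\<omega>. min 1 \<bar>X t \<omega> - S N \<omega>\<bar>)) \<longlonglongrightarrow> 0"
    by (rule Lim_null_comparison[OF always_eventually[OF allI], rotated])
  \<comment> \<open>The second limit of the same sequence, along the almost surely convergent
    series; uniqueness of limits makes the truncated distance of X t and V vanish.\<close>
  moreover have "(\<lambda>N. expectation (\<lambda>\<omega>. min 1 \<bar>X t \<omega> - S N \<omega>\<bar>)) \<longlonglongrightarrow> expectation (\<lambda>\<omega>. min 1 \<bar>X t \<omega> - V \<omega>\<bar>)"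
  proof (rule integral_dominated_convergence[where w="\<lambda>_. 1"])
    show "AE \<omega> in M. (\<lambda>N. min 1 \<bar>X t \<omega> - S N \<omega>\<bar>) \<longlonglongrightarrow> min 1 \<bar>X t \<omega> - V \<omega>\<bar>"
      using summ[of t]
      by eventually_elim (auto simp: S_def V_def intro!: tendsto_intros summable_LIMSEQ')
  qed auto
  ultimately have "expectation (\<lambda>\<omega>. min 1 \<bar>X t \<omega> - V \<omega>\<bar>) = 0"
    by (rule LIMSEQ_unique[symmetric])
  then have "AE \<omega> in M. min 1 \<bar>X t \<omega> - V \<omega>\<bar> = 0"
    by (subst (asm) integral_nonneg_eq_0_iff_AE) (auto intro!: bounded_int)
  then show ?thesis by eventually_elim (auto simp: V_def min_def split: if_splits)
qed

section \<open>Increments of a distribution function under outliers\<close>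

text \<open>Case distinction on the number of contaminated positions. None: s = s0 and
  \<open>quad\<close> applies. One: A T is compared with A at the point displaced by the outlier
  alone; the leftover shift costs a Lipschitz term but never more than 1, whence the truncation. Two
  or more: trivial bounds, paid for by the double sum. For the second claim, one contaminated
  position already makes the right side at least 1.\<close>

lemma contaminated_increment_bound:
  fixes Z X b :: "nat \<Rightarrow> real" and A G :: "real \<Rightarrow> real"
  assumes Z: "\<And>j. Z j = 0 \<or> Z j = 1"
    and A01: "\<And>u. 0 \<le> A u" "\<And>u. A u \<le> 1" and G01: "\<And>u. 0 \<le> G u" "\<And>u. G u \<le> 1"
    and lip: "\<And>u v. \<bar>A u - A v\<bar> \<le> L * \<bar>u - v\<bar>"
    and quad: "\<And>d. \<bar>A (x + d) - A x - g * d\<bar> \<le> L * d\<^sup>2 + L * r * \<bar>d\<bar>"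
    and g: "\<bar>g\<bar> \<le> L" and AG: "\<And>u. \<bar>A u - G u\<bar> \<le> r" and r: "r \<ge> 0"
    and h: "h \<ge> 0" and \<kappa>: "\<kappa> \<ge> 0" and N: "N \<ge> 0"
    and s0: "\<bar>s0\<bar> \<le> \<kappa> * N" and s: "\<bar>s - s0\<bar> \<le> \<kappa> * (\<Sum>j\<le>p. Z j * \<bar>X j\<bar>)"
  defines "T \<equiv> x + h * s + (\<Sum>j\<le>p. b j * Z j * X j)"
  shows "\<bar>A T - A x - g * (h * s0) - (\<Sum>j\<le>p. Z j * (G (x + b j * X j) - G x))\<bar>
      \<le> L * (h * \<kappa> * N)\<^sup>2 + L * r * (h * \<kappa> * N)
        + (\<Sum>j\<le>p. Z j * (min 1 (L * h * \<kappa> * \<bar>X j\<bar>) + 2 * r + 2 * L * (h * \<kappa> * N)))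
        + 2 * (\<Sum>j\<le>p. \<Sum>k\<in>{..p} - {j}. Z j * Z k)" (is ?bound)
    and "\<bar>A T - A x\<bar> \<le> (\<Sum>j\<le>p. Z j) + L * (h * \<kappa> * N)" (is ?incr)
proof -
  define K where "K = {j\<in>{..p}. Z j = 1}"
  have fK: "finite K" by (simp add: K_def)
  have sumZ: "(\<Sum>j\<le>p. Z j * F j) = (\<Sum>j\<in>K. F j)" for F
  proof -
    have "(\<Sum>j\<le>p. Z j * F j) = (\<Sum>j\<in>K. Z j * F j)"
      using Z by (intro sum.mono_neutral_right) (auto simp: K_def)
    then show ?thesis by (simp add: K_def)
  qed
  have sumZ1: "(\<Sum>j\<le>p. Z j) = real (card K)" using sumZ[of "\<lambda>_. 1"] by simp
  \<comment> \<open>The double sum counts ordered pairs of distinct contaminated positions.\<close>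
  have dbl: "(\<Sum>j\<le>p. \<Sum>k\<in>{..p} - {j}. Z j * Z k) = real (card K) * (real (card K) - 1)"
  proof -
    have "(\<Sum>k\<in>{..p} - {j}. Z j * Z k) = Z j * (real (card K) - 1)" if "j \<le> p" for j
      using that Z[of j] by (subst sum_diff1) (auto simp: sumZ1[symmetric] sum_distrib_left[symmetric])
    then have "(\<Sum>j\<le>p. \<Sum>k\<in>{..p} - {j}. Z j * Z k) = (\<Sum>j\<le>p. Z j * (real (card K) - 1))"
      by (intro sum.cong) auto
    then show ?thesis by (simp add: sumZ1 sum_distrib_right[symmetric])
  qed
  have T: "T = x + h * s + (\<Sum>j\<in>K. b j * X j)"
    using sumZ[of "\<lambda>j. b j * X j"] by (simp add: T_def mult.commute mult.left_commute)
  have s: "\<bar>s - s0\<bar> \<le> \<kappa> * (\<Sum>j\<in>K. \<bar>X j\<bar>)" using s by (simp add: sumZ)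
  have L: "L \<ge> 0" using g by linarith
  define B where "B = h * \<kappa> * N"
  have B: "B \<ge> 0" using h \<kappa> N by (simp add: B_def)
  have hs0: "\<bar>h * s0\<bar> \<le> B"
    using mult_left_mono[OF s0 h] h by (simp add: B_def abs_mult mult.assoc)
  have ghs0: "\<bar>g * (h * s0)\<bar> \<le> L * B"
    unfolding abs_mult[of g] by (intro mult_mono g hs0 L) auto
  have K01: "K = {} \<or> (\<exists>j. K = {j}) \<or> card K \<ge> 2"
    using fK by (metis One_nat_def card_1_singletonE card_eq_0_iff less_2_cases not_le)
  show ?incr
  proof (cases "K = {}")
    case True
    then have "s = s0" using s by simp
    then have "\<bar>A T - A x\<bar> \<le> L * \<bar>h * s0\<bar>" using lip[of T x] by (simp add: T True)
    also have "\<dots> \<le> L * B" by (intro mult_left_mono hs0 L)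
    finally show ?thesis by (simp add: sumZ1 True B_def)
  next
    case False
    then have "real (card K) \<ge> 1" using fK by (simp add: Suc_le_eq card_gt_0_iff)
    moreover have "\<bar>A T - A x\<bar> \<le> 1" using A01[of T] A01[of x] by linarith
    moreover have "L * B \<ge> 0" using L B by simp
    ultimately show ?thesis by (simp add: sumZ1 B_def)
  qed
  have LB: "L * B\<^sup>2 \<ge> 0" "L * r * B \<ge> 0" "L * B \<ge> 0" using L B r by simp_all
  consider "K = {}" | j where "K = {j}" | "card K \<ge> 2" using K01 by blast
  then have "\<bar>A T - A x - g * (h * s0) - (\<Sum>j\<in>K. G (x + b j * X j) - G x)\<bar>
      \<le> L * B\<^sup>2 + L * r * B + (\<Sum>j\<in>K. min 1 (L * h * \<kappa> * \<bar>X j\<bar>) + 2 * r + 2 * L * B)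
        + 2 * (real (card K) * (real (card K) - 1))"
  proof cases
    case 1
    then have "s = s0" using s by simp
    then have "\<bar>A T - A x - g * (h * s0)\<bar> \<le> L * (h * s0)\<^sup>2 + L * r * \<bar>h * s0\<bar>"
      using quad[of "h * s0"] by (simp add: T 1)
    also have "L * (h * s0)\<^sup>2 \<le> L * B\<^sup>2"
      using hs0 B L by (intro mult_left_mono) (auto simp: abs_le_square_iff[symmetric])
    also have "L * r * \<bar>h * s0\<bar> \<le> L * r * B" using L r by (intro mult_left_mono hs0) auto
    finally show ?thesis by (simp add: 1)
  next
    case (2 j)
    define y where "y = x + b j * X j"
    have Ty: "T = y + h * s" by (simp add: T 2 y_def)
    have "\<bar>s\<bar> \<le> \<kappa> * N + \<kappa> * \<bar>X j\<bar>" using s s0 by (simp add: 2)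
    then have "\<bar>h * s\<bar> \<le> h * (\<kappa> * N + \<kappa> * \<bar>X j\<bar>)" using h by (simp add: abs_mult mult_left_mono)
    then have "L * \<bar>h * s\<bar> \<le> L * (h * (\<kappa> * N + \<kappa> * \<bar>X j\<bar>))" using L by (intro mult_left_mono)
    then have "\<bar>A T - A y\<bar> \<le> L * B + L * h * \<kappa> * \<bar>X j\<bar>"
      using lip[of T y] by (simp add: Ty B_def algebra_simps)
    moreover have "\<bar>A T - A y\<bar> \<le> 1" using A01[of T] A01[of y] by linarith
    \<comment> \<open>The difference is at most 1 and at most a + b with a = L * B nonnegative,
      hence at most a + min 1 b: only the part caused by the outlier is truncated.\<close>
    ultimately have "\<bar>A T - A y\<bar> \<le> L * B + min 1 (L * h * \<kappa> * \<bar>X j\<bar>)"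
      using LB by (auto simp: min_def)
    moreover have "A T - A x - g * (h * s0) - (G y - G x)
      = (A T - A y) + (A y - G y) - (A x - G x) - g * (h * s0)" by simp
    ultimately have "\<bar>A T - A x - g * (h * s0) - (G y - G x)\<bar>
       \<le> L * B + min 1 (L * h * \<kappa> * \<bar>X j\<bar>) + 2 * r + L * B"
      using AG[of y] AG[of x] ghs0 by linarith
    then have "\<bar>A T - A x - g * (h * s0) - (G y - G x)\<bar>
       \<le> L * B\<^sup>2 + L * r * B + (min 1 (L * h * \<kappa> * \<bar>X j\<bar>) + 2 * r + 2 * L * B)"
      using LB by linarith
    then show ?thesis by (simp add: 2 y_def)
  next
    case 3
    define m where "m = real (card K)"
    have m: "m \<ge> 2" using 3 by (simp add: m_def)
    have "\<bar>\<Sum>j\<in>K. G (x + b j * X j) - G x\<bar> \<le> (\<Sum>j\<in>K. 1)"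
    proof (rule order.trans[OF sum_abs sum_mono])
      fix j show "\<bar>G (x + b j * X j) - G x\<bar> \<le> 1"
        using G01[of "x + b j * X j"] G01[of x] by linarith
    qed
    then have 1: "\<bar>\<Sum>j\<in>K. G (x + b j * X j) - G x\<bar> \<le> m" by (simp add: m_def)
    have 2: "\<bar>A T - A x\<bar> \<le> 1" using A01[of T] A01[of x] by linarith
    have "(\<Sum>j\<in>K. L * B) \<le> (\<Sum>j\<in>K. min 1 (L * h * \<kappa> * \<bar>X j\<bar>) + 2 * r + 2 * L * B)"
    proof (rule sum_mono)
      fix j
      have "0 \<le> min 1 (L * h * \<kappa> * \<bar>X j\<bar>)" using L h \<kappa> by simp
      then show "L * B \<le> min 1 (L * h * \<kappa> * \<bar>X j\<bar>) + 2 * r + 2 * L * B" using r LB by linarith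
    qed
    moreover have "L * B \<le> (\<Sum>j\<in>K. L * B)"
      using mult_right_mono[of 1 m "L * B"] m LB by (simp add: m_def)
    \<comment> \<open>The increment of A costs 1 and the sum of increments of G costs m; both must
      fit under twice m * (m - 1), which fixes the factor 2 of the double sum. The drift is absorbed
      by the sum over \<open>K\<close>.\<close>
    moreover have "1 + m \<le> 2 * (m * (m - 1))"
    proof -
      have "1 + m \<le> 2 * (2 * (m - 1))" using m by simp
      also have "\<dots> \<le> 2 * (m * (m - 1))" by (intro mult_left_mono mult_right_mono) (use m in auto)
      finally show ?thesis .
    qed
    ultimately show ?thesis using 1 2 ghs0 LB unfolding m_def[symmetric] by linarith
  qed
  then show ?bound unfolding sumZ dbl B_def .
qed

section \<open>The linearised residual empirical process\<close>

text \<open>A common Lipschitz constant for all the maps that send u to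
  \<open>\<theta> j * u + \<eta> * \<bar>u\<bar>\<close>. It is even in \<eta>, so both sides of the
  bracketing have the same rate.\<close>

definition kap :: "nat \<Rightarrow> (nat \<Rightarrow> real) \<Rightarrow> real \<Rightarrow> real" where
  "kap p \<theta> \<eta> = (\<Sum>j\<le>p. \<bar>\<theta> j\<bar>) + \<bar>\<eta>\<bar>"

lemma kap: "kap p \<theta> \<eta> \<ge> 0" "j \<le> p \<Longrightarrow> \<bar>\<theta> j\<bar> + \<bar>\<eta>\<bar> \<le> kap p \<theta> \<eta>"
  using member_le_sum[of j "{..p}" "\<lambda>j. \<bar>\<theta> j\<bar>"] by (auto simp: kap_def sum_nonneg)

text \<open>
  The model for one fixed \<open>n\<close>, with \<open>b\<close> standing for \<open>(-1, \<beta>\<^sub>1, \<dots>, \<beta>\<^sub>p)\<close> and \<open>c\<close> for the impulse response.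
  The error term in \<open>quad\<close> contains \<open>L r |d|\<close> because \<open>g\<close> is the density of \<open>G\<close>, not of \<open>A\<close>.
\<close>

locale outlier_ar = prob_space M for M :: "'a measure" +
  fixes e zi xi :: "int \<Rightarrow> 'a \<Rightarrow> real" and p n :: nat and c b :: "nat \<Rightarrow> real"
    and A G :: "real \<Rightarrow> real" and Q :: "real measure" and x g L r q S :: real
  assumes n: "n \<ge> 1"
    and indep: "indep_vars (\<lambda>_. borel) (\<lambda>(k :: nat, t :: int). ([e, zi, xi] ! k) t) ({..<3} \<times> UNIV)"
    and cdf_e: "\<And>t. cdf (distr M borel (e t)) = A"
    and mean_e: "\<And>t. expectation (e t) = 0"
    and sq_e: "\<And>t. integrable M (\<lambda>\<omega>. (e t \<omega>)\<^sup>2)" "\<And>t. expectation (\<lambda>\<omega>. (e t \<omega>)\<^sup>2) \<le> S"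
    and zi: "\<And>t \<omega>. zi t \<omega> = 0 \<or> zi t \<omega> = 1" "\<And>t. expectation (zi t) = q"
    and xi: "\<And>t. distr M borel (xi t) = Q"
    and c: "summable (\<lambda>k. \<bar>c k\<bar>)"
    and G: "G \<in> borel_measurable borel" "\<And>u. 0 \<le> G u" "\<And>u. G u \<le> 1"
    and lip: "\<And>u v. \<bar>A u - A v\<bar> \<le> L * \<bar>u - v\<bar>"
    and quad: "\<And>d. \<bar>A (x + d) - A x - g * d\<bar> \<le> L * d\<^sup>2 + L * r * \<bar>d\<bar>"
    and g: "\<bar>g\<bar> \<le> L" and AG: "\<And>u. \<bar>A u - G u\<bar> \<le> r" and r: "r \<ge> 0"
begin

text \<open>Innovations, outlier indicators and outlier sizes as one family indexed by source and
  time: independence of two quantities reduces to disjointness of index sets.\<close>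

definition W :: "nat \<times> int \<Rightarrow> 'a \<Rightarrow> real" where "W = (\<lambda>(k :: nat, t :: int). ([e, zi, xi] ! k) t)"

abbreviation gen :: "(nat \<times> int) set \<Rightarrow> 'a measure" where "gen \<equiv> generated_algebra M W"

lemma W_simps: "W (0, t) = e t" "W (Suc 0, t) = zi t" "W (2, t) = xi t"
  by (simp_all add: W_def numeral_2_eq_2)

lemma indep_W: "indep_vars (\<lambda>_. borel) W ({..<3} \<times> UNIV)"
  using indep by (simp add: W_def)

lemma W_measurable: "i \<in> {..<3} \<times> UNIV \<Longrightarrow> W i \<in> borel_measurable M"
  using indep_W by (auto simp: indep_vars_def2)

lemma rv [measurable]: "e t \<in> borel_measurable M" "zi t \<in> borel_measurable M" "xi t \<in> borel_measurable M"
  using W_measurable[of "(0, t)"] W_measurable[of "(Suc 0, t)"] W_measurable[of "(2, t)"]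
  by (auto simp: W_simps)

lemma gen_rv:
  "(0, t) \<in> I \<Longrightarrow> e t \<in> borel_measurable (gen I)"
  "(Suc 0, t) \<in> I \<Longrightarrow> zi t \<in> borel_measurable (gen I)"
  "(2, t) \<in> I \<Longrightarrow> xi t \<in> borel_measurable (gen I)"
  using measurable_generated_algebra[of "(0, t)" I W M] measurable_generated_algebra[of "(Suc 0, t)" I W M]
    measurable_generated_algebra[of "(2, t)" I W M] by (auto simp: W_simps)

lemma gen_measurable: "f \<in> borel_measurable (gen I) \<Longrightarrow> I \<subseteq> {..<3} \<times> UNIV \<Longrightarrow> f \<in> borel_measurable M"
  by (rule measurable_generated_algebra_subset[of f M W I]) (use W_measurable in auto)

lemma expectation_mult_disjoint:
  fixes f f' :: "'a \<Rightarrow> real"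
  assumes "f \<in> borel_measurable (gen I)" "f' \<in> borel_measurable (gen J)" "I \<inter> J = {}"
    "I \<subseteq> {..<3} \<times> UNIV" "J \<subseteq> {..<3} \<times> UNIV" "integrable M f" "integrable M f'"
  shows "expectation (\<lambda>\<omega>. f \<omega> * f' \<omega>) = expectation f * expectation f'"
    and "integrable M (\<lambda>\<omega>. f \<omega> * f' \<omega>)"
proof -
  have "indep_var borel f borel f'"
    by (rule indep_var_generated_algebra[OF indep_W assms(3,4,5,1,2)])
  then show "expectation (\<lambda>\<omega>. f \<omega> * f' \<omega>) = expectation f * expectation f'"
    and "integrable M (\<lambda>\<omega>. f \<omega> * f' \<omega>)"
    using assms(6,7) by (rule indep_var_lebesgue_integral, rule indep_var_integrable)
qed

lemma A_borel [measurable]: "A \<in> borel_measurable borel"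
proof -
  interpret R: real_distribution "distr M borel (e 0)" by (rule real_distribution_distr) simp
  have "cdf (distr M borel (e 0)) \<in> borel_measurable borel"
    by (intro borel_measurable_mono) (auto simp: mono_def R.cdf_nondecreasing)
  then show ?thesis by (simp add: cdf_e)
qed

lemma A01: "0 \<le> A u" "A u \<le> 1"
proof -
  interpret R: real_distribution "distr M borel (e 0)" by (rule real_distribution_distr) simp
  show "0 \<le> A u" "A u \<le> 1"
    using R.cdf_nonneg[of u] R.cdf_bounded_prob[of u] by (simp_all add: cdf_e)
qed

lemma L_nonneg: "L \<ge> 0" using g by linarith

lemma S_nonneg: "S \<ge> 0"
proof -
  have "0 \<le> expectation (\<lambda>\<omega>. (e 0 \<omega>)\<^sup>2)" by (rule Bochner_Integration.integral_nonneg) auto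
  with sq_e(2)[of 0] show ?thesis by linarith
qed

lemma zi_bounds: "0 \<le> zi t \<omega>" "zi t \<omega> \<le> 1" "\<bar>zi t \<omega>\<bar> \<le> 1"
  using zi(1)[of t \<omega>] by auto

lemma integrable_zi [simp]: "integrable M (zi t)"
  by (rule integrable_const_bound[of _ 1]) (use zi_bounds in auto)

lemma q01: "0 \<le> q" "q \<le> 1"
proof -
  have "0 \<le> expectation (zi 0)" by (rule Bochner_Integration.integral_nonneg) (use zi_bounds in auto)
  then show "0 \<le> q" by (simp add: zi(2))
  have "expectation (zi 0) \<le> expectation (\<lambda>_. 1)"
    by (rule integral_mono) (use zi_bounds in auto)
  then show "q \<le> 1" by (simp add: zi(2) prob_space)
qed

lemma integrable_e: "integrable M (e t)"
  by (rule square_integrable_imp_integrable) (use sq_e in auto)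

lemma expectation_e_mult: "s \<noteq> t \<Longrightarrow> expectation (\<lambda>\<omega>. e s \<omega> * e t \<omega>) = 0"
  by (subst expectation_mult_disjoint(1)[of _ "{(0, s)}" _ "{(0, t)}"])
     (auto simp: gen_rv integrable_e mean_e)

text \<open>On the null set where the series diverges, the value of \<open>V\<close> is junk.\<close>

definition V :: "int \<Rightarrow> 'a \<Rightarrow> real" where
  "V t \<omega> = (\<Sum>k. c k * e (t - int k) \<omega>)"

lemma V_gen: "{0} \<times> {..t} \<subseteq> I \<Longrightarrow> V t \<in> borel_measurable (gen I)"
  unfolding V_def
  by (intro borel_measurable_suminf borel_measurable_times borel_measurable_const gen_rv) auto

lemma V_borel [measurable]: "V t \<in> borel_measurable M"
  unfolding V_def by measurable

section \<open>Second moments and time averages of the causal solution\<close>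

lemma nn_sq_e: "(\<integral>\<^sup>+\<omega>. ennreal ((e t \<omega>)\<^sup>2) \<partial>M) \<le> ennreal S"
  using sq_e(2)[of t] by (subst nn_integral_eq_integral[OF sq_e(1)]) (auto intro: ennreal_leI)

lemma AE_V_summable: "AE \<omega> in M. summable (\<lambda>k. c k * e (t - int k) \<omega>)"
  by (rule AE_summable_moving_average(1)[OF c _ _ S_nonneg]) (auto intro: nn_sq_e)

lemma integrable_sq_bound:
  fixes f :: "'a \<Rightarrow> real"
  assumes [measurable]: "f \<in> borel_measurable M"
    and bd: "(\<integral>\<^sup>+\<omega>. ennreal ((f \<omega>)\<^sup>2) \<partial>M) \<le> ennreal B" and B: "B \<ge> 0"
  shows "integrable M (\<lambda>\<omega>. (f \<omega>)\<^sup>2)" "expectation (\<lambda>\<omega>. (f \<omega>)\<^sup>2) \<le> B" "integrable M f"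
proof -
  show int: "integrable M (\<lambda>\<omega>. (f \<omega>)\<^sup>2)"
    by (rule integrableI_nonneg) (use order.strict_trans1[OF bd ennreal_less_top] in auto)
  show "expectation (\<lambda>\<omega>. (f \<omega>)\<^sup>2) \<le> B"
    using bd B by (subst (asm) nn_integral_eq_integral[OF int]) auto
  show "integrable M f" by (rule square_integrable_imp_integrable) (use int in auto)
qed

text \<open>The bound of \<open>AE_summable_moving_average\<close> for \<open>V\<close>. It involves
  the impulse response and S only, which keeps it the same for all sample sizes and
  parameters.\<close>

definition C :: real where "C = (\<Sum>k. \<bar>c k\<bar>)\<^sup>2 * S"

lemma C_nonneg: "C \<ge> 0" using S_nonneg by (simp add: C_def)

lemma sq_V: "integrable M (\<lambda>\<omega>. (V t \<omega>)\<^sup>2)" "expectation (\<lambda>\<omega>. (V t \<omega>)\<^sup>2) \<le> C" "integrable M (V t)"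
proof -
  have "(\<integral>\<^sup>+\<omega>. ennreal ((V t \<omega>)\<^sup>2) \<partial>M) \<le> ennreal C"
    unfolding V_def C_def
    by (rule AE_summable_moving_average(2)[OF c _ _ S_nonneg]) (auto intro: nn_sq_e)
  from integrable_sq_bound[OF V_borel this C_nonneg]
  show "integrable M (\<lambda>\<omega>. (V t \<omega>)\<^sup>2)" "expectation (\<lambda>\<omega>. (V t \<omega>)\<^sup>2) \<le> C" "integrable M (V t)" by auto
qed

lemma integrable_e_mult: "integrable M (\<lambda>\<omega>. e s \<omega> * e t \<omega>)"
proof (cases "s = t")
  case True
  then show ?thesis using sq_e(1)[of t] by (simp add: power2_eq_square)
next
  case False
  then show ?thesis
    by (intro expectation_mult_disjoint(2)[of _ "{(0, s)}" _ "{(0, t)}"])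
       (auto simp: gen_rv integrable_e)
qed

text \<open>
  Summing a moving average over time gives the moving average of the partial sums of the innovations,
  which avoids computing autocovariances.
\<close>

lemma mean_V_bound: "expectation (\<lambda>\<omega>. \<bar>(\<Sum>t=1..int n. V (t - int j) \<omega>) / real n\<bar>) \<le> sqrt (C / real n)"
proof -
  define E where "E k \<omega> = (\<Sum>t=1..int n. e (t - int j - int k) \<omega>)" for k :: nat and \<omega>
  have E_eq: "E k = (\<lambda>\<omega>. \<Sum>t\<in>{1..int n}. e (t - int j - int k) \<omega>)" for k by (simp add: E_def fun_eq_iff)
  have [measurable]: "E k \<in> borel_measurable M" for k unfolding E_def by measurable
  have E2: "(\<integral>\<^sup>+\<omega>. ennreal ((E k \<omega>)\<^sup>2) \<partial>M) \<le> ennreal (real n * S)" for k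
  proof -
    note orth = expectation_sum_orthogonal[of "{1..int n}" "\<lambda>t. e (t - int j - int k)"]
    have "expectation (\<lambda>\<omega>. (E k \<omega>)\<^sup>2) = (\<Sum>t=1..int n. expectation (\<lambda>\<omega>. (e (t - int j - int k) \<omega>)\<^sup>2))"
      unfolding E_def by (rule orth(1)) (auto simp: integrable_e_mult expectation_e_mult)
    also have "\<dots> \<le> (\<Sum>t=1..int n. S)" by (intro sum_mono sq_e)
    also have "\<dots> = real n * S" by simp
    finally have "expectation (\<lambda>\<omega>. (E k \<omega>)\<^sup>2) \<le> real n * S" .
    moreover have "integrable M (\<lambda>\<omega>. (E k \<omega>)\<^sup>2)"
      unfolding E_def by (rule orth(2)) (auto simp: integrable_e_mult expectation_e_mult)
    ultimately show ?thesis by (subst nn_integral_eq_integral) (auto intro: ennreal_leI)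
  qed
  define D where "D \<omega> = (\<Sum>t=1..int n. V (t - int j) \<omega>)" for \<omega>
  have [measurable]: "D \<in> borel_measurable M" unfolding D_def by measurable
  \<comment> \<open>Interchanging the sum over time with the series requires convergence at all
    these times off a single null set.\<close>
  have "AE \<omega> in M. \<forall>t. summable (\<lambda>k. c k * e (t - int k) \<omega>)"
    unfolding AE_all_countable using AE_V_summable by blast
  then have "AE \<omega> in M. D \<omega> = (\<Sum>k. c k * E k \<omega>)"
  proof eventually_elim
    case (elim \<omega>)
    have "D \<omega> = (\<Sum>k. \<Sum>t=1..int n. c k * e (t - int j - int k) \<omega>)"
      unfolding D_def V_def using elim by (subst suminf_sum) auto
    then show ?case by (simp add: E_def sum_distrib_left)
  qed
  then have "(\<integral>\<^sup>+\<omega>. ennreal ((D \<omega>)\<^sup>2) \<partial>M) = (\<integral>\<^sup>+\<omega>. ennreal ((\<Sum>k. c k * E k \<omega>)\<^sup>2) \<partial>M)"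
    by (intro nn_integral_cong_AE) auto
  also have "\<dots> \<le> ennreal ((\<Sum>k. \<bar>c k\<bar>)\<^sup>2 * (real n * S))"
    by (rule AE_summable_moving_average(2)[OF c _ E2]) (use S_nonneg in auto)
  finally have "(\<integral>\<^sup>+\<omega>. ennreal ((D \<omega>)\<^sup>2) \<partial>M) \<le> ennreal (real n * C)"
    by (simp add: C_def mult_ac)
  note bound = this
  have Dm: "D \<in> borel_measurable M" by measurable
  have nC: "0 \<le> real n * C" using C_nonneg by simp
  note D = integrable_sq_bound[OF Dm bound nC]
  have "expectation (\<lambda>\<omega>. \<bar>D \<omega> / real n\<bar>) = expectation (\<lambda>\<omega>. \<bar>D \<omega>\<bar>) / real n" by simp
  also have "\<dots> \<le> sqrt (real n * C) / real n"
    using order.trans[OF expectation_abs_le_sqrt[OF D(3,1)] real_sqrt_le_mono[OF D(2)]]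
    by (rule divide_right_mono) simp
  also have "\<dots> = sqrt (C / real n)"
  proof -
    have "real n = sqrt (real n) * sqrt (real n)" by simp
    then have "sqrt (real n * C) / real n = sqrt (real n) * sqrt C / (sqrt (real n) * sqrt (real n))"
      by (metis real_sqrt_mult)
    also have "\<dots> = sqrt C / sqrt (real n)"
      by (rule mult_divide_mult_cancel_left) (use n in auto)
    finally show ?thesis by (simp add: real_sqrt_divide)
  qed
  finally show ?thesis by (simp add: D_def)
qed

section \<open>Regressors, thresholds and the information they use\<close>

definition h :: real where "h = 1 / sqrt (real n)"

lemma h_pos: "h > 0" using n by (simp add: h_def)

lemma h_sq: "h * h * real n = 1" using n by (simp add: h_def)

text \<open>The lagged centred observations are split into a clean part \<open>U0\<close> and an
  outlier part \<open>Oz\<close>, because the drift is computed from the clean part alone. Entry 0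
  is the intercept, which carries the error of the location estimate and is never
  contaminated.\<close>

definition U0 :: "int \<Rightarrow> nat \<Rightarrow> 'a \<Rightarrow> real" where
  "U0 t j \<omega> = (if j = 0 then 1 else V (t - int j) \<omega>)"

definition Oz :: "int \<Rightarrow> nat \<Rightarrow> 'a \<Rightarrow> real" where
  "Oz t j \<omega> = (if j = 0 then 0 else zi (t - int j) \<omega> * xi (t - int j) \<omega>)"

definition N0 :: "int \<Rightarrow> 'a \<Rightarrow> real" where "N0 t \<omega> = (\<Sum>j\<le>p. \<bar>U0 t j \<omega>\<bar>)"

definition shift0 :: "(nat \<Rightarrow> real) \<Rightarrow> real \<Rightarrow> int \<Rightarrow> 'a \<Rightarrow> real" where
  "shift0 \<theta> \<eta> t \<omega> = (\<Sum>j\<le>p. \<theta> j * U0 t j \<omega> + \<eta> * \<bar>U0 t j \<omega>\<bar>)"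

definition shift :: "(nat \<Rightarrow> real) \<Rightarrow> real \<Rightarrow> int \<Rightarrow> 'a \<Rightarrow> real" where
  "shift \<theta> \<eta> t \<omega> = (\<Sum>j\<le>p. \<theta> j * (U0 t j \<omega> + Oz t j \<omega>) + \<eta> * \<bar>U0 t j \<omega> + Oz t j \<omega>\<bar>)"

definition thr :: "(nat \<Rightarrow> real) \<Rightarrow> real \<Rightarrow> int \<Rightarrow> 'a \<Rightarrow> real" where
  "thr \<theta> \<eta> t \<omega> = x + h * shift \<theta> \<eta> t \<omega> + (\<Sum>j\<le>p. b j * zi (t - int j) \<omega> * xi (t - int j) \<omega>)"

definition psi :: "nat \<Rightarrow> real \<Rightarrow> real" where "psi j u = G (x + b j * u) - G x"

text \<open>Innovations strictly before t, but outlier variables of all times: the threshold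
  contains the outlier at time t itself, and all of these are independent of
  \<open>e t\<close>.\<close>

definition past :: "int \<Rightarrow> (nat \<times> int) set" where
  "past t = {0} \<times> {..<t} \<union> {1, 2} \<times> UNIV"

lemma N0_nonneg: "N0 t \<omega> \<ge> 0" by (simp add: N0_def sum_nonneg)

lemma abs_shift0_le: "\<bar>shift0 \<theta> \<eta> t \<omega>\<bar> \<le> kap p \<theta> \<eta> * N0 t \<omega>"
  unfolding shift0_def N0_def sum_distrib_left
proof (rule order.trans[OF sum_abs sum_mono])
  fix j assume "j \<in> {..p}"
  then have "(\<bar>\<theta> j\<bar> + \<bar>\<eta>\<bar>) * \<bar>U0 t j \<omega>\<bar> \<le> kap p \<theta> \<eta> * \<bar>U0 t j \<omega>\<bar>"
    by (intro mult_right_mono kap) auto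
  then show "\<bar>\<theta> j * U0 t j \<omega> + \<eta> * \<bar>U0 t j \<omega>\<bar>\<bar> \<le> kap p \<theta> \<eta> * \<bar>U0 t j \<omega>\<bar>"
    using abs_triangle_ineq[of "\<theta> j * U0 t j \<omega>" "\<eta> * \<bar>U0 t j \<omega>\<bar>"]
    by (simp add: abs_mult distrib_right)
qed

text \<open>The map \<open>\<theta> j * u + \<eta> * \<bar>u\<bar>\<close> is Lipschitz in u, so
  dropping the outliers from the regressors costs at most their moduli.\<close>

lemma abs_shift_diff_le:
  "\<bar>shift \<theta> \<eta> t \<omega> - shift0 \<theta> \<eta> t \<omega>\<bar> \<le> kap p \<theta> \<eta> * (\<Sum>j\<le>p. zi (t - int j) \<omega> * \<bar>xi (t - int j) \<omega>\<bar>)"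
  unfolding shift0_def shift_def sum_subtractf[symmetric] sum_distrib_left
proof (rule order.trans[OF sum_abs sum_mono])
  fix j assume j: "j \<in> {..p}"
  let ?u = "U0 t j \<omega>" and ?o = "Oz t j \<omega>"
  have "\<theta> j * (?u + ?o) + \<eta> * \<bar>?u + ?o\<bar> - (\<theta> j * ?u + \<eta> * \<bar>?u\<bar>) = \<theta> j * ?o + \<eta> * (\<bar>?u + ?o\<bar> - \<bar>?u\<bar>)"
    by (simp add: algebra_simps)
  also have "\<bar>\<dots>\<bar> \<le> \<bar>\<theta> j\<bar> * \<bar>?o\<bar> + \<bar>\<eta>\<bar> * \<bar>\<bar>?u + ?o\<bar> - \<bar>?u\<bar>\<bar>"
    by (rule order.trans[OF abs_triangle_ineq]) (simp add: abs_mult)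
  also have "\<dots> \<le> \<bar>\<theta> j\<bar> * \<bar>?o\<bar> + \<bar>\<eta>\<bar> * \<bar>?o\<bar>"
    using abs_triangle_ineq3[of "?u + ?o" ?u] by (intro add_left_mono mult_left_mono) auto
  also have "\<dots> \<le> kap p \<theta> \<eta> * \<bar>?o\<bar>"
    using mult_right_mono[OF kap(2)[of j p \<theta> \<eta>], of "\<bar>?o\<bar>"] j by (simp add: distrib_right)
  also have "\<dots> \<le> kap p \<theta> \<eta> * (zi (t - int j) \<omega> * \<bar>xi (t - int j) \<omega>\<bar>)"
    using zi_bounds(1) by (intro mult_left_mono kap) (auto simp: Oz_def abs_mult)
  finally show "\<bar>\<theta> j * (?u + ?o) + \<eta> * \<bar>?u + ?o\<bar> - (\<theta> j * ?u + \<eta> * \<bar>?u\<bar>)\<bar>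
      \<le> kap p \<theta> \<eta> * (zi (t - int j) \<omega> * \<bar>xi (t - int j) \<omega>\<bar>)" .
qed

lemma compensator_bound:
  "\<bar>A (thr \<theta> \<eta> t \<omega>) - A x - g * (h * shift0 \<theta> \<eta> t \<omega>)
      - (\<Sum>j\<le>p. zi (t - int j) \<omega> * psi j (xi (t - int j) \<omega>))\<bar>
    \<le> L * (h * kap p \<theta> \<eta> * N0 t \<omega>)\<^sup>2 + L * r * (h * kap p \<theta> \<eta> * N0 t \<omega>)
      + (\<Sum>j\<le>p. zi (t - int j) \<omega> * (min 1 (L * h * kap p \<theta> \<eta> * \<bar>xi (t - int j) \<omega>\<bar>)
            + 2 * r + 2 * L * (h * kap p \<theta> \<eta> * N0 t \<omega>)))
      + 2 * (\<Sum>j\<le>p. \<Sum>k\<in>{..p} - {j}. zi (t - int j) \<omega> * zi (t - int k) \<omega>)"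
  unfolding thr_def psi_def
  by (rule contaminated_increment_bound(1)[where Z="\<lambda>j. zi (t - int j) \<omega>" and X="\<lambda>j. xi (t - int j) \<omega>" and
      N="N0 t \<omega>" and s="shift \<theta> \<eta> t \<omega>" and \<kappa>="kap p \<theta> \<eta>" and p=p and b=b,
      OF zi(1) A01 G(2,3) lip quad g AG r less_imp_le[OF h_pos] kap(1) N0_nonneg abs_shift0_le abs_shift_diff_le])

lemma increment_bound:
  "\<bar>A (thr \<theta> \<eta> t \<omega>) - A x\<bar> \<le> (\<Sum>j\<le>p. zi (t - int j) \<omega>) + L * (h * kap p \<theta> \<eta> * N0 t \<omega>)"
  unfolding thr_def
  by (rule contaminated_increment_bound(2)[where Z="\<lambda>j. zi (t - int j) \<omega>" and X="\<lambda>j. xi (t - int j) \<omega>" and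
      N="N0 t \<omega>" and s="shift \<theta> \<eta> t \<omega>" and \<kappa>="kap p \<theta> \<eta>" and p=p and b=b,
      OF zi(1) A01 G(2,3) lip quad g AG r less_imp_le[OF h_pos] kap(1) N0_nonneg abs_shift0_le abs_shift_diff_le])

lemma U0_borel [measurable]: "U0 t j \<in> borel_measurable M"
  unfolding U0_def[abs_def] by measurable

lemma Oz_borel [measurable]: "Oz t j \<in> borel_measurable M"
  unfolding Oz_def[abs_def] by measurable

lemma N0_borel [measurable]: "N0 t \<in> borel_measurable M"
  unfolding N0_def[abs_def] by measurable

lemma shift0_borel [measurable]: "shift0 \<theta> \<eta> t \<in> borel_measurable M"
  unfolding shift0_def[abs_def] by measurable

lemma psi_borel [measurable]: "psi j \<in> borel_measurable borel"
  using G(1) unfolding psi_def[abs_def] by measurable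

lemma past_subset: "past t \<subseteq> {..<3} \<times> UNIV" by (auto simp: past_def)

text \<open>Here causality is used: only lags of at least 1 occur, and \<open>V s\<close> is built
  from innovations up to time s.\<close>

lemma thr_gen: "thr \<theta> \<eta> t \<in> borel_measurable (gen (past t))"
proof -
  have [measurable]: "zi s \<in> borel_measurable (gen (past t))" "xi s \<in> borel_measurable (gen (past t))" for s
    by (auto intro!: gen_rv simp: past_def)
  have [measurable]: "U0 t j \<in> borel_measurable (gen (past t))" for j
  proof (cases "j = 0")
    case False
    then have "V (t - int j) \<in> borel_measurable (gen (past t))"
      by (intro V_gen) (auto simp: past_def)
    with False show ?thesis by (simp add: U0_def[abs_def])
  qed (simp add: U0_def[abs_def])
  have [measurable]: "Oz t j \<in> borel_measurable (gen (past t))" for j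
    unfolding Oz_def[abs_def] by measurable
  show ?thesis
    unfolding thr_def[abs_def] shift_def[abs_def] by measurable
qed

lemma thr_borel [measurable]: "thr \<theta> \<eta> t \<in> borel_measurable M"
  by (rule gen_measurable[OF thr_gen past_subset])

lemma past_mono: "s \<le> t \<Longrightarrow> past s \<subseteq> past t" by (auto simp: past_def)

lemma gen_mono:
  assumes "f \<in> borel_measurable (gen I)" "I \<subseteq> J"
  shows "f \<in> borel_measurable (gen J)"
proof (rule measurable_generated_algebra_subset[of f "gen J" W I])
  show "f \<in> borel_measurable (generated_algebra (gen J) W I)"
    using assms(1) by (simp add: generated_algebra_def)
  show "W i \<in> borel_measurable (gen J)" if "i \<in> I" for i
    using assms(2) that by (intro measurable_generated_algebra) auto
qed

text \<open>Given the past, \<open>e t \<le> T\<close> has conditional probability A T when T is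
  known from the past; this is stated in integrated form against bounded weights, so no conditional
  expectations are needed.\<close>

lemma expectation_past:
  assumes T: "T \<in> borel_measurable (gen (past t))" and f: "f \<in> borel_measurable (gen (past t))"
    and B: "\<And>\<omega>. \<bar>f \<omega>\<bar> \<le> B"
  shows "expectation (\<lambda>\<omega>. f \<omega> * of_bool (e t \<omega> \<le> T \<omega>)) = expectation (\<lambda>\<omega>. f \<omega> * A (T \<omega>))"
proof -
  have "indep_var (gen (past t)) (\<lambda>\<omega>. \<omega>) (gen {(0, t)}) (\<lambda>\<omega>. \<omega>)"
    by (rule indep_var_generated_algebra[OF indep_W, of "past t" "{(0, t)}"]) (auto simp: past_def)
  from expectation_indicator_le_past[OF this gen_rv(1) T f B]
  show ?thesis by (simp add: cdf_e)
qed

text \<open>One constant for both moments of \<open>N0\<close>. Cauchy-Schwarz over the p + 1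
  regressors bounds the second moment by K - 1, and \<open>y \<le> 1 + y\<^sup>2\<close> then bounds
  the first by K.\<close>

definition K :: real where "K = 1 + real (p + 1) * (1 + real p * C)"

lemma K_ge_1: "K \<ge> 1" using C_nonneg by (simp add: K_def)

lemma sq_N0: "integrable M (\<lambda>\<omega>. (N0 t \<omega>)\<^sup>2)" "expectation (\<lambda>\<omega>. (N0 t \<omega>)\<^sup>2) \<le> K"
  "integrable M (N0 t)" "expectation (N0 t) \<le> K"
proof -
  have le: "(N0 t \<omega>)\<^sup>2 \<le> real (p + 1) * (1 + (\<Sum>j=1..p. (V (t - int j) \<omega>)\<^sup>2))" for \<omega>
  proof -
    have "(N0 t \<omega>)\<^sup>2 = (\<Sum>j\<le>p. 1 * \<bar>U0 t j \<omega>\<bar>)\<^sup>2" by (simp add: N0_def)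
    also have "\<dots> \<le> (\<Sum>j\<le>p. 1\<^sup>2) * (\<Sum>j\<le>p. \<bar>U0 t j \<omega>\<bar>\<^sup>2)" by (rule Cauchy_Schwarz_ineq_sum)
    also have "(\<Sum>j\<le>p. \<bar>U0 t j \<omega>\<bar>\<^sup>2) = 1 + (\<Sum>j=1..p. (V (t - int j) \<omega>)\<^sup>2)"
    proof -
      have "{..p} = insert 0 {1..p}" by auto
      then show ?thesis by (simp add: U0_def)
    qed
    finally show ?thesis by simp
  qed
  have int: "integrable M (\<lambda>\<omega>. real (p + 1) * (1 + (\<Sum>j=1..p. (V (t - int j) \<omega>)\<^sup>2)))"
    by (intro integrable_mult_right Bochner_Integration.integrable_add Bochner_Integration.integrable_sum sq_V) auto
  show int2: "integrable M (\<lambda>\<omega>. (N0 t \<omega>)\<^sup>2)"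
    by (rule Bochner_Integration.integrable_bound[OF int])
       (use le in \<open>auto intro!: order.trans[OF _ abs_ge_self]\<close>)
  have "expectation (\<lambda>\<omega>. (N0 t \<omega>)\<^sup>2) \<le> expectation (\<lambda>\<omega>. real (p + 1) * (1 + (\<Sum>j=1..p. (V (t - int j) \<omega>)\<^sup>2)))"
    by (intro integral_mono int int2 le)
  also have "\<dots> = real (p + 1) * (1 + (\<Sum>j=1..p. expectation (\<lambda>\<omega>. (V (t - int j) \<omega>)\<^sup>2)))"
    by (simp add: sq_V(1) prob_space)
  also have "\<dots> \<le> real (p + 1) * (1 + (\<Sum>j=1..p. C))"
    by (intro mult_left_mono add_left_mono sum_mono sq_V) auto
  finally have E: "expectation (\<lambda>\<omega>. (N0 t \<omega>)\<^sup>2) \<le> K - 1" by (simp add: K_def)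
  then show "expectation (\<lambda>\<omega>. (N0 t \<omega>)\<^sup>2) \<le> K" by simp
  show int1: "integrable M (N0 t)"
    by (rule square_integrable_imp_integrable) (use int2 in auto)
  have "y \<le> 1 + y\<^sup>2" for y :: real
    using zero_le_power2[of "y - 1 / 2"] by (simp add: power2_eq_square algebra_simps)
  then have "expectation (N0 t) \<le> expectation (\<lambda>\<omega>. 1 + (N0 t \<omega>)\<^sup>2)"
    by (intro integral_mono int1) (use int2 in auto)
  also have "\<dots> = 1 + expectation (\<lambda>\<omega>. (N0 t \<omega>)\<^sup>2)" by (simp add: int2 prob_space)
  finally show "expectation (N0 t) \<le> K" using E by simp
qed

section \<open>The martingale part of the empirical process\<close>

definition Y :: "(nat \<Rightarrow> real) \<Rightarrow> real \<Rightarrow> int \<Rightarrow> 'a \<Rightarrow> real" where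
  "Y \<theta> \<eta> t \<omega> = of_bool (e t \<omega> \<le> thr \<theta> \<eta> t \<omega>) - of_bool (e t \<omega> \<le> x) - (A (thr \<theta> \<eta> t \<omega>) - A x)"

lemma of_bool_borel [measurable]:
  "T \<in> borel_measurable M \<Longrightarrow> (\<lambda>\<omega>. of_bool (e t \<omega> \<le> T \<omega>) :: real) \<in> borel_measurable M"
  unfolding of_bool_def by measurable

lemma Y_borel [measurable]: "Y \<theta> \<eta> t \<in> borel_measurable M"
  unfolding Y_def[abs_def] by measurable

lemma Y_bound: "\<bar>Y \<theta> \<eta> t \<omega>\<bar> \<le> 2"
  using A01[of "thr \<theta> \<eta> t \<omega>"] A01[of x] by (auto simp: Y_def of_bool_def)

lemma Y_gen:
  assumes "s < t"
  shows "Y \<theta> \<eta> s \<in> borel_measurable (gen (past t))"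
proof -
  have [measurable]: "e s \<in> borel_measurable (gen (past t))"
    by (rule gen_rv) (use assms in \<open>auto simp: past_def\<close>)
  have [measurable]: "thr \<theta> \<eta> s \<in> borel_measurable (gen (past t))"
    by (rule gen_mono[OF thr_gen past_mono]) (use assms in auto)
  show ?thesis unfolding Y_def[abs_def] of_bool_def by measurable
qed

lemma integrable_bounded:
  fixes f :: "'a \<Rightarrow> real"
  assumes "f \<in> borel_measurable M" "\<And>\<omega>. \<bar>f \<omega>\<bar> \<le> B"
  shows "integrable M f"
  by (rule integrable_const_bound[of _ B]) (use assms in auto)

lemma expectation_past_diff:
  assumes f: "f \<in> borel_measurable (gen (past t))" and B: "\<And>\<omega>. \<bar>f \<omega>\<bar> \<le> B"
  shows "expectation (\<lambda>\<omega>. f \<omega> * (of_bool (e t \<omega> \<le> thr \<theta> \<eta> t \<omega>) - of_bool (e t \<omega> \<le> x)))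
    = expectation (\<lambda>\<omega>. f \<omega> * (A (thr \<theta> \<eta> t \<omega>) - A x))"
proof -
  have fM[measurable]: "f \<in> borel_measurable M" by (rule gen_measurable[OF f past_subset])
  have mult_bound: "\<bar>f \<omega> * u\<bar> \<le> B" if "0 \<le> u" "u \<le> 1" for \<omega> u
    using mult_mono[OF B[of \<omega>], of "\<bar>u\<bar>" 1] B[of \<omega>] that by (simp add: abs_mult)
  have i1: "integrable M (\<lambda>\<omega>. f \<omega> * of_bool (e t \<omega> \<le> T \<omega>))" if [measurable]: "T \<in> borel_measurable M" for T
    by (rule integrable_bounded[of _ B]) (use mult_bound in \<open>auto simp del: mult_eq_0_iff\<close>)
  have i2: "integrable M (\<lambda>\<omega>. f \<omega> * A (T \<omega>))" if [measurable]: "T \<in> borel_measurable M" for T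
    by (rule integrable_bounded[of _ B]) (use mult_bound A01 in auto)
  have "expectation (\<lambda>\<omega>. f \<omega> * (of_bool (e t \<omega> \<le> thr \<theta> \<eta> t \<omega>) - of_bool (e t \<omega> \<le> x)))
    = expectation (\<lambda>\<omega>. f \<omega> * of_bool (e t \<omega> \<le> thr \<theta> \<eta> t \<omega>)) - expectation (\<lambda>\<omega>. f \<omega> * of_bool (e t \<omega> \<le> x))"
    unfolding right_diff_distrib using i1[of "thr \<theta> \<eta> t"] i1[of "\<lambda>_. x"]
    by (intro Bochner_Integration.integral_diff) auto
  also have "expectation (\<lambda>\<omega>. f \<omega> * of_bool (e t \<omega> \<le> thr \<theta> \<eta> t \<omega>)) = expectation (\<lambda>\<omega>. f \<omega> * A (thr \<theta> \<eta> t \<omega>))"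
    by (rule expectation_past[OF thr_gen f B])
  also have "expectation (\<lambda>\<omega>. f \<omega> * of_bool (e t \<omega> \<le> x)) = expectation (\<lambda>\<omega>. f \<omega> * A x)"
    by (rule expectation_past[OF _ f B]) simp
  also have "expectation (\<lambda>\<omega>. f \<omega> * A (thr \<theta> \<eta> t \<omega>)) - expectation (\<lambda>\<omega>. f \<omega> * A x)
      = expectation (\<lambda>\<omega>. f \<omega> * (A (thr \<theta> \<eta> t \<omega>) - A x))"
    unfolding right_diff_distrib using i2[of "thr \<theta> \<eta> t"] i2[of "\<lambda>_. x"]
    by (intro Bochner_Integration.integral_diff[symmetric]) auto
  finally show ?thesis .
qed

text \<open>An earlier difference is a bounded function of the past of t, so it may serve as the
  weight in \<open>expectation_past_diff\<close>, and the compensator subtracted in the later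
  difference cancels the product mean.\<close>

lemma Y_orthogonal: "s < t \<Longrightarrow> expectation (\<lambda>\<omega>. Y \<theta> \<eta> s \<omega> * Y \<theta> \<eta> t \<omega>) = 0"
proof -
  assume "s < t"
  have i: "integrable M (\<lambda>\<omega>. Y \<theta> \<eta> s \<omega> * F \<omega>)"
    if [measurable]: "F \<in> borel_measurable M" and F: "\<And>\<omega>. \<bar>F \<omega>\<bar> \<le> 1" for F
  proof (rule integrable_bounded[of _ 2])
    show "\<bar>Y \<theta> \<eta> s \<omega> * F \<omega>\<bar> \<le> 2" for \<omega>
      using mult_mono[OF Y_bound[of \<theta> \<eta> s \<omega>] F[of \<omega>]] by (simp add: abs_mult)
  qed measurable
  have "expectation (\<lambda>\<omega>. Y \<theta> \<eta> s \<omega> * Y \<theta> \<eta> t \<omega>)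
     = expectation (\<lambda>\<omega>. Y \<theta> \<eta> s \<omega> * (of_bool (e t \<omega> \<le> thr \<theta> \<eta> t \<omega>) - of_bool (e t \<omega> \<le> x))
        - Y \<theta> \<eta> s \<omega> * (A (thr \<theta> \<eta> t \<omega>) - A x))"
    by (intro Bochner_Integration.integral_cong refl) (subst (2) Y_def, simp add: algebra_simps)
  also have "\<dots> = expectation (\<lambda>\<omega>. Y \<theta> \<eta> s \<omega> * (of_bool (e t \<omega> \<le> thr \<theta> \<eta> t \<omega>) - of_bool (e t \<omega> \<le> x)))
     - expectation (\<lambda>\<omega>. Y \<theta> \<eta> s \<omega> * (A (thr \<theta> \<eta> t \<omega>) - A x))"
  proof (rule Bochner_Integration.integral_diff)
    show "integrable M (\<lambda>\<omega>. Y \<theta> \<eta> s \<omega> * (A (thr \<theta> \<eta> t \<omega>) - A x))"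
    proof (rule i)
      show "\<bar>A (thr \<theta> \<eta> t \<omega>) - A x\<bar> \<le> 1" for \<omega>
        using A01[of "thr \<theta> \<eta> t \<omega>"] A01[of x] by linarith
    qed measurable
    show "integrable M (\<lambda>\<omega>. Y \<theta> \<eta> s \<omega> * (of_bool (e t \<omega> \<le> thr \<theta> \<eta> t \<omega>) - of_bool (e t \<omega> \<le> x)))"
    proof (rule i)
      show "(\<lambda>\<omega>. of_bool (e t \<omega> \<le> thr \<theta> \<eta> t \<omega>) - of_bool (e t \<omega> \<le> x) :: real) \<in> borel_measurable M"
        by measurable
    qed (auto simp: of_bool_def)
  qed
  also have "\<dots> = 0"
    by (simp add: expectation_past_diff[OF Y_gen[OF \<open>s < t\<close>] Y_bound])
  finally show ?thesis .
qed

lemma expectation_increment_bound: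
  "expectation (\<lambda>\<omega>. \<bar>A (thr \<theta> \<eta> t \<omega>) - A x\<bar>) \<le> real (p + 1) * q + L * h * kap p \<theta> \<eta> * K"
proof -
  have "expectation (\<lambda>\<omega>. \<bar>A (thr \<theta> \<eta> t \<omega>) - A x\<bar>)
     \<le> expectation (\<lambda>\<omega>. (\<Sum>j\<le>p. zi (t - int j) \<omega>) + L * h * kap p \<theta> \<eta> * N0 t \<omega>)"
  proof (rule integral_mono)
    show "integrable M (\<lambda>\<omega>. \<bar>A (thr \<theta> \<eta> t \<omega>) - A x\<bar>)"
    proof (rule integrable_bounded)
      show "\<bar>\<bar>A (thr \<theta> \<eta> t \<omega>) - A x\<bar>\<bar> \<le> 1" for \<omega>
        using A01[of "thr \<theta> \<eta> t \<omega>"] A01[of x] by linarith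
    qed measurable
    show "integrable M (\<lambda>\<omega>. (\<Sum>j\<le>p. zi (t - int j) \<omega>) + L * h * kap p \<theta> \<eta> * N0 t \<omega>)"
      by (intro Bochner_Integration.integrable_add Bochner_Integration.integrable_sum integrable_mult_right integrable_zi sq_N0)
    show "\<bar>A (thr \<theta> \<eta> t \<omega>) - A x\<bar> \<le> (\<Sum>j\<le>p. zi (t - int j) \<omega>) + L * h * kap p \<theta> \<eta> * N0 t \<omega>" for \<omega>
      using increment_bound[of \<theta> \<eta> t \<omega>] by (simp add: mult.assoc)
  qed
  also have "\<dots> = real (p + 1) * q + L * h * kap p \<theta> \<eta> * expectation (N0 t)"
    by (simp add: zi(2) sq_N0(3))
  also have "\<dots> \<le> real (p + 1) * q + L * h * kap p \<theta> \<eta> * K"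
    using L_nonneg h_pos kap(1) by (intro add_left_mono mult_left_mono sq_N0) auto
  finally show ?thesis .
qed

text \<open>As |Y| is at most 2, its square is at most twice |J| + |D|, with J the difference of
  indicators and D its compensator. The mean of |J| does not exceed that of |D|, which gives the
  factor 4.\<close>

lemma expectation_sq_Y: "expectation (\<lambda>\<omega>. (Y \<theta> \<eta> t \<omega>)\<^sup>2) \<le> 4 * (real (p + 1) * q + L * h * kap p \<theta> \<eta> * K)"
proof -
  define D where "D \<omega> = A (thr \<theta> \<eta> t \<omega>) - A x" for \<omega>
  define J :: "'a \<Rightarrow> real" where "J \<omega> = of_bool (e t \<omega> \<le> thr \<theta> \<eta> t \<omega>) - of_bool (e t \<omega> \<le> x)" for \<omega>
  have [measurable]: "D \<in> borel_measurable M" "J \<in> borel_measurable M"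
    unfolding D_def[abs_def] J_def[abs_def] by measurable
  have D1: "\<bar>D \<omega>\<bar> \<le> 1" for \<omega>
    using A01[of "thr \<theta> \<eta> t \<omega>"] A01[of x] by (auto simp: D_def)
  have J1: "\<bar>J \<omega>\<bar> \<le> 1" for \<omega> by (auto simp: J_def)
  have iD: "integrable M (\<lambda>\<omega>. \<bar>D \<omega>\<bar>)" and iJ: "integrable M (\<lambda>\<omega>. \<bar>J \<omega>\<bar>)"
    by (rule integrable_bounded[of _ 1]; use D1 J1 in auto)+
  \<comment> \<open>Whether the threshold lies above or below x is known from the past. An indicator
    is monotone in its threshold, so this sign turns J into |J| and the compensator identity applies
    to |J|.\<close>
  define \<sigma> where "\<sigma> \<omega> = sgn (thr \<theta> \<eta> t \<omega> - x)" for \<omega>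
  have \<sigma>_gen: "\<sigma> \<in> borel_measurable (gen (past t))"
  proof -
    note [measurable] = thr_gen[of \<theta> \<eta> t]
    show ?thesis unfolding \<sigma>_def[abs_def] sgn_if by measurable
  qed
  have \<sigma>1: "\<bar>\<sigma> \<omega>\<bar> \<le> 1" for \<omega> by (auto simp: \<sigma>_def sgn_if)
  have J_abs: "\<bar>J \<omega>\<bar> = \<sigma> \<omega> * J \<omega>" for \<omega> by (auto simp: J_def \<sigma>_def sgn_if)
  have "expectation (\<lambda>\<omega>. \<bar>J \<omega>\<bar>) = expectation (\<lambda>\<omega>. \<sigma> \<omega> * D \<omega>)"
    unfolding J_abs unfolding J_def D_def by (rule expectation_past_diff[OF \<sigma>_gen \<sigma>1])
  also have "\<dots> \<le> expectation (\<lambda>\<omega>. \<bar>D \<omega>\<bar>)"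
  proof (rule integral_mono[OF _ iD])
    have [measurable]: "\<sigma> \<in> borel_measurable M" by (rule gen_measurable[OF \<sigma>_gen past_subset])
    have le: "\<bar>\<sigma> \<omega> * D \<omega>\<bar> \<le> \<bar>D \<omega>\<bar>" for \<omega>
      using mult_right_mono[OF \<sigma>1[of \<omega>], of "\<bar>D \<omega>\<bar>"] by (simp add: abs_mult)
    show "integrable M (\<lambda>\<omega>. \<sigma> \<omega> * D \<omega>)"
      by (rule integrable_bounded[of _ 1]) (use order.trans[OF le D1] in auto)
    show "\<sigma> \<omega> * D \<omega> \<le> \<bar>D \<omega>\<bar>" for \<omega> using le[of \<omega>] by linarith
  qed
  finally have EJ: "expectation (\<lambda>\<omega>. \<bar>J \<omega>\<bar>) \<le> expectation (\<lambda>\<omega>. \<bar>D \<omega>\<bar>)" .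
  have sq: "(Y \<theta> \<eta> t \<omega>)\<^sup>2 \<le> 2 * \<bar>J \<omega>\<bar> + 2 * \<bar>D \<omega>\<bar>" for \<omega>
  proof -
    have "\<bar>Y \<theta> \<eta> t \<omega>\<bar> * \<bar>Y \<theta> \<eta> t \<omega>\<bar> \<le> 2 * (\<bar>J \<omega>\<bar> + \<bar>D \<omega>\<bar>)"
    proof (rule mult_mono[OF Y_bound])
      show "\<bar>Y \<theta> \<eta> t \<omega>\<bar> \<le> \<bar>J \<omega>\<bar> + \<bar>D \<omega>\<bar>" by (simp add: Y_def J_def D_def)
    qed auto
    then show ?thesis by (simp add: power2_eq_square)
  qed
  have "expectation (\<lambda>\<omega>. (Y \<theta> \<eta> t \<omega>)\<^sup>2) \<le> expectation (\<lambda>\<omega>. 2 * \<bar>J \<omega>\<bar> + 2 * \<bar>D \<omega>\<bar>)"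
  proof (rule integral_mono[OF _ _ sq])
    show "integrable M (\<lambda>\<omega>. (Y \<theta> \<eta> t \<omega>)\<^sup>2)"
    proof (rule integrable_bounded[of _ 4])
      show "\<bar>(Y \<theta> \<eta> t \<omega>)\<^sup>2\<bar> \<le> 4" for \<omega>
        using mult_mono[OF Y_bound[of \<theta> \<eta> t \<omega>] Y_bound[of \<theta> \<eta> t \<omega>]] by (simp add: power2_eq_square)
    qed measurable
    show "integrable M (\<lambda>\<omega>. 2 * \<bar>J \<omega>\<bar> + 2 * \<bar>D \<omega>\<bar>)" using iJ iD by auto
  qed
  also have "\<dots> = 2 * expectation (\<lambda>\<omega>. \<bar>J \<omega>\<bar>) + 2 * expectation (\<lambda>\<omega>. \<bar>D \<omega>\<bar>)"
    using iJ iD by simp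
  also have "\<dots> \<le> 4 * expectation (\<lambda>\<omega>. \<bar>D \<omega>\<bar>)" using EJ by simp
  also have "\<dots> \<le> 4 * (real (p + 1) * q + L * h * kap p \<theta> \<eta> * K)"
    unfolding D_def by (intro mult_left_mono expectation_increment_bound) simp
  finally show ?thesis .
qed

text \<open>By orthogonality and h * h * n = 1 the second moment of the scaled sum is at most v. It
  serves both the martingale part and the centred outlier effects.\<close>

lemma sqrt_mean_bound:
  fixes F :: "int \<Rightarrow> 'a \<Rightarrow> real"
  assumes [measurable]: "\<And>t. F t \<in> borel_measurable M" and B: "\<And>t \<omega>. \<bar>F t \<omega>\<bar> \<le> B"
    and orth: "\<And>s t. s < t \<Longrightarrow> expectation (\<lambda>\<omega>. F s \<omega> * F t \<omega>) = 0"
    and v: "\<And>t. expectation (\<lambda>\<omega>. (F t \<omega>)\<^sup>2) \<le> v"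
  shows "expectation (\<lambda>\<omega>. \<bar>h * (\<Sum>t=1..int n. F t \<omega>)\<bar>) \<le> sqrt v"
proof -
  have int: "integrable M (\<lambda>\<omega>. F s \<omega> * F t \<omega>)" for s t
  proof (rule integrable_bounded)
    show "\<bar>F s \<omega> * F t \<omega>\<bar> \<le> B * B" for \<omega>
      unfolding abs_mult by (intro mult_mono B) (auto intro: order.trans[OF abs_ge_zero B])
  qed measurable
  have i1: "integrable M (F t)" for t by (rule integrable_bounded[OF _ B]) measurable
  define Z where "Z \<omega> = h * (\<Sum>t=1..int n. F t \<omega>)" for \<omega>
  note orth' = expectation_sum_orthogonal[of "{1..int n}" F]
  have sq: "(Z \<omega>)\<^sup>2 = h * h * (\<Sum>t=1..int n. F t \<omega>)\<^sup>2" for \<omega>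
    by (simp add: Z_def power2_eq_square mult_ac)
  have "expectation (\<lambda>\<omega>. \<bar>Z \<omega>\<bar>) \<le> sqrt (expectation (\<lambda>\<omega>. (Z \<omega>)\<^sup>2))"
  proof (rule expectation_abs_le_sqrt)
    show "integrable M Z" unfolding Z_def[abs_def]
      by (intro integrable_mult_right Bochner_Integration.integrable_sum i1)
    show "integrable M (\<lambda>\<omega>. (Z \<omega>)\<^sup>2)"
      unfolding sq by (intro integrable_mult_right orth'(2)) (auto simp: int orth)
  qed
  also have "expectation (\<lambda>\<omega>. (Z \<omega>)\<^sup>2) = h * h * (\<Sum>t=1..int n. expectation (\<lambda>\<omega>. (F t \<omega>)\<^sup>2))"
    unfolding sq using orth'(1) int orth by simp
  also have "\<dots> \<le> h * h * (\<Sum>t=1..int n. v)"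
    by (intro mult_left_mono sum_mono v) auto
  also have "\<dots> = v" using h_sq by (simp add: mult.assoc[symmetric])
  finally show ?thesis by (simp add: Z_def)
qed

lemma martingale_bound:
  "expectation (\<lambda>\<omega>. \<bar>h * (\<Sum>t=1..int n. Y \<theta> \<eta> t \<omega>)\<bar>) \<le> sqrt (4 * (real (p + 1) * q + L * h * kap p \<theta> \<eta> * K))"
  by (rule sqrt_mean_bound[OF Y_borel Y_bound Y_orthogonal expectation_sq_Y])

section \<open>The single-outlier effect and the remainder of the compensator\<close>

definition psi_mean :: "nat \<Rightarrow> real" where "psi_mean j = (\<integral>u. psi j u \<partial>Q)"

lemma psi_bound: "\<bar>psi j u\<bar> \<le> 1"
  using G(2,3)[of "x + b j * u"] G(2,3)[of x] by (auto simp: psi_def abs_le_iff)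

lemma expectation_xi:
  fixes f :: "real \<Rightarrow> real"
  assumes "f \<in> borel_measurable borel"
  shows "expectation (\<lambda>\<omega>. f (xi t \<omega>)) = (\<integral>u. f u \<partial>Q)"
  unfolding xi[of t, symmetric] by (rule integral_distr[symmetric]) (use assms in auto)

lemma expectation_zi_xi:
  fixes f :: "real \<Rightarrow> real"
  assumes [measurable]: "f \<in> borel_measurable borel" and B: "\<And>u. \<bar>f u\<bar> \<le> B"
  shows "expectation (\<lambda>\<omega>. zi t \<omega> * f (xi t \<omega>)) = q * (\<integral>u. f u \<partial>Q)"
    and "integrable M (\<lambda>\<omega>. zi t \<omega> * f (xi t \<omega>))"
proof -
  have [measurable]: "xi t \<in> borel_measurable (gen {(2, t)})" by (rule gen_rv) simp
  have 1: "(\<lambda>\<omega>. f (xi t \<omega>)) \<in> borel_measurable (gen {(2, t)})" by measurable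
  have 2: "integrable M (\<lambda>\<omega>. f (xi t \<omega>))" by (rule integrable_bounded[OF _ B]) measurable
  note * = expectation_mult_disjoint[OF gen_rv(2)[of t "{(Suc 0, t)}"] 1 _ _ _ integrable_zi 2]
  show "expectation (\<lambda>\<omega>. zi t \<omega> * f (xi t \<omega>)) = q * (\<integral>u. f u \<partial>Q)"
    by (subst *(1)) (auto simp: zi(2) expectation_xi)
  show "integrable M (\<lambda>\<omega>. zi t \<omega> * f (xi t \<omega>))" by (rule *(2)) auto
qed

text \<open>At a fixed lag the summands are independent over time, which would fail if the
  overlapping windows were summed first. Their variance is at most q because |psi| is at most 1 and
  the indicator equals its square, so the sum scaled by h vanishes along with q.\<close>

lemma psi_sum_bound:
  "expectation (\<lambda>\<omega>. \<bar>h * (\<Sum>t=1..int n. zi (t - int j) \<omega> * psi j (xi (t - int j) \<omega>) - q * psi_mean j)\<bar>) \<le> sqrt q"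
proof (rule sqrt_mean_bound)
  define F where "F t \<omega> = zi t \<omega> * psi j (xi t \<omega>)" for t \<omega>
  have [measurable]: "F t \<in> borel_measurable M" for t unfolding F_def[abs_def] by measurable
  have mean: "expectation (F t) = q * psi_mean j" and int: "integrable M (F t)" for t
    using expectation_zi_xi[OF psi_borel psi_bound, of t j] by (auto simp: F_def[abs_def] psi_mean_def)
  have F1: "\<bar>F t \<omega>\<bar> \<le> zi t \<omega>" for t \<omega>
    using zi(1)[of t \<omega>] psi_bound by (auto simp: F_def)
  have m1: "\<bar>q * psi_mean j\<bar> \<le> 1"
  proof -
    have "\<bar>expectation (F 0)\<bar> \<le> expectation (zi 0)"
      by (rule order.trans[OF integral_abs_bound integral_mono]) (use F1 int in auto)
    then show ?thesis using q01 by (auto simp: mean zi(2))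
  qed
  show "(\<lambda>\<omega>. zi (t - int j) \<omega> * psi j (xi (t - int j) \<omega>) - q * psi_mean j) \<in> borel_measurable M" for t
    by measurable
  show "\<bar>zi (t - int j) \<omega> * psi j (xi (t - int j) \<omega>) - q * psi_mean j\<bar> \<le> 2" for t \<omega>
    using F1[of "t - int j" \<omega>] zi_bounds[of "t - int j" \<omega>] m1 unfolding F_def by linarith
  show "expectation (\<lambda>\<omega>. (zi (s - int j) \<omega> * psi j (xi (s - int j) \<omega>) - q * psi_mean j)
      * (zi (t - int j) \<omega> * psi j (xi (t - int j) \<omega>) - q * psi_mean j)) = 0" if "s < t" for s t
  proof -
    have g: "(\<lambda>\<omega>. F s \<omega> - q * psi_mean j) \<in> borel_measurable (gen {(Suc 0, s), (2, s)})" for s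
    proof -
      have [measurable]: "xi s \<in> borel_measurable (gen {(Suc 0, s), (2, s)})"
        "zi s \<in> borel_measurable (gen {(Suc 0, s), (2, s)})" by (auto intro!: gen_rv)
      show ?thesis unfolding F_def[abs_def] by measurable
    qed
    have i: "integrable M (\<lambda>\<omega>. F s \<omega> - q * psi_mean j)" for s using int by auto
    have "expectation (\<lambda>\<omega>. (F (s - int j) \<omega> - q * psi_mean j) * (F (t - int j) \<omega> - q * psi_mean j))
      = expectation (\<lambda>\<omega>. F (s - int j) \<omega> - q * psi_mean j) * expectation (\<lambda>\<omega>. F (t - int j) \<omega> - q * psi_mean j)"
      by (rule expectation_mult_disjoint(1)[OF g g _ _ _ i i]) (use that in auto)
    also have "\<dots> = 0" using int mean by (simp add: prob_space)
    finally show ?thesis by (simp add: F_def)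
  qed
  show "expectation (\<lambda>\<omega>. (zi (t - int j) \<omega> * psi j (xi (t - int j) \<omega>) - q * psi_mean j)\<^sup>2) \<le> q" for t
  proof -
    have sqb: "(F s \<omega>)\<^sup>2 \<le> zi s \<omega>" for s \<omega>
      using F1[of s \<omega>] zi(1)[of s \<omega>] by (auto simp: abs_square_le_1)
    have int2: "integrable M (\<lambda>\<omega>. (F s \<omega>)\<^sup>2)" for s
      by (rule Bochner_Integration.integrable_bound[OF integrable_zi[of s]]) (use sqb in \<open>auto intro!: order.trans[OF _ abs_ge_self]\<close>)
    have "expectation (\<lambda>\<omega>. (F (t - int j) \<omega> - q * psi_mean j)\<^sup>2)
        = expectation (\<lambda>\<omega>. (F (t - int j) \<omega>)\<^sup>2) - (q * psi_mean j)\<^sup>2"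
      using variance_eq[OF int int2, of "t - int j"] by (simp add: mean)
    also have "\<dots> \<le> expectation (\<lambda>\<omega>. (F (t - int j) \<omega>)\<^sup>2)" by simp
    also have "\<dots> \<le> expectation (zi (t - int j))" by (intro integral_mono int2 sqb integrable_zi)
    finally show ?thesis by (simp add: F_def zi(2))
  qed
qed

definition phi :: "real \<Rightarrow> real" where "phi a = (\<integral>u. min 1 (a * \<bar>u\<bar>) \<partial>Q)"

text \<open>Bounds the mean of the right side of \<open>compensator_bound\<close>, with both moments
  of \<open>N0\<close> replaced by \<open>K\<close>. An indicator is independent of the outlier
  size, of \<open>N0\<close> and of the indicators at other times, so each product factorises and
  yields q or \<open>q\<^sup>2\<close>.\<close>

definition remainder_bound :: "real \<Rightarrow> real" where
  "remainder_bound \<kappa> = L * h\<^sup>2 * \<kappa>\<^sup>2 * K + L * r * h * \<kappa> * K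
     + real (p + 1) * (q * phi (L * h * \<kappa>) + 2 * r * q + 2 * L * h * \<kappa> * q * K)
     + 2 * (real (p + 1) * real p * q\<^sup>2)"

definition remainder :: "(nat \<Rightarrow> real) \<Rightarrow> real \<Rightarrow> int \<Rightarrow> 'a \<Rightarrow> real" where
  "remainder \<theta> \<eta> t \<omega> = A (thr \<theta> \<eta> t \<omega>) - A x - g * (h * shift0 \<theta> \<eta> t \<omega>)
      - (\<Sum>j\<le>p. zi (t - int j) \<omega> * psi j (xi (t - int j) \<omega>))"

lemma remainder_borel [measurable]: "remainder \<theta> \<eta> t \<in> borel_measurable M"
  unfolding remainder_def[abs_def] by measurable

text \<open>\<open>N0\<close> is a function of innovations alone, hence independent of every outlier
  variable.\<close>

lemma N0_gen: "N0 t \<in> borel_measurable (gen ({0} \<times> UNIV))"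
proof -
  have [measurable]: "V s \<in> borel_measurable (gen ({0} \<times> UNIV))" for s by (rule V_gen) auto
  show ?thesis unfolding N0_def[abs_def] U0_def by measurable
qed

lemma expectation_zi_N0:
  "expectation (\<lambda>\<omega>. zi s \<omega> * N0 t \<omega>) = q * expectation (N0 t)" "integrable M (\<lambda>\<omega>. zi s \<omega> * N0 t \<omega>)"
proof -
  note * = expectation_mult_disjoint[OF gen_rv(2)[of s "{(Suc 0, s)}"] N0_gen _ _ _ integrable_zi sq_N0(3)]
  show "expectation (\<lambda>\<omega>. zi s \<omega> * N0 t \<omega>) = q * expectation (N0 t)"
    by (subst *(1)) (auto simp: zi(2))
  show "integrable M (\<lambda>\<omega>. zi s \<omega> * N0 t \<omega>)" by (rule *(2)) auto
qed

lemma expectation_zi_zi: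
  assumes "s \<noteq> t"
  shows "expectation (\<lambda>\<omega>. zi s \<omega> * zi t \<omega>) = q\<^sup>2" "integrable M (\<lambda>\<omega>. zi s \<omega> * zi t \<omega>)"
proof -
  note * = expectation_mult_disjoint[OF gen_rv(2)[of s "{(Suc 0, s)}"] gen_rv(2)[of t "{(Suc 0, t)}"] _ _ _
      integrable_zi integrable_zi]
  show "expectation (\<lambda>\<omega>. zi s \<omega> * zi t \<omega>) = q\<^sup>2"
    by (subst *(1)) (use assms in \<open>auto simp: zi(2) power2_eq_square\<close>)
  show "integrable M (\<lambda>\<omega>. zi s \<omega> * zi t \<omega>)" by (rule *(2)) (use assms in auto)
qed

lemma expectation_remainder:
  "integrable M (remainder \<theta> \<eta> t)" "expectation (\<lambda>\<omega>. \<bar>remainder \<theta> \<eta> t \<omega>\<bar>) \<le> remainder_bound (kap p \<theta> \<eta>)"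
proof -
  define \<kappa> where "\<kappa> = kap p \<theta> \<eta>"
  define a where "a = L * h * \<kappa>"
  have \<kappa>: "\<kappa> \<ge> 0" by (simp add: \<kappa>_def kap)
  have a: "a \<ge> 0" using \<kappa> L_nonneg h_pos by (simp add: a_def)
  define F1 where "F1 j \<omega> = zi (t - int j) \<omega> * min 1 (a * \<bar>xi (t - int j) \<omega>\<bar>)" for j \<omega>
  define F2 where "F2 j \<omega> = zi (t - int j) \<omega> * N0 t \<omega>" for j \<omega>
  define F3 where "F3 j k \<omega> = zi (t - int j) \<omega> * zi (t - int k) \<omega>" for j k \<omega>
  define R where "R \<omega> = L * h\<^sup>2 * \<kappa>\<^sup>2 * (N0 t \<omega>)\<^sup>2 + L * r * h * \<kappa> * N0 t \<omega>
     + (\<Sum>j\<le>p. F1 j \<omega> + 2 * r * zi (t - int j) \<omega> + 2 * L * h * \<kappa> * F2 j \<omega>)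
     + 2 * (\<Sum>j\<le>p. \<Sum>k\<in>{..p} - {j}. F3 j k \<omega>)" for \<omega>
  have le: "\<bar>remainder \<theta> \<eta> t \<omega>\<bar> \<le> R \<omega>" for \<omega>
  proof -
    have "(\<Sum>j\<le>p. zi (t - int j) \<omega> * (min 1 (L * h * kap p \<theta> \<eta> * \<bar>xi (t - int j) \<omega>\<bar>)
            + 2 * r + 2 * L * (h * kap p \<theta> \<eta> * N0 t \<omega>)))
        = (\<Sum>j\<le>p. F1 j \<omega> + 2 * r * zi (t - int j) \<omega> + 2 * L * h * \<kappa> * F2 j \<omega>)"
      by (intro sum.cong) (simp_all add: F1_def F2_def a_def \<kappa>_def algebra_simps)
    moreover have "L * (h * kap p \<theta> \<eta> * N0 t \<omega>)\<^sup>2 = L * h\<^sup>2 * \<kappa>\<^sup>2 * (N0 t \<omega>)\<^sup>2"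
      by (simp add: \<kappa>_def power_mult_distrib)
    moreover have "L * r * (h * kap p \<theta> \<eta> * N0 t \<omega>) = L * r * h * \<kappa> * N0 t \<omega>"
      by (simp add: \<kappa>_def)
    ultimately show ?thesis
      using compensator_bound[of \<theta> \<eta> t \<omega>] unfolding remainder_def R_def F3_def by (simp only:)
  qed
  have min_bound: "\<bar>min 1 (a * \<bar>u\<bar>)\<bar> \<le> 1" for u using a by (simp add: abs_le_iff)
  have min_borel: "(\<lambda>u. min 1 (a * \<bar>u\<bar>)) \<in> borel_measurable borel" by measurable
  note zx = expectation_zi_xi[OF min_borel min_bound]
  have iF1: "integrable M (F1 j)" and eF1: "expectation (F1 j) = q * phi a" for j
    using zx by (auto simp: F1_def[abs_def] phi_def)
  have iF2: "integrable M (F2 j)" and eF2: "expectation (F2 j) = q * expectation (N0 t)" for j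
    using expectation_zi_N0 by (auto simp: F2_def[abs_def])
  have iF3: "integrable M (F3 j k)" and eF3: "expectation (F3 j k) = q\<^sup>2" if "k \<in> {..p} - {j}" for j k
    using expectation_zi_zi[of "t - int j" "t - int k"] that by (auto simp: F3_def[abs_def])
  have iR: "integrable M R"
    unfolding R_def[abs_def]
    by (intro Bochner_Integration.integrable_add Bochner_Integration.integrable_sum integrable_mult_right iF1 iF2 iF3 sq_N0 integrable_zi)
  show int: "integrable M (remainder \<theta> \<eta> t)"
    by (rule Bochner_Integration.integrable_bound[OF iR]) (auto intro!: order.trans[OF le abs_ge_self])
  have "expectation (\<lambda>\<omega>. \<bar>remainder \<theta> \<eta> t \<omega>\<bar>) \<le> expectation R"
    by (intro integral_mono iR le) (use int in auto)
  also have "\<dots> = L * h\<^sup>2 * \<kappa>\<^sup>2 * expectation (\<lambda>\<omega>. (N0 t \<omega>)\<^sup>2) + L * r * h * \<kappa> * expectation (N0 t)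
     + (\<Sum>j\<le>p. q * phi a + 2 * r * q + 2 * L * h * \<kappa> * (q * expectation (N0 t)))
     + 2 * (\<Sum>j\<le>p. \<Sum>k\<in>{..p} - {j}. q\<^sup>2)"
  proof -
    have s2: "expectation (\<lambda>\<omega>. F1 j \<omega> + 2 * r * zi (t - int j) \<omega> + 2 * L * h * \<kappa> * F2 j \<omega>)
       = q * phi a + 2 * r * q + 2 * L * h * \<kappa> * (q * expectation (N0 t))"
      and i2: "integrable M (\<lambda>\<omega>. F1 j \<omega> + 2 * r * zi (t - int j) \<omega> + 2 * L * h * \<kappa> * F2 j \<omega>)" for j
      by (simp_all add: iF1 iF2 eF1 eF2 zi(2))
    have s3: "expectation (\<lambda>\<omega>. \<Sum>k\<in>{..p} - {j}. F3 j k \<omega>) = (\<Sum>k\<in>{..p} - {j}. q\<^sup>2)" for j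
      by (subst Bochner_Integration.integral_sum[OF iF3]) (auto simp: eF3)
    have i3: "integrable M (\<lambda>\<omega>. \<Sum>k\<in>{..p} - {j}. F3 j k \<omega>)" for j
      by (rule Bochner_Integration.integrable_sum[OF iF3])
    show ?thesis
      unfolding R_def[abs_def] by (simp add: i2 s2 i3 s3 sq_N0 Bochner_Integration.integral_sum)
  qed
  also have "\<dots> = L * h\<^sup>2 * \<kappa>\<^sup>2 * expectation (\<lambda>\<omega>. (N0 t \<omega>)\<^sup>2) + L * r * h * \<kappa> * expectation (N0 t)
     + real (p + 1) * (q * phi a + 2 * r * q + 2 * L * h * \<kappa> * q * expectation (N0 t))
     + 2 * (real (p + 1) * real p * q\<^sup>2)"
    by (simp add: algebra_simps)
  also have "\<dots> \<le> remainder_bound \<kappa>"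
    unfolding remainder_bound_def a_def
    using L_nonneg h_pos r q01 \<kappa> by (intro add_mono mult_left_mono sq_N0 order.refl) auto
  finally show "expectation (\<lambda>\<omega>. \<bar>remainder \<theta> \<eta> t \<omega>\<bar>) \<le> remainder_bound (kap p \<theta> \<eta>)"
    by (simp add: \<kappa>_def)
qed

section \<open>Deviation of the process at fixed coefficients\<close>

definition increment :: "(nat \<Rightarrow> real) \<Rightarrow> real \<Rightarrow> 'a \<Rightarrow> real" where
  "increment \<theta> \<eta> \<omega> = h * (\<Sum>t=1..int n. of_bool (e t \<omega> \<le> thr \<theta> \<eta> t \<omega>) - of_bool (e t \<omega> \<le> x))"

text \<open>The outlier bias is centred with \<open>real n * h * q\<close>, which makes the bounds
  valid at every sample size; this equals the contamination parameter once the minimum in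
  \<open>rate\<close> is inactive.\<close>

definition deviation :: "(nat \<Rightarrow> real) \<Rightarrow> real \<Rightarrow> 'a \<Rightarrow> real" where
  "deviation \<theta> \<eta> \<omega> = increment \<theta> \<eta> \<omega> - g * ((\<Sum>t=1..int n. shift0 \<theta> \<eta> t \<omega>) / real n)
     - real n * h * q * (\<Sum>j\<le>p. psi_mean j)"

lemma deviation_borel [measurable]: "deviation \<theta> \<eta> \<in> borel_measurable M"
  unfolding deviation_def[abs_def] increment_def by measurable

text \<open>The remainder is divided by h because n summands scaled by h amount to a factor 1 / h.
  So \<open>remainder_bound\<close> has to be of smaller order than h: with q and r of order h, each
  of its terms has two factors of that order, except the one with \<open>phi\<close>, where
  \<open>phi\<close> itself vanishes.\<close>

lemma deviation_bound:
  "expectation (\<lambda>\<omega>. \<bar>deviation \<theta> \<eta> \<omega>\<bar>) \<le> sqrt (4 * (real (p + 1) * q + L * h * kap p \<theta> \<eta> * K))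
     + remainder_bound (kap p \<theta> \<eta>) / h + real (p + 1) * sqrt q" (is "_ \<le> ?B")
  and integrable_deviation: "integrable M (deviation \<theta> \<eta>)"
proof -
  define D1 where "D1 \<omega> = h * (\<Sum>t=1..int n. Y \<theta> \<eta> t \<omega>)" for \<omega>
  define D2 where "D2 \<omega> = h * (\<Sum>t=1..int n. remainder \<theta> \<eta> t \<omega>)" for \<omega>
  define D3 where "D3 j \<omega> = h * (\<Sum>t=1..int n. zi (t - int j) \<omega> * psi j (xi (t - int j) \<omega>) - q * psi_mean j)" for j \<omega>
  have eq: "deviation \<theta> \<eta> \<omega> = D1 \<omega> + D2 \<omega> + (\<Sum>j\<le>p. D3 j \<omega>)" for \<omega>
  proof -
    have D3: "(\<Sum>j\<le>p. D3 j \<omega>) = h * (\<Sum>t=1..int n. \<Sum>j\<le>p. zi (t - int j) \<omega> * psi j (xi (t - int j) \<omega>))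
        - real n * h * q * (\<Sum>j\<le>p. psi_mean j)"
    proof -
      have "(\<Sum>j\<le>p. D3 j \<omega>) = (\<Sum>j\<le>p. h * (\<Sum>t=1..int n. zi (t - int j) \<omega> * psi j (xi (t - int j) \<omega>))
          - real n * h * q * psi_mean j)"
        unfolding D3_def by (intro sum.cong) (simp_all add: sum_subtractf algebra_simps)
      also have "\<dots> = h * (\<Sum>j\<le>p. \<Sum>t=1..int n. zi (t - int j) \<omega> * psi j (xi (t - int j) \<omega>))
        - real n * h * q * (\<Sum>j\<le>p. psi_mean j)"
        by (simp add: sum_subtractf sum_distrib_left)
      also have "(\<Sum>j\<le>p. \<Sum>t=1..int n. zi (t - int j) \<omega> * psi j (xi (t - int j) \<omega>))
          = (\<Sum>t=1..int n. \<Sum>j\<le>p. zi (t - int j) \<omega> * psi j (xi (t - int j) \<omega>))"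
        by (rule sum.swap)
      finally show ?thesis .
    qed
    \<comment> \<open>The drift of each summand has size h and the sum is scaled by h; as h * h = 1
      / n, the total drift is an average over time.\<close>
    have hh: "h * (g * (h * u)) = g * (u / real n)" for u
      using h_sq n by (simp add: h_def)
    have "h * (\<Sum>t=1..int n. g * (h * shift0 \<theta> \<eta> t \<omega>)) = g * ((\<Sum>t=1..int n. shift0 \<theta> \<eta> t \<omega>) / real n)"
      unfolding hh[symmetric] by (simp add: sum_distrib_left)
    moreover have "D1 \<omega> + D2 \<omega> = increment \<theta> \<eta> \<omega> - h * (\<Sum>t=1..int n. g * (h * shift0 \<theta> \<eta> t \<omega>))
        - h * (\<Sum>t=1..int n. \<Sum>j\<le>p. zi (t - int j) \<omega> * psi j (xi (t - int j) \<omega>))"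
      unfolding D1_def D2_def increment_def right_diff_distrib[symmetric] distrib_left[symmetric]
        sum_subtractf[symmetric] sum.distrib[symmetric]
      by (intro arg_cong[where f="times h"] refl sum.cong) (simp add: Y_def remainder_def)
    ultimately show ?thesis unfolding deviation_def D3 by simp
  qed
  have i1: "integrable M D1"
    unfolding D1_def[abs_def]
    by (intro integrable_mult_right Bochner_Integration.integrable_sum integrable_bounded[OF Y_borel Y_bound])
  have i2: "integrable M D2"
    unfolding D2_def[abs_def]
    by (intro integrable_mult_right Bochner_Integration.integrable_sum expectation_remainder(1))
  have i3: "integrable M (D3 j)" for j
    unfolding D3_def[abs_def]
    by (intro integrable_mult_right Bochner_Integration.integrable_sum Bochner_Integration.integrable_diff
        expectation_zi_xi(2)[OF psi_borel psi_bound]) simp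
  show int: "integrable M (deviation \<theta> \<eta>)"
    unfolding eq by (intro Bochner_Integration.integrable_add Bochner_Integration.integrable_sum i1 i2 i3)
  have "expectation (\<lambda>\<omega>. \<bar>deviation \<theta> \<eta> \<omega>\<bar>) \<le> expectation (\<lambda>\<omega>. \<bar>D1 \<omega>\<bar> + \<bar>D2 \<omega>\<bar> + (\<Sum>j\<le>p. \<bar>D3 j \<omega>\<bar>))"
  proof (rule integral_mono)
    show "integrable M (\<lambda>\<omega>. \<bar>deviation \<theta> \<eta> \<omega>\<bar>)" using int by simp
    show "integrable M (\<lambda>\<omega>. \<bar>D1 \<omega>\<bar> + \<bar>D2 \<omega>\<bar> + (\<Sum>j\<le>p. \<bar>D3 j \<omega>\<bar>))"
      by (intro Bochner_Integration.integrable_add Bochner_Integration.integrable_sum integrable_abs i1 i2 i3)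
    show "\<bar>deviation \<theta> \<eta> \<omega>\<bar> \<le> \<bar>D1 \<omega>\<bar> + \<bar>D2 \<omega>\<bar> + (\<Sum>j\<le>p. \<bar>D3 j \<omega>\<bar>)" for \<omega>
      unfolding eq using sum_abs[of "\<lambda>j. D3 j \<omega>" "{..p}"] by linarith
  qed
  also have "\<dots> = expectation (\<lambda>\<omega>. \<bar>D1 \<omega>\<bar>) + expectation (\<lambda>\<omega>. \<bar>D2 \<omega>\<bar>) + (\<Sum>j\<le>p. expectation (\<lambda>\<omega>. \<bar>D3 j \<omega>\<bar>))"
    by (simp add: i1 i2 i3 Bochner_Integration.integral_sum)
  also have "\<dots> \<le> sqrt (4 * (real (p + 1) * q + L * h * kap p \<theta> \<eta> * K)) + remainder_bound (kap p \<theta> \<eta>) / h + (\<Sum>j\<le>p. sqrt q)"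
  proof (intro add_mono sum_mono)
    show "expectation (\<lambda>\<omega>. \<bar>D1 \<omega>\<bar>) \<le> sqrt (4 * (real (p + 1) * q + L * h * kap p \<theta> \<eta> * K))"
      unfolding D1_def by (rule martingale_bound)
    show "expectation (\<lambda>\<omega>. \<bar>D3 j \<omega>\<bar>) \<le> sqrt q" for j
      unfolding D3_def by (rule psi_sum_bound)
    have "expectation (\<lambda>\<omega>. \<bar>D2 \<omega>\<bar>) \<le> expectation (\<lambda>\<omega>. h * (\<Sum>t=1..int n. \<bar>remainder \<theta> \<eta> t \<omega>\<bar>))"
    proof (rule integral_mono)
      show "integrable M (\<lambda>\<omega>. \<bar>D2 \<omega>\<bar>)" using i2 by simp
      show "integrable M (\<lambda>\<omega>. h * (\<Sum>t=1..int n. \<bar>remainder \<theta> \<eta> t \<omega>\<bar>))"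
        by (intro integrable_mult_right Bochner_Integration.integrable_sum integrable_abs expectation_remainder(1))
      show "\<bar>D2 \<omega>\<bar> \<le> h * (\<Sum>t=1..int n. \<bar>remainder \<theta> \<eta> t \<omega>\<bar>)" for \<omega>
        using h_pos by (simp add: D2_def abs_mult sum_abs)
    qed
    also have "\<dots> = h * (\<Sum>t=1..int n. expectation (\<lambda>\<omega>. \<bar>remainder \<theta> \<eta> t \<omega>\<bar>))"
      by (simp add: Bochner_Integration.integral_sum expectation_remainder(1))
    also have "\<dots> \<le> h * (\<Sum>t=1..int n. remainder_bound (kap p \<theta> \<eta>))"
      using h_pos by (intro mult_left_mono sum_mono expectation_remainder(2)) auto
    also have "\<dots> = remainder_bound (kap p \<theta> \<eta>) / h"
    proof -
      have "h * real n = 1 / h" using h_sq h_pos by (simp add: field_simps)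
      then show ?thesis by (simp add: mult.assoc[symmetric])
    qed
    finally show "expectation (\<lambda>\<omega>. \<bar>D2 \<omega>\<bar>) \<le> remainder_bound (kap p \<theta> \<eta>) / h" .
  qed
  finally show "expectation (\<lambda>\<omega>. \<bar>deviation \<theta> \<eta> \<omega>\<bar>) \<le> ?B" by simp
qed

text \<open>Averaging isolates the intercept: the other coefficients multiply sample means of the
  centred solution, which vanish as n grows by \<open>mean_V_bound\<close>.\<close>

lemma mean_shift0:
  "(\<Sum>t=1..int n. shift0 \<theta> \<eta> t \<omega>) / real n
    = \<theta> 0 + (\<Sum>j=1..p. \<theta> j * ((\<Sum>t=1..int n. V (t - int j) \<omega>) / real n))
      + \<eta> * ((\<Sum>t=1..int n. N0 t \<omega>) / real n)"
proof -
  have split: "{..p} = insert 0 {1..p}" by auto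
  have "shift0 \<theta> \<eta> t \<omega> = \<theta> 0 + (\<Sum>j=1..p. \<theta> j * V (t - int j) \<omega>) + \<eta> * N0 t \<omega>" for t
    unfolding shift0_def N0_def sum.distrib sum_distrib_left[symmetric]
    by (simp add: split U0_def)
  then have "(\<Sum>t=1..int n. shift0 \<theta> \<eta> t \<omega>)
    = real n * \<theta> 0 + (\<Sum>t=1..int n. \<Sum>j=1..p. \<theta> j * V (t - int j) \<omega>) + \<eta> * (\<Sum>t=1..int n. N0 t \<omega>)"
    by (simp add: sum.distrib sum_distrib_left)
  also have "(\<Sum>t=1..int n. \<Sum>j=1..p. \<theta> j * V (t - int j) \<omega>) = (\<Sum>j=1..p. \<theta> j * (\<Sum>t=1..int n. V (t - int j) \<omega>))"
    by (subst sum.swap) (simp add: sum_distrib_left)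
  finally have eq: "(\<Sum>t=1..int n. shift0 \<theta> \<eta> t \<omega>) = real n * \<theta> 0
      + (\<Sum>j=1..p. \<theta> j * (\<Sum>t=1..int n. V (t - int j) \<omega>)) + \<eta> * (\<Sum>t=1..int n. N0 t \<omega>)" .
  have "(\<Sum>j=1..p. \<theta> j * s j) / real n = (\<Sum>j=1..p. \<theta> j * (s j / real n))" for s
    by (simp add: sum_divide_distrib)
  then show ?thesis unfolding eq add_divide_distrib using n by simp
qed

section \<open>Bracketing on a finite grid\<close>

lemma shift_sandwich:
  assumes "\<And>j. j \<le> p \<Longrightarrow> \<bar>\<tau> j - \<theta> j\<bar> \<le> \<eta>"
  shows "shift \<theta> (- \<eta>) t \<omega> \<le> shift \<tau> 0 t \<omega>" "shift \<tau> 0 t \<omega> \<le> shift \<theta> \<eta> t \<omega>"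
proof -
  \<comment> \<open>Valid for every regressor value u, contaminated lags included, so the bracket
    holds however large the outliers are; this is why \<open>shift\<close> applies \<eta> to the
    modulus of the contaminated regressor.\<close>
  have *: "\<bar>\<tau> j * u - \<theta> j * u\<bar> \<le> \<eta> * \<bar>u\<bar>" if "j \<le> p" for j u
    using mult_right_mono[OF assms[OF that], of "\<bar>u\<bar>"] by (simp add: abs_mult[symmetric] left_diff_distrib)
  show "shift \<theta> (- \<eta>) t \<omega> \<le> shift \<tau> 0 t \<omega>"
    unfolding shift_def
  proof (rule sum_mono)
    fix j assume "j \<in> {..p}"
    then show "\<theta> j * (U0 t j \<omega> + Oz t j \<omega>) + - \<eta> * \<bar>U0 t j \<omega> + Oz t j \<omega>\<bar>
      \<le> \<tau> j * (U0 t j \<omega> + Oz t j \<omega>) + 0 * \<bar>U0 t j \<omega> + Oz t j \<omega>\<bar>"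
      using *[of j "U0 t j \<omega> + Oz t j \<omega>"] by (simp add: abs_le_iff)
  qed
  show "shift \<tau> 0 t \<omega> \<le> shift \<theta> \<eta> t \<omega>"
    unfolding shift_def
  proof (rule sum_mono)
    fix j assume "j \<in> {..p}"
    then show "\<tau> j * (U0 t j \<omega> + Oz t j \<omega>) + 0 * \<bar>U0 t j \<omega> + Oz t j \<omega>\<bar>
      \<le> \<theta> j * (U0 t j \<omega> + Oz t j \<omega>) + \<eta> * \<bar>U0 t j \<omega> + Oz t j \<omega>\<bar>"
      using *[of j "U0 t j \<omega> + Oz t j \<omega>"] by (simp add: abs_le_iff)
  qed
qed

lemma increment_mono:
  assumes "\<And>t. shift \<theta> \<eta> t \<omega> \<le> shift \<theta>' \<eta>' t \<omega>"
  shows "increment \<theta> \<eta> \<omega> \<le> increment \<theta>' \<eta>' \<omega>"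
  unfolding increment_def
proof (intro mult_left_mono sum_mono diff_right_mono)
  fix t
  have "thr \<theta> \<eta> t \<omega> \<le> thr \<theta>' \<eta>' t \<omega>"
    unfolding thr_def using assms h_pos by (intro add_right_mono add_left_mono mult_left_mono) auto
  then show "of_bool (e t \<omega> \<le> thr \<theta> \<eta> t \<omega>) \<le> (of_bool (e t \<omega> \<le> thr \<theta>' \<eta>' t \<omega>) :: real)"
    by (auto simp: of_bool_def)
qed (use h_pos in auto)

text \<open>A lattice of mesh \<eta> covering the cube of half-width B in the coordinates 0 to p,
  with a margin for rounding. It depends on p, B and \<eta> only, so the limit in n passes through
  sums over it.\<close>

definition grid :: "real \<Rightarrow> real \<Rightarrow> (nat \<Rightarrow> real) set" where
  "grid B \<eta> = (\<Pi>\<^sub>E j\<in>{..p}. (\<lambda>k. \<eta> * real_of_int k) ` {- \<lceil>B / \<eta>\<rceil> - 1..\<lceil>B / \<eta>\<rceil> + 1})"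

lemma finite_grid: "finite (grid B \<eta>)"
  unfolding grid_def by (intro finite_PiE) auto

lemma grid_dense:
  assumes \<eta>: "\<eta> > 0" and \<tau>: "\<And>j. j \<le> p \<Longrightarrow> \<bar>\<tau> j\<bar> \<le> B"
  obtains \<theta> where "\<theta> \<in> grid B \<eta>" "\<And>j. j \<le> p \<Longrightarrow> \<bar>\<tau> j - \<theta> j\<bar> \<le> \<eta>"
proof
  define \<theta> where "\<theta> = (\<lambda>j\<in>{..p}. \<eta> * real_of_int \<lfloor>\<tau> j / \<eta>\<rfloor>)"
  show "\<theta> \<in> grid B \<eta>"
    unfolding grid_def \<theta>_def
  proof (rule restrict_PiE_iff[THEN iffD2], intro ballI imageI)
    fix j assume j: "j \<in> {..p}"
    have "\<bar>\<tau> j / \<eta>\<bar> \<le> B / \<eta>" using \<tau>[of j] j \<eta> by (simp add: abs_divide divide_right_mono)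
    then have "- (B / \<eta>) \<le> \<tau> j / \<eta>" "\<tau> j / \<eta> \<le> B / \<eta>" by linarith+
    then have "- \<lceil>B / \<eta>\<rceil> - 1 \<le> \<lfloor>\<tau> j / \<eta>\<rfloor>" "\<lfloor>\<tau> j / \<eta>\<rfloor> \<le> \<lceil>B / \<eta>\<rceil> + 1" by linarith+
    then show "\<lfloor>\<tau> j / \<eta>\<rfloor> \<in> {- \<lceil>B / \<eta>\<rceil> - 1..\<lceil>B / \<eta>\<rceil> + 1}" by simp
  qed
  show "\<bar>\<tau> j - \<theta> j\<bar> \<le> \<eta>" if "j \<le> p" for j
  proof -
    have "\<bar>\<tau> j / \<eta> - real_of_int \<lfloor>\<tau> j / \<eta>\<rfloor>\<bar> \<le> 1" by linarith
    then have "\<eta> * \<bar>\<tau> j / \<eta> - real_of_int \<lfloor>\<tau> j / \<eta>\<rfloor>\<bar> \<le> \<eta> * 1" using \<eta> by (intro mult_left_mono) auto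
    moreover have "\<eta> * \<bar>\<tau> j / \<eta> - real_of_int \<lfloor>\<tau> j / \<eta>\<rfloor>\<bar> = \<bar>\<eta> * (\<tau> j / \<eta> - real_of_int \<lfloor>\<tau> j / \<eta>\<rfloor>)\<bar>"
      using \<eta> by (simp add: abs_mult)
    ultimately show ?thesis using that \<eta> by (simp add: \<theta>_def right_diff_distrib)
  qed
qed

text \<open>A random bound free of \<tau>, taking the place of a supremum over the cube: its
  exceedance probability controls every \<tau> there at once, whatever its dependence on the sample,
  and its mean can be bounded term by term.\<close>

definition envelope :: "real \<Rightarrow> real \<Rightarrow> 'a \<Rightarrow> real" where
  "envelope B \<eta> \<omega> = (\<Sum>\<theta>\<in>grid B \<eta>. \<bar>deviation \<theta> \<eta> \<omega>\<bar> + \<bar>deviation \<theta> (- \<eta>) \<omega>\<bar>)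
    + L * (\<eta> + (B + \<eta>) * (\<Sum>j=1..p. \<bar>(\<Sum>t=1..int n. V (t - int j) \<omega>) / real n\<bar>)
        + \<eta> * ((\<Sum>t=1..int n. N0 t \<omega>) / real n))"

lemma envelope_borel [measurable]: "envelope B \<eta> \<in> borel_measurable M"
  unfolding envelope_def[abs_def] by measurable

text \<open>Pathwise, so \<tau> may depend on the sample point. The increment at \<tau> lies between
  those at the nearest grid point with -\<eta> and +\<eta>, and each of these is a deviation plus a
  drift close to \<open>g * \<tau> 0\<close>.\<close>

lemma increment_le_envelope:
  assumes \<eta>: "\<eta> > 0" and \<tau>: "\<And>j. j \<le> p \<Longrightarrow> \<bar>\<tau> j\<bar> \<le> B"
  shows "\<bar>increment \<tau> 0 \<omega> - g * \<tau> 0 - real n * h * q * (\<Sum>j\<le>p. psi_mean j)\<bar> \<le> envelope B \<eta> \<omega>"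
proof -
  obtain \<theta> where \<theta>: "\<theta> \<in> grid B \<eta>" "\<And>j. j \<le> p \<Longrightarrow> \<bar>\<tau> j - \<theta> j\<bar> \<le> \<eta>"
    using grid_dense[of \<eta> \<tau> B, OF \<eta> \<tau>] by blast
  define mV where "mV j = (\<Sum>t=1..int n. V (t - int j) \<omega>) / real n" for j :: nat
  define mN where "mN = (\<Sum>t=1..int n. N0 t \<omega>) / real n"
  define c0 where "c0 = real n * h * q * (\<Sum>j\<le>p. psi_mean j)"
  define S1 where "S1 = (\<Sum>\<theta>\<in>grid B \<eta>. \<bar>deviation \<theta> \<eta> \<omega>\<bar> + \<bar>deviation \<theta> (- \<eta>) \<omega>\<bar>)"
  define E where "E = \<eta> + (B + \<eta>) * (\<Sum>j=1..p. \<bar>mV j\<bar>) + \<eta> * mN"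
  have mN: "mN \<ge> 0" by (simp add: mN_def sum_nonneg N0_nonneg)
  have dev: "\<bar>deviation \<theta> \<eta> \<omega>\<bar> + \<bar>deviation \<theta> (- \<eta>) \<omega>\<bar> \<le> S1"
    unfolding S1_def by (rule member_le_sum[OF \<theta>(1)]) (auto simp: finite_grid)
  have lo: "increment \<theta> (- \<eta>) \<omega> \<le> increment \<tau> 0 \<omega>" and hi: "increment \<tau> 0 \<omega> \<le> increment \<theta> \<eta> \<omega>"
    using shift_sandwich[of \<tau> \<theta> \<eta>, OF \<theta>(2)] by (auto intro: increment_mono)
  \<comment> \<open>Three errors make up \<open>E\<close>: rounding of the intercept, the other
    coefficients (at most B + \<eta>) times means of \<open>V\<close>, and the inflation by \<eta>
    times the mean of \<open>N0\<close>. The first and third are proportional to \<eta>; the second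
    is small for large n.\<close>
  have drift: "\<bar>g * (\<theta> 0 + (\<Sum>j=1..p. \<theta> j * mV j) + \<eta>' * mN) - g * \<tau> 0\<bar> \<le> L * E" if "\<bar>\<eta>'\<bar> = \<eta>" for \<eta>'
  proof -
    have "\<bar>\<Sum>j=1..p. \<theta> j * mV j\<bar> \<le> (\<Sum>j=1..p. (B + \<eta>) * \<bar>mV j\<bar>)"
    proof (rule order.trans[OF sum_abs sum_mono])
      fix j assume "j \<in> {1..p}"
      then have "\<bar>\<theta> j\<bar> \<le> B + \<eta>" using \<tau>[of j] \<theta>(2)[of j] by auto
      then show "\<bar>\<theta> j * mV j\<bar> \<le> (B + \<eta>) * \<bar>mV j\<bar>" unfolding abs_mult by (rule mult_right_mono) simp
    qed
    moreover have "\<bar>\<eta>' * mN\<bar> = \<eta> * mN" using mN that by (simp add: abs_mult)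
    moreover have "\<bar>\<theta> 0 - \<tau> 0\<bar> \<le> \<eta>" using \<theta>(2)[of 0] by linarith
    ultimately have "\<bar>(\<theta> 0 - \<tau> 0) + (\<Sum>j=1..p. \<theta> j * mV j) + \<eta>' * mN\<bar> \<le> E"
      unfolding E_def sum_distrib_left by linarith
    then have "\<bar>g\<bar> * \<bar>(\<theta> 0 - \<tau> 0) + (\<Sum>j=1..p. \<theta> j * mV j) + \<eta>' * mN\<bar> \<le> L * E"
      using g L_nonneg by (intro mult_mono) auto
    then show ?thesis by (simp add: abs_mult[symmetric] algebra_simps)
  qed
  have inc: "increment \<theta> \<eta>' \<omega> = deviation \<theta> \<eta>' \<omega> + g * (\<theta> 0 + (\<Sum>j=1..p. \<theta> j * mV j) + \<eta>' * mN) + c0" for \<eta>'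
    unfolding deviation_def mean_shift0 mV_def mN_def c0_def by simp
  have "\<bar>increment \<tau> 0 \<omega> - g * \<tau> 0 - c0\<bar> \<le> S1 + L * E"
    using lo hi dev drift[of \<eta>] drift[of "- \<eta>"] \<eta> unfolding inc by linarith
  then show ?thesis by (simp add: envelope_def S1_def E_def mV_def mN_def c0_def)
qed

definition deviation_rate :: "real \<Rightarrow> real" where
  "deviation_rate \<kappa> = sqrt (4 * (real (p + 1) * q + L * h * \<kappa> * K)) + remainder_bound \<kappa> / h + real (p + 1) * sqrt q"

lemma expectation_envelope:
  assumes B: "B \<ge> 0" and \<eta>: "\<eta> > 0"
  shows "expectation (envelope B \<eta>) \<le> (\<Sum>\<theta>\<in>grid B \<eta>. 2 * deviation_rate (kap p \<theta> \<eta>))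
      + L * (\<eta> + (B + \<eta>) * (real p * sqrt (C / real n)) + \<eta> * K)"
    and "integrable M (envelope B \<eta>)"
proof -
  define mV where "mV j \<omega> = \<bar>(\<Sum>t=1..int n. V (t - int j) \<omega>) / real n\<bar>" for j :: nat and \<omega>
  define mN where "mN \<omega> = (\<Sum>t=1..int n. N0 t \<omega>) / real n" for \<omega>
  define S1 where "S1 \<omega> = (\<Sum>\<theta>\<in>grid B \<eta>. \<bar>deviation \<theta> \<eta> \<omega>\<bar> + \<bar>deviation \<theta> (- \<eta>) \<omega>\<bar>)" for \<omega>
  have iV: "integrable M (mV j)" for j
    unfolding mV_def[abs_def] by (intro integrable_abs integrable_divide Bochner_Integration.integrable_sum sq_V(3))
  have iN: "integrable M mN"
    unfolding mN_def[abs_def] by (intro integrable_divide Bochner_Integration.integrable_sum sq_N0(3))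
  have iS: "integrable M S1"
    unfolding S1_def[abs_def]
    by (intro Bochner_Integration.integrable_sum Bochner_Integration.integrable_add integrable_abs integrable_deviation)
  have env: "envelope B \<eta> = (\<lambda>\<omega>. S1 \<omega> + L * (\<eta> + (B + \<eta>) * (\<Sum>j=1..p. mV j \<omega>) + \<eta> * mN \<omega>))"
    by (simp add: envelope_def fun_eq_iff S1_def mV_def mN_def)
  show "integrable M (envelope B \<eta>)"
    unfolding env
    by (intro Bochner_Integration.integrable_add integrable_mult_right Bochner_Integration.integrable_sum iS iV iN) auto
  have "expectation (envelope B \<eta>)
    = expectation S1 + L * (\<eta> + (B + \<eta>) * (\<Sum>j=1..p. expectation (mV j)) + \<eta> * expectation mN)"
    unfolding env by (simp add: iS iV iN prob_space Bochner_Integration.integral_sum)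
  also have "\<dots> \<le> (\<Sum>\<theta>\<in>grid B \<eta>. 2 * deviation_rate (kap p \<theta> \<eta>))
      + L * (\<eta> + (B + \<eta>) * (\<Sum>j=1..p. sqrt (C / real n)) + \<eta> * K)"
  proof (intro add_mono mult_left_mono order.refl sum_mono L_nonneg)
    show "expectation (mV j) \<le> sqrt (C / real n)" for j
      unfolding mV_def by (rule mean_V_bound)
    have "expectation mN = (\<Sum>t=1..int n. expectation (N0 t)) / real n"
      unfolding mN_def by (simp add: sq_N0(3) Bochner_Integration.integral_sum)
    also have "\<dots> \<le> (\<Sum>t=1..int n. K) / real n"
      by (intro divide_right_mono sum_mono sq_N0) auto
    also have "\<dots> = K" using n by simp
    finally show "expectation mN \<le> K" .
    have "expectation S1 = (\<Sum>\<theta>\<in>grid B \<eta>. expectation (\<lambda>\<omega>. \<bar>deviation \<theta> \<eta> \<omega>\<bar>) + expectation (\<lambda>\<omega>. \<bar>deviation \<theta> (- \<eta>) \<omega>\<bar>))"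
      unfolding S1_def by (simp add: integrable_deviation Bochner_Integration.integral_sum)
    also have "\<dots> \<le> (\<Sum>\<theta>\<in>grid B \<eta>. deviation_rate (kap p \<theta> \<eta>) + deviation_rate (kap p \<theta> (- \<eta>)))"
      unfolding deviation_rate_def by (intro sum_mono add_mono deviation_bound)
    finally show "expectation S1 \<le> (\<Sum>\<theta>\<in>grid B \<eta>. 2 * deviation_rate (kap p \<theta> \<eta>))"
      by (simp add: kap_def)
  qed (use B \<eta> in auto)
  finally show "expectation (envelope B \<eta>) \<le> (\<Sum>\<theta>\<in>grid B \<eta>. 2 * deviation_rate (kap p \<theta> \<eta>))
      + L * (\<eta> + (B + \<eta>) * (real p * sqrt (C / real n)) + \<eta> * K)" by simp
qed

lemma prob_envelope:
  assumes B: "B \<ge> 0" and \<eta>: "\<eta> > 0" and \<delta>: "\<delta> > 0"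
  shows "prob {\<omega> \<in> space M. envelope B \<eta> \<omega> > \<delta>}
    \<le> ((\<Sum>\<theta>\<in>grid B \<eta>. 2 * deviation_rate (kap p \<theta> \<eta>))
      + L * (\<eta> + (B + \<eta>) * (real p * sqrt (C / real n)) + \<eta> * K)) / \<delta>"
proof -
  have nn: "envelope B \<eta> \<omega> \<ge> 0" for \<omega>
    using B \<eta> L_nonneg by (auto simp: envelope_def intro!: add_nonneg_nonneg mult_nonneg_nonneg sum_nonneg divide_nonneg_nonneg N0_nonneg)
  have "prob {\<omega> \<in> space M. envelope B \<eta> \<omega> > \<delta>} \<le> prob {\<omega> \<in> space M. envelope B \<eta> \<omega> \<ge> \<delta>}"
    by (intro finite_measure_mono) auto
  also have "\<dots> \<le> expectation (envelope B \<eta>) / \<delta>"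
    using integral_Markov_inequality_measure[OF expectation_envelope(2)[OF B \<eta>], of "{}" \<delta>] nn \<delta> by simp
  also have "\<dots> \<le> ((\<Sum>\<theta>\<in>grid B \<eta>. 2 * deviation_rate (kap p \<theta> \<eta>))
      + L * (\<eta> + (B + \<eta>) * (real p * sqrt (C / real n)) + \<eta> * K)) / \<delta>"
    using \<delta> by (intro divide_right_mono expectation_envelope B \<eta>) auto
  finally show ?thesis .
qed

end

section \<open>Uniform rates and the model\<close>

text \<open>\<open>deviation_rate\<close> after q and r are replaced by \<Gamma> * h and R * h and
  the division by h is carried out: a bound common to all parameters in the range.\<close>

definition asymptotic_rate :: "nat \<Rightarrow> real \<Rightarrow> real \<Rightarrow> real \<Rightarrow> real \<Rightarrow> real measure \<Rightarrow> real \<Rightarrow> real \<Rightarrow> real" where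
  "asymptotic_rate p L K \<Gamma> R Q \<kappa> h =
     sqrt (4 * (real (p + 1) * (\<Gamma> * h) + L * h * \<kappa> * K))
     + (L * h * \<kappa>\<^sup>2 * K + L * (R * h) * \<kappa> * K
       + real (p + 1) * (\<Gamma> * (\<integral>u. min 1 (L * h * \<kappa> * \<bar>u\<bar>) \<partial>Q) + 2 * (R * h) * \<Gamma> + 2 * L * \<kappa> * (\<Gamma> * h) * K)
       + 2 * (real (p + 1) * real p * (\<Gamma>\<^sup>2 * h)))
     + real (p + 1) * sqrt (\<Gamma> * h)"

text \<open>Apart from the integral, every term is continuous in h and vanishes at 0. The integrand
  is at most 1 and vanishes pointwise, so dominated convergence covers any law of outlier
  sizes.\<close>

lemma asymptotic_rate_tendsto_0:
  assumes Q: "real_distribution Q" and \<kappa>: "\<kappa> \<ge> 0" and L: "L \<ge> 0"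
  shows "(\<lambda>n. asymptotic_rate p L K \<Gamma> R Q \<kappa> (1 / sqrt (real n))) \<longlonglongrightarrow> 0"
proof -
  interpret Q: real_distribution Q by fact
  have h: "(\<lambda>n. 1 / sqrt (real n)) \<longlonglongrightarrow> 0"
    by (intro tendsto_divide_0[OF tendsto_const] filterlim_at_top_imp_at_infinity
        filterlim_compose[OF sqrt_at_top filterlim_real_sequentially])
  have "(\<lambda>n. \<integral>u. min 1 (L * (1 / sqrt (real n)) * \<kappa> * \<bar>u\<bar>) \<partial>Q) \<longlonglongrightarrow> (\<integral>u. 0 \<partial>Q)"
  proof (rule integral_dominated_convergence[where w="\<lambda>_. 1"])
    show "AE u in Q. (\<lambda>n. min 1 (L * (1 / sqrt (real n)) * \<kappa> * \<bar>u\<bar>)) \<longlonglongrightarrow> 0"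
    proof (rule AE_I2)
      fix u :: real
      have "(\<lambda>n. min 1 (L * (1 / sqrt (real n)) * \<kappa> * \<bar>u\<bar>)) \<longlonglongrightarrow> min 1 (L * 0 * \<kappa> * \<bar>u\<bar>)"
        by (intro tendsto_intros h)
      then show "(\<lambda>n. min 1 (L * (1 / sqrt (real n)) * \<kappa> * \<bar>u\<bar>)) \<longlonglongrightarrow> 0" by simp
    qed
    show "AE u in Q. norm (min 1 (L * (1 / sqrt (real n)) * \<kappa> * \<bar>u\<bar>)) \<le> 1" for n
      using L \<kappa> by (intro AE_I2) (simp add: abs_le_iff)
  qed auto
  then have phi: "(\<lambda>n. \<integral>u. min 1 (L * (1 / sqrt (real n)) * \<kappa> * \<bar>u\<bar>) \<partial>Q) \<longlonglongrightarrow> 0" by simp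
  have "(\<lambda>n. asymptotic_rate p L K \<Gamma> R Q \<kappa> (1 / sqrt (real n))) \<longlonglongrightarrow>
     sqrt (4 * (real (p + 1) * (\<Gamma> * 0) + L * 0 * \<kappa> * K))
     + (L * 0 * \<kappa>\<^sup>2 * K + L * (R * 0) * \<kappa> * K
       + real (p + 1) * (\<Gamma> * 0 + 2 * (R * 0) * \<Gamma> + 2 * L * \<kappa> * (\<Gamma> * 0) * K)
       + 2 * (real (p + 1) * real p * (\<Gamma>\<^sup>2 * 0)))
     + real (p + 1) * sqrt (\<Gamma> * 0)"
    unfolding asymptotic_rate_def by (intro tendsto_intros h phi)
  then show ?thesis by simp
qed

lemma (in outlier_ar) deviation_rate_le:
  assumes q: "q \<le> \<Gamma> * h" and rh: "r = R * h" and \<kappa>: "\<kappa> \<ge> 0"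
  shows "deviation_rate \<kappa> \<le> asymptotic_rate p L K \<Gamma> R Q \<kappa> h"
proof -
  have K: "K \<ge> 0" using K_ge_1 by simp
  \<comment> \<open>The signs of \<Gamma> and R follow from 0 \<le> q \<le> \<Gamma> * h and 0 \<le>
    r = R * h.\<close>
  have \<Gamma>: "\<Gamma> \<ge> 0"
    using order.trans[OF q01(1) q] h_pos by (simp add: zero_le_mult_iff)
  have R: "R \<ge> 0" using r h_pos unfolding rh by (simp add: zero_le_mult_iff)
  have phi: "phi a \<ge> 0" if "a \<ge> 0" for a
    unfolding phi_def using that by (intro Bochner_Integration.integral_nonneg) auto
  define a where "a = phi (L * h * \<kappa>)"
  have a: "a \<ge> 0" unfolding a_def using L_nonneg h_pos \<kappa> by (intro phi) auto
  have "remainder_bound \<kappa> / h = L * h * \<kappa>\<^sup>2 * K + L * (R * h) * \<kappa> * K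
     + real (p + 1) * (q / h * a + 2 * (R * h) * (q / h) + 2 * L * \<kappa> * q * K)
     + 2 * (real (p + 1) * real p * (q * (q / h)))"
    using h_pos unfolding remainder_bound_def a_def[symmetric] unfolding rh
    by (simp add: field_simps power2_eq_square)
  also have "\<dots> \<le> L * h * \<kappa>\<^sup>2 * K + L * (R * h) * \<kappa> * K
     + real (p + 1) * (\<Gamma> * a + 2 * (R * h) * \<Gamma> + 2 * L * \<kappa> * (\<Gamma> * h) * K)
     + 2 * (real (p + 1) * real p * (\<Gamma> * h * \<Gamma>))"
  proof -
    have qh: "q / h \<le> \<Gamma>" using q h_pos by (simp add: pos_divide_le_eq)
    have "q * (q / h) \<le> \<Gamma> * h * \<Gamma>"
      using q qh q01 h_pos \<Gamma> by (intro mult_mono) auto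
    then show ?thesis
      using qh q a R h_pos L_nonneg \<kappa> K by (intro add_mono mult_left_mono mult_right_mono order.refl) auto
  qed
  finally have "remainder_bound \<kappa> / h \<le> L * h * \<kappa>\<^sup>2 * K + L * (R * h) * \<kappa> * K
     + real (p + 1) * (\<Gamma> * a + 2 * (R * h) * \<Gamma> + 2 * L * \<kappa> * (\<Gamma> * h) * K)
     + 2 * (real (p + 1) * real p * (\<Gamma>\<^sup>2 * h))"
    by (simp add: power2_eq_square mult_ac)
  moreover have "sqrt (4 * (real (p + 1) * q + L * h * \<kappa> * K)) \<le> sqrt (4 * (real (p + 1) * (\<Gamma> * h) + L * h * \<kappa> * K))"
    by (intro real_sqrt_le_mono mult_left_mono add_right_mono q) auto
  moreover have "real (p + 1) * sqrt q \<le> real (p + 1) * sqrt (\<Gamma> * h)"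
    by (intro mult_left_mono real_sqrt_le_mono q) auto
  ultimately show ?thesis
    unfolding deviation_rate_def asymptotic_rate_def a_def phi_def by linarith
qed

section \<open>From the stated model to the setting of one fixed sample size\<close>

lemma mixture_cdf_bounds:
  assumes G: "\<And>u. 0 \<le> G u" "\<And>u. G u \<le> 1" "\<And>u v. \<bar>G u - G v\<bar> \<le> L1 * \<bar>u - v\<bar>" "\<bar>g\<bar> \<le> L1"
      "\<And>d. \<bar>G (x + d) - G x - g * d\<bar> \<le> L1 * d\<^sup>2"
    and H: "\<And>u. 0 \<le> H u" "\<And>u. H u \<le> 1" "\<And>u v. \<bar>H u - H v\<bar> \<le> L2 * \<bar>u - v\<bar>" "\<bar>g'\<bar> \<le> L2"
      "\<And>d. \<bar>H (x + d) - H x - g' * d\<bar> \<le> L2 * d\<^sup>2"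
    and s: "0 \<le> s" "s \<le> 1" "s \<le> r"
  shows "\<bar>mixture_cdf G H s u - mixture_cdf G H s w\<bar> \<le> (L1 + L2) * \<bar>u - w\<bar>" (is ?lip)
    and "\<bar>mixture_cdf G H s (x + d) - mixture_cdf G H s x - g * d\<bar> \<le> (L1 + L2) * d\<^sup>2 + (L1 + L2) * r * \<bar>d\<bar>" (is ?quad)
    and "\<bar>mixture_cdf G H s u - G u\<bar> \<le> r" (is ?close)
proof -
  have L: "L1 \<ge> 0" "L2 \<ge> 0" using G(4) H(4) by linarith+
  \<comment> \<open>Both weights are at most 1, so bounds for G and H add up; this is the origin of
    the constant L1 + L2.\<close>
  have conv: "\<bar>(1 - s) * a + s * b\<bar> \<le> A + B" if "\<bar>a\<bar> \<le> A" "\<bar>b\<bar> \<le> B" for a b A B :: real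
  proof -
    have "\<bar>(1 - s) * a\<bar> \<le> 1 * A" "\<bar>s * b\<bar> \<le> 1 * B"
      unfolding abs_mult using that s by (intro mult_mono; simp)+
    then show ?thesis by linarith
  qed
  have "mixture_cdf G H s u - mixture_cdf G H s w = (1 - s) * (G u - G w) + s * (H u - H w)"
    by (simp add: mixture_cdf_def algebra_simps)
  then show ?lip using conv[OF G(3) H(3), of u w u w] by (simp add: distrib_right)
  have "mixture_cdf G H s (x + d) - mixture_cdf G H s x - g * d
     = ((1 - s) * (G (x + d) - G x - g * d) + s * (H (x + d) - H x - g' * d)) + s * (g' - g) * d"
    by (simp add: mixture_cdf_def algebra_simps)
  \<comment> \<open>The mixture has slope (1 - s) g + s g' at x, whereas the linear term uses g. The
    discrepancy has factor s and produces the term with r in the expansion.\<close>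
  moreover have "\<bar>s * (g' - g) * d\<bar> \<le> (L1 + L2) * r * \<bar>d\<bar>"
  proof -
    have "\<bar>s\<bar> * \<bar>g' - g\<bar> \<le> r * (L1 + L2)" using s G(4) H(4) L by (intro mult_mono) auto
    then show ?thesis unfolding abs_mult by (intro mult_right_mono) (auto simp: mult.commute)
  qed
  ultimately show ?quad using conv[OF G(5) H(5), of d d] by (simp add: distrib_right)
  have "mixture_cdf G H s u - G u = s * (H u - G u)" by (simp add: mixture_cdf_def algebra_simps)
  moreover have "\<bar>H u - G u\<bar> \<le> 1" using G(1,2)[of u] H(1,2)[of u] by linarith
  ultimately show ?close using s mult_mono[of s r "\<bar>H u - G u\<bar>" 1] by (simp add: abs_mult)
qed

text \<open>The model states independence between whole paths and within each process, while all
  coordinates together are needed. The map f replaces z by a genuinely two-valued version.\<close>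

lemma indep_vars_combined:
  assumes "prob_space M" and e: "iid M \<epsilon>" and z: "iid M z" and xi: "iid M \<xi>"
    and indep: "prob_space.indep_vars M (\<lambda>_. \<Pi>\<^sub>M t\<in>UNIV. borel) (\<lambda>k. [path \<epsilon>, path z, path \<xi>] ! k) {..<3}"
    and f: "f \<in> borel_measurable borel"
  shows "prob_space.indep_vars M (\<lambda>_. borel)
    (\<lambda>(k :: nat, t :: int). ([\<epsilon>, \<lambda>t \<omega>. f (z t \<omega>), \<xi>] ! k) t) ({..<3} \<times> UNIV)"
proof -
  interpret prob_space M by fact
  have k3: "k = 0 \<or> k = Suc 0 \<or> k = Suc (Suc 0)" if "k < 3" for k :: nat using that by linarith
  have "indep_vars (\<lambda>_. \<Pi>\<^sub>M t\<in>UNIV. borel) (\<lambda>k \<omega> t. ([\<epsilon>, z, \<xi>] ! k) t \<omega>) {..<3}"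
    using indep by (rule indep_vars_cong[THEN iffD1, rotated -1]) (auto dest!: k3 simp: path_def fun_eq_iff)
  then have "indep_vars (\<lambda>_. borel) (\<lambda>(k, t). ([\<epsilon>, z, \<xi>] ! k) t) ({..<3} \<times> UNIV)"
    by (rule indep_vars_blocks) (use e z xi in \<open>auto dest!: k3 simp: iid_def\<close>)
  then have "indep_vars (\<lambda>_. borel)
      (\<lambda>i \<omega>. (if fst i = Suc 0 then f else (\<lambda>u. u)) ((case i of (k, t) \<Rightarrow> ([\<epsilon>, z, \<xi>] ! k) t) \<omega>)) ({..<3} \<times> UNIV)"
    by (rule indep_vars_compose2) (use f in auto)
  then show ?thesis
    by (rule indep_vars_cong[THEN iffD1, rotated -1]) (auto dest!: k3)
qed

text \<open>The second moment is a convex combination of those of P0 and PH; the sum of the two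
  bounds it without reference to the mixing weight.\<close>

lemma contaminated_ar_second_moment:
  assumes model: "contaminated_ar p \<beta> \<nu> (mixture_cdf (cdf P0) (cdf PH) s) q Q M \<epsilon> z \<xi> v"
    and P0: "real_distribution P0" "zero_mean_finite_variance P0"
    and PH: "real_distribution PH" "zero_mean_finite_variance PH"
    and s: "0 \<le> s" "s \<le> 1"
  shows "(\<integral>\<omega>. (\<epsilon> t \<omega>)\<^sup>2 \<partial>M) \<le> (\<integral>u. u\<^sup>2 \<partial>P0) + (\<integral>u. u\<^sup>2 \<partial>PH)"
proof -
  interpret prob_space M using model by (simp add: contaminated_ar_def)
  have ind: "indep_vars (\<lambda>_. borel) \<epsilon> UNIV" and int: "integrable M (\<lambda>\<omega>. (\<epsilon> t \<omega>)\<^sup>2)"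
    and cdf: "\<And>x. cdf (distr M borel (\<epsilon> t)) x = mixture_cdf (cdf P0) (cdf PH) s x"
    using model by (auto simp: contaminated_ar_def iid_def)
  have \<epsilon>: "\<epsilon> t \<in> borel_measurable M" using ind by (auto simp: indep_vars_def2)
  have sq: "(\<integral>\<^sup>+u. ennreal (u\<^sup>2) \<partial>P) = ennreal (\<integral>u. u\<^sup>2 \<partial>P)" if "zero_mean_finite_variance P" for P
    using that by (intro nn_integral_eq_integral) (auto simp: zero_mean_finite_variance_def)
  have n0: "0 \<le> (\<integral>u. u\<^sup>2 \<partial>P0)" and nH: "0 \<le> (\<integral>u. u\<^sup>2 \<partial>PH)"
    by (intro Bochner_Integration.integral_nonneg; simp)+
  have "ennreal (\<integral>\<omega>. (\<epsilon> t \<omega>)\<^sup>2 \<partial>M) = (\<integral>\<^sup>+\<omega>. ennreal ((\<epsilon> t \<omega>)\<^sup>2) \<partial>M)"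
    by (rule nn_integral_eq_integral[symmetric, OF int]) simp
  also have "\<dots> = (\<integral>\<^sup>+u. ennreal (u\<^sup>2) \<partial>distr M borel (\<epsilon> t))"
    by (rule nn_integral_distr[symmetric, OF \<epsilon>]) simp
  also have "\<dots> = ennreal (1 - s) * (\<integral>\<^sup>+u. ennreal (u\<^sup>2) \<partial>P0) + ennreal s * (\<integral>\<^sup>+u. ennreal (u\<^sup>2) \<partial>PH)"
    by (rule nn_integral_mixture_cdf[OF P0(1) PH(1) real_distribution_distr[OF \<epsilon>] cdf s]) simp
  also have "\<dots> = ennreal ((1 - s) * (\<integral>u. u\<^sup>2 \<partial>P0) + s * (\<integral>u. u\<^sup>2 \<partial>PH))"
    using s n0 nH by (simp add: sq P0(2) PH(2) ennreal_mult ennreal_plus)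
  finally have "(\<integral>\<omega>. (\<epsilon> t \<omega>)\<^sup>2 \<partial>M) = (1 - s) * (\<integral>u. u\<^sup>2 \<partial>P0) + s * (\<integral>u. u\<^sup>2 \<partial>PH)"
    using s n0 nH by (subst (asm) ennreal_inj) (auto intro!: Bochner_Integration.integral_nonneg add_nonneg_nonneg)
  also have "\<dots> \<le> 1 * (\<integral>u. u\<^sup>2 \<partial>P0) + 1 * (\<integral>u. u\<^sup>2 \<partial>PH)"
    using s n0 nH by (intro add_mono mult_right_mono) auto
  finally show ?thesis by simp
qed

text \<open>The model makes z equal to 0 or 1 only almost surely, whereas counting contaminated
  positions is pathwise. The indicator of z = 1 differs from z on a null set and keeps the
  independence.\<close>

lemma contaminated_ar_outlier_ar:
  assumes model: "contaminated_ar p \<beta> \<nu> A q Q M \<epsilon> z \<xi> v" and n: "n \<ge> 1"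
    and c: "summable (\<lambda>k. \<bar>c k\<bar>)"
    and S: "\<And>t. (\<integral>\<omega>. (\<epsilon> t \<omega>)\<^sup>2 \<partial>M) \<le> S"
    and G: "G \<in> borel_measurable borel" "\<And>u. 0 \<le> G u" "\<And>u. G u \<le> 1"
    and lip: "\<And>u w. \<bar>A u - A w\<bar> \<le> L * \<bar>u - w\<bar>"
    and quad: "\<And>d. \<bar>A (x + d) - A x - g * d\<bar> \<le> L * d\<^sup>2 + L * r * \<bar>d\<bar>"
    and g: "\<bar>g\<bar> \<le> L" and AG: "\<And>u. \<bar>A u - G u\<bar> \<le> r" and r: "r \<ge> 0"
  shows "outlier_ar M \<epsilon> (\<lambda>t \<omega>. of_bool (z t \<omega> = 1)) \<xi> n c A G Q x g L r q S"
    and "AE \<omega> in M. \<forall>t. z t \<omega> = of_bool (z t \<omega> = 1)"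
proof -
  interpret prob_space M using model by (simp add: contaminated_ar_def)
  have iid: "iid M \<epsilon>" "iid M z" "iid M \<xi>"
    and zq: "\<And>t. prob {\<omega> \<in> space M. z t \<omega> = 1} = q" "\<And>t. prob {\<omega> \<in> space M. z t \<omega> = 0} = 1 - q"
    and ind: "indep_vars (\<lambda>_. \<Pi>\<^sub>M t\<in>UNIV. borel) (\<lambda>k. [path \<epsilon>, path z, path \<xi>] ! k) {..<3}"
    using model by (auto simp: contaminated_ar_def)
  have z[measurable]: "z t \<in> borel_measurable M" for t
    using iid(2) by (auto simp: iid_def indep_vars_def2)
  have f: "(\<lambda>u :: real. of_bool (u = 1) :: real) \<in> borel_measurable borel"
  proof -
    have "(\<lambda>u :: real. of_bool (u = 1) :: real) = indicator {1}" by (auto simp: indicator_def)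
    then show ?thesis by simp
  qed
  show "outlier_ar M \<epsilon> (\<lambda>t \<omega>. of_bool (z t \<omega> = 1)) \<xi> n c A G Q x g L r q S"
  proof unfold_locales
    show "indep_vars (\<lambda>_. borel) (\<lambda>(k :: nat, t :: int). ([\<epsilon>, \<lambda>t \<omega>. of_bool (z t \<omega> = 1), \<xi>] ! k) t) ({..<3} \<times> UNIV)"
      by (rule indep_vars_combined[OF prob_space_axioms iid ind f])
    show "expectation (\<lambda>\<omega>. of_bool (z t \<omega> = 1)) = q" for t
    proof -
      have "expectation (\<lambda>\<omega>. of_bool (z t \<omega> = 1)) = expectation (indicator {\<omega> \<in> space M. z t \<omega> = 1})"
        by (intro Bochner_Integration.integral_cong) (auto simp: indicator_def)
      also have "\<dots> = prob ({\<omega> \<in> space M. z t \<omega> = 1} \<inter> space M)"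
        by (rule Bochner_Integration.integral_indicator)
      also have "{\<omega> \<in> space M. z t \<omega> = 1} \<inter> space M = {\<omega> \<in> space M. z t \<omega> = 1}" by auto
      finally show ?thesis by (simp only: zq(1))
    qed
    show "cdf (distr M borel (\<epsilon> t)) = A" for t
      using model by (auto simp: contaminated_ar_def fun_eq_iff)
  qed (use model assms in \<open>auto simp: contaminated_ar_def of_bool_def\<close>)
  have "AE \<omega> in M. z t \<omega> = of_bool (z t \<omega> = 1)" for t
  proof -
    have "prob ({\<omega> \<in> space M. z t \<omega> = 1} \<union> {\<omega> \<in> space M. z t \<omega> = 0}) = q + (1 - q)"
      by (subst finite_measure_Union) (auto simp: zq)
    then have "AE \<omega> in M. \<omega> \<in> {\<omega> \<in> space M. z t \<omega> = 1} \<union> {\<omega> \<in> space M. z t \<omega> = 0}"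
      by (intro AE_prob_1) simp
    then show ?thesis by eventually_elim auto
  qed
  then show "AE \<omega> in M. \<forall>t. z t \<omega> = of_bool (z t \<omega> = 1)"
    by (simp add: AE_all_countable)
qed

text \<open>The residual equals the innovation minus (threshold - x). An outlier at time t raises
  the residual and so lowers the threshold, hence the coefficient -1. A lagged outlier enters with
  the true coefficient through \<open>b\<close> and with the estimation error through \<tau>;
  together they give the estimated coefficient.\<close>

lemma (in outlier_ar) residual_le_iff:
  assumes V: "V t \<omega> = (\<Sum>j=1..p. \<beta> j * V (t - int j) \<omega>) + e t \<omega>"
    and y: "\<And>s. y s = V s \<omega> + \<mu> + zi s \<omega> * xi s \<omega>"
    and b: "b = (\<lambda>j. if j = 0 then - 1 else \<beta> j)"
    and \<tau>: "h * \<tau> 0 = (m - \<mu>) * (1 - (\<Sum>j=1..p. \<beta>' j))" "\<And>j. j \<in> {1..p} \<Longrightarrow> h * \<tau> j = \<beta>' j - \<beta> j"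
  shows "residual p m \<beta>' y t \<le> x \<longleftrightarrow> e t \<omega> \<le> thr \<tau> 0 t \<omega>"
proof -
  define Z where "Z s = zi s \<omega> * xi s \<omega>" for s
  define F where "F j = V (t - int j) \<omega> + Z (t - int j)" for j
  define s where "s = (\<Sum>j=1..p. \<beta>' j)"
  have split: "{..p} = insert 0 {1..p}" by auto
  have "thr \<tau> 0 t \<omega> - x = h * \<tau> 0 + (\<Sum>j=1..p. h * \<tau> j * F j) - Z t + (\<Sum>j=1..p. \<beta> j * Z (t - int j))"
    unfolding thr_def shift_def split unfolding b
    by (simp add: U0_def Oz_def F_def Z_def sum_distrib_left distrib_left mult.assoc)
  also have "(\<Sum>j=1..p. h * \<tau> j * F j) = (\<Sum>j=1..p. \<beta>' j * F j) - (\<Sum>j=1..p. \<beta> j * F j)"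
    using \<tau>(2) by (simp add: left_diff_distrib sum_subtractf)
  also have "(\<Sum>j=1..p. \<beta> j * F j) = (\<Sum>j=1..p. \<beta> j * V (t - int j) \<omega>) + (\<Sum>j=1..p. \<beta> j * Z (t - int j))"
    by (simp add: F_def distrib_left sum.distrib)
  also have "h * \<tau> 0 = (m - \<mu>) * (1 - s)" by (simp add: \<tau>(1) s_def)
  finally have 1: "thr \<tau> 0 t \<omega> - x = (m - \<mu>) - (m - \<mu>) * s + (\<Sum>j=1..p. \<beta>' j * F j)
      - (\<Sum>j=1..p. \<beta> j * V (t - int j) \<omega>) - Z t"
    by (simp add: right_diff_distrib)
  have "(\<Sum>j=1..p. \<beta>' j * (y (t - int j) - m)) = (\<Sum>j=1..p. \<beta>' j * F j - (m - \<mu>) * \<beta>' j)"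
    by (intro sum.cong refl) (simp add: y F_def Z_def algebra_simps)
  also have "\<dots> = (\<Sum>j=1..p. \<beta>' j * F j) - (m - \<mu>) * s"
    by (simp add: sum_subtractf sum_distrib_left s_def)
  finally have "residual p m \<beta>' y t = V t \<omega> + \<mu> + Z t - m - ((\<Sum>j=1..p. \<beta>' j * F j) - (m - \<mu>) * s)"
    by (simp add: residual_def y Z_def)
  then have "residual p m \<beta>' y t = e t \<omega> - (thr \<tau> 0 t \<omega> - x)"
    using V 1 by linarith
  then show ?thesis by linarith
qed

text \<open>Outside the two bad events of the estimators, \<tau> lies in the cube of half-width B,
  so up to a null set the statistic is at most the envelope. The last term on the right depends on q
  and A only through \<Gamma>, R, L and S, so it survives a supremum over the parameters.\<close>

lemma prob_statistic_le:
  fixes mh :: "'w \<Rightarrow> real" and bh :: "'w \<Rightarrow> nat \<Rightarrow> real" and c :: "int \<Rightarrow> real"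
  assumes model: "contaminated_ar p \<beta> \<nu> A q Q M \<epsilon> z \<xi> v" and n: "n \<ge> 1"
    and \<nu>: "\<nu> = (1 - (\<Sum>j=1..p. \<beta> j)) * \<mu>"
    and c: "\<And>k. k < 0 \<Longrightarrow> c k = 0" "c 0 = 1"
      "\<And>k. k > 0 \<Longrightarrow> c k = (\<Sum>j=1..p. \<beta> j * c (k - int j))"
      "summable (\<lambda>k. \<bar>c (int k)\<bar>)"
    and Q: "real_distribution Q"
    and S: "\<And>t. (\<integral>\<omega>. (\<epsilon> t \<omega>)\<^sup>2 \<partial>M) \<le> S"
    and G: "G \<in> borel_measurable borel" "\<And>u. 0 \<le> G u" "\<And>u. G u \<le> 1"
    and lip: "\<And>u w. \<bar>A u - A w\<bar> \<le> L * \<bar>u - w\<bar>"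
    and quad: "\<And>d. \<bar>A (x + d) - A x - g * d\<bar> \<le> L * d\<^sup>2 + L * (R * (1 / sqrt (real n))) * \<bar>d\<bar>"
    and g: "\<bar>g\<bar> \<le> L" and AG: "\<And>u. \<bar>A u - G u\<bar> \<le> R * (1 / sqrt (real n))" and R: "R \<ge> 0"
    and q: "q \<le> \<Gamma> * (1 / sqrt (real n))"
    and mh [measurable]: "mh \<in> borel_measurable M"
    and bh [measurable]: "\<And>j. j \<in> {1..p} \<Longrightarrow> (\<lambda>\<omega>. bh \<omega> j) \<in> borel_measurable M"
    and B: "B \<ge> 0" "C0 \<ge> 0" "C0 \<le> B" "C0 * (1 + (\<Sum>j=1..p. \<bar>\<beta> j\<bar>) + real p * C0) \<le> B"
    and \<eta>: "\<eta> > 0" and \<delta>: "\<delta> > 0"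
  defines "Kc \<equiv> outlier_ar.K p (\<lambda>k. c (int k)) S"
  shows "measure M {\<omega> \<in> space M. \<bar>sqrt (real n) *
           (edf n (residual p (mh \<omega>) (bh \<omega>) (\<lambda>t. v t \<omega> + z t \<omega> * \<xi> t \<omega>)) x - edf n (\<lambda>t. \<epsilon> t \<omega>) x)
         - g * (1 - (\<Sum>j=1..p. bh \<omega> j)) * (sqrt (real n) * (mh \<omega> - \<mu>))
         - sqrt (real n) * q * Delta p \<beta> G x Q\<bar> > \<delta>}
    \<le> measure M {\<omega> \<in> space M. \<bar>sqrt (real n) * (mh \<omega> - \<mu>)\<bar> > C0}
      + measure M {\<omega> \<in> space M. \<bar>L2_set (\<lambda>j. sqrt (real n) * (bh \<omega> j - \<beta> j)) {1..p}\<bar> > C0}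
      + ((\<Sum>\<theta>\<in>outlier_ar.grid p B \<eta>. 2 * asymptotic_rate p L Kc \<Gamma> R Q (kap p \<theta> \<eta>) (1 / sqrt (real n)))
        + L * (\<eta> + (B + \<eta>) * (real p * sqrt (outlier_ar.C (\<lambda>k. c (int k)) S / real n)) + \<eta> * Kc)) / \<delta>"
    (is "measure M {\<omega> \<in> space M. \<bar>?stat \<omega>\<bar> > \<delta>} \<le> measure M ?bad1 + measure M ?bad2 + ?bound")
proof -
  define b where "b = (\<lambda>j :: nat. if j = 0 then - 1 else \<beta> j)"
  define zi where "zi t \<omega> = (of_bool (z t \<omega> = 1) :: real)" for t \<omega>
  note c_rec = c
  note inst = contaminated_ar_outlier_ar[OF model n c(4) S G lip quad g AG, simplified R, folded zi_def[abs_def]]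
  interpret outlier_ar M \<epsilon> zi \<xi> p n "\<lambda>k. c (int k)" b A G Q x g L "R * (1 / sqrt (real n))" q S
    using inst(1) R by (simp add: zi_def[abs_def])
  interpret Q: real_distribution Q by fact
  have K: "Kc = K" by (simp only: Kc_def)
  have AEz: "AE \<omega> in M. \<forall>t. z t \<omega> = zi t \<omega>" using inst(2) R by (simp add: zi_def)
  have sol: "strictly_stationary M v"
    "\<And>t. AE \<omega> in M. v t \<omega> = (\<Sum>j=1..p. \<beta> j * v (t - int j) \<omega>) + \<nu> + \<epsilon> t \<omega>"
    using model by (auto simp: contaminated_ar_def stationary_ar_solution_def)
  have v[measurable]: "v t \<in> borel_measurable M" for t
    using sol(1) by (simp add: strictly_stationary_def)
  \<comment> \<open>Since \<nu> equals \<mu> times 1 minus the sum of the coefficients, centring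
    removes the intercept from the recursion.\<close>
  define X where "X t \<omega> = v t \<omega> - \<mu>" for t \<omega>
  have X[measurable]: "X t \<in> borel_measurable M" for t unfolding X_def[abs_def] by measurable
  have AErec: "AE \<omega> in M. \<forall>t. X t \<omega> = (\<Sum>j=1..p. \<beta> j * X (t - int j) \<omega>) + \<epsilon> t \<omega>"
    unfolding AE_all_countable
  proof
    fix t
    show "AE \<omega> in M. X t \<omega> = (\<Sum>j=1..p. \<beta> j * X (t - int j) \<omega>) + \<epsilon> t \<omega>"
      using sol(2)[of t]
    proof eventually_elim
      case (elim \<omega>)
      have "(\<Sum>j=1..p. \<beta> j * X (t - int j) \<omega>) = (\<Sum>j=1..p. \<beta> j * v (t - int j) \<omega>) - (\<Sum>j=1..p. \<beta> j) * \<mu>"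
        by (simp add: X_def right_diff_distrib sum_subtractf sum_distrib_right)
      then show ?case using elim by (simp add: X_def \<nu> left_diff_distrib)
    qed
  qed
  have distrX: "distr M borel (X t) = distr M borel (X 0)" for t
  proof -
    have "distr (distr M borel (v t)) borel (\<lambda>u. u - \<mu>) = distr M borel (X t)" for t
      by (subst distr_distr) (auto simp: comp_def X_def[abs_def])
    from this[of t] this[of 0] show ?thesis
      using strictly_stationary_distr_eq[OF sol(1), of t] by simp
  qed
  have "AE \<omega> in M. \<forall>t. X t \<omega> = V t \<omega>"
    unfolding AE_all_countable V_def
    by (intro allI ar_solution_eq_moving_average[OF c_rec X rv(1) distrX AErec AE_V_summable])
  then have AEV: "AE \<omega> in M. \<forall>t. v t \<omega> = V t \<omega> + \<mu>"
    by eventually_elim (simp add: X_def algebra_simps)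
  define \<tau> where "\<tau> \<omega> j = (if j = 0 then (1 - (\<Sum>j=1..p. bh \<omega> j)) * (sqrt (real n) * (mh \<omega> - \<mu>))
      else sqrt (real n) * (bh \<omega> j - \<beta> j))" for \<omega> and j :: nat
  have hn: "h * sqrt (real n) = 1" using n by (simp add: h_def)
  have h\<tau>: "h * \<tau> \<omega> 0 = (mh \<omega> - \<mu>) * (1 - (\<Sum>j=1..p. bh \<omega> j))"
    "\<And>j. j \<in> {1..p} \<Longrightarrow> h * \<tau> \<omega> j = bh \<omega> j - \<beta> j" for \<omega>
  proof -
    have 1: "h * (sqrt (real n) * d) = d" for d using hn by (simp only: mult.assoc[symmetric] mult_1)
    have 2: "h * (a * (sqrt (real n) * d)) = d * a" for a d
      unfolding mult.left_commute[of h a] 1 by (rule mult.commute)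
    show "h * \<tau> \<omega> 0 = (mh \<omega> - \<mu>) * (1 - (\<Sum>j=1..p. bh \<omega> j))"
      unfolding \<tau>_def by (simp only: simp_thms if_True 2)
    fix j assume "j \<in> {1..p}"
    then have "j \<noteq> 0" by auto
    then show "h * \<tau> \<omega> j = bh \<omega> j - \<beta> j"
      unfolding \<tau>_def by (simp only: simp_thms if_False 1)
  qed
  have Delta: "real n * h * q * (\<Sum>j\<le>p. psi_mean j) = sqrt (real n) * q * Delta p \<beta> G x Q"
  proof -
    have "psi_mean j = (\<integral>u. G (x + (if j = 0 then -1 else \<beta> j) * u) \<partial>Q) - G x" for j
    proof -
      note [measurable] = G(1)
      have "integrable Q (\<lambda>u. G (x + b j * u))"
        by (rule Q.integrable_const_bound[of _ 1]) (use G in auto)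
      then have "psi_mean j = (\<integral>u. G (x + b j * u) \<partial>Q) - G x"
        using Q.prob_space by (simp add: psi_mean_def psi_def)
      then show ?thesis by (simp only: b_def)
    qed
    then have "(\<Sum>j\<le>p. psi_mean j) = Delta p \<beta> G x Q" by (simp add: Delta_def atMost_atLeast0)
    moreover have "real n * h = sqrt (real n)" using n by (simp add: h_def real_div_sqrt)
    ultimately show ?thesis by simp
  qed
  have AEstat: "AE \<omega> in M. ?stat \<omega> = increment (\<tau> \<omega>) 0 \<omega> - g * \<tau> \<omega> 0 - real n * h * q * (\<Sum>j\<le>p. psi_mean j)"
    using AEz AEV AErec
  proof eventually_elim
    case (elim \<omega>)
    have iff: "residual p (mh \<omega>) (bh \<omega>) (\<lambda>t. v t \<omega> + z t \<omega> * \<xi> t \<omega>) t \<le> x \<longleftrightarrow> \<epsilon> t \<omega> \<le> thr (\<tau> \<omega>) 0 t \<omega>" for t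
    proof (rule residual_le_iff)
      show "V t \<omega> = (\<Sum>j=1..p. \<beta> j * V (t - int j) \<omega>) + \<epsilon> t \<omega>"
        using elim(2) spec[OF elim(3), of t] by (simp add: X_def)
      show "v s \<omega> + z s \<omega> * \<xi> s \<omega> = V s \<omega> + \<mu> + zi s \<omega> * \<xi> s \<omega>" for s
        using elim(1,2) by simp
    qed (use h\<tau> in \<open>auto simp: b_def\<close>)
    have "sqrt (real n) * (edf n (residual p (mh \<omega>) (bh \<omega>) (\<lambda>t. v t \<omega> + z t \<omega> * \<xi> t \<omega>)) x - edf n (\<lambda>t. \<epsilon> t \<omega>) x)
       = increment (\<tau> \<omega>) 0 \<omega>"
    proof -
      have "sqrt (real n) * (a / real n - a' / real n) = h * (a - a')" for a a'
      proof -
        have "sqrt (real n) / real n = h" by (simp add: h_def sqrt_divide_self_eq inverse_eq_divide)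
        moreover have "sqrt (real n) * (a / real n - a' / real n) = sqrt (real n) / real n * (a - a')"
          by (simp add: diff_divide_distrib[symmetric])
        ultimately show ?thesis by (simp only:)
      qed
      then show ?thesis by (simp add: edf_def iff increment_def sum_subtractf)
    qed
    then show ?case unfolding Delta by (simp add: \<tau>_def mult.assoc)
  qed
  have bad1: "?bad1 \<in> events" by measurable
  have bad2: "?bad2 \<in> events"
  proof -
    have [measurable]: "(\<lambda>\<omega>. L2_set (\<lambda>j. sqrt (real n) * (bh \<omega> j - \<beta> j)) {1..p}) \<in> borel_measurable M"
    proof -
      have [measurable]: "(\<lambda>\<omega>. \<Sum>j=1..p. (sqrt (real n) * (bh \<omega> j - \<beta> j))\<^sup>2) \<in> borel_measurable M"
        by (intro borel_measurable_sum borel_measurable_power borel_measurable_times borel_measurable_diff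
            borel_measurable_const bh)
      show ?thesis unfolding L2_set_def by measurable
    qed
    show ?thesis by measurable
  qed
  have bad3: "{\<omega> \<in> space M. envelope B \<eta> \<omega> > \<delta>} \<in> events" by measurable
  have small: "\<bar>\<tau> \<omega> j\<bar> \<le> B"
    if m: "\<bar>sqrt (real n) * (mh \<omega> - \<mu>)\<bar> \<le> C0" and L2: "\<bar>L2_set (\<lambda>j. sqrt (real n) * (bh \<omega> j - \<beta> j)) {1..p}\<bar> \<le> C0"
      and j: "j \<le> p" for \<omega> j
  proof -
    have *: "\<bar>sqrt (real n) * (bh \<omega> i - \<beta> i)\<bar> \<le> C0" if "i \<in> {1..p}" for i
    proof -
      have "\<bar>sqrt (real n) * (bh \<omega> i - \<beta> i)\<bar> \<le> L2_set (\<lambda>j. \<bar>sqrt (real n) * (bh \<omega> j - \<beta> j)\<bar>) {1..p}"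
        by (rule member_le_L2_set) (use that in auto)
      then show ?thesis using L2 by (simp add: L2_set_def)
    qed
    show ?thesis
    proof (cases "j = 0")
      case False
      then show ?thesis using *[of j] j B(3) by (auto simp: \<tau>_def)
    next
      case True
      have "\<bar>bh \<omega> i\<bar> \<le> \<bar>\<beta> i\<bar> + C0" if "i \<in> {1..p}" for i
      proof -
        \<comment> \<open>The unscaled coefficient errors are also at most C0, which bounds the
          random factor in front of the location error and explains the second lower bound required
          of B.\<close>
        have "1 \<le> sqrt (real n)" using n by simp
        then have "1 * \<bar>bh \<omega> i - \<beta> i\<bar> \<le> sqrt (real n) * \<bar>bh \<omega> i - \<beta> i\<bar>" by (intro mult_right_mono) auto
        also have "\<dots> \<le> C0" using *[OF that] by (simp add: abs_mult)
        finally have "\<bar>bh \<omega> i - \<beta> i\<bar> \<le> C0" by (simp only: mult_1)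
        then show ?thesis by linarith
      qed
      then have "(\<Sum>i=1..p. \<bar>bh \<omega> i\<bar>) \<le> (\<Sum>i=1..p. \<bar>\<beta> i\<bar> + C0)" by (rule sum_mono)
      then have "(\<Sum>i=1..p. \<bar>bh \<omega> i\<bar>) \<le> (\<Sum>j=1..p. \<bar>\<beta> j\<bar>) + real p * C0" by (simp add: sum.distrib)
      then have "\<bar>1 - (\<Sum>i=1..p. bh \<omega> i)\<bar> \<le> 1 + (\<Sum>j=1..p. \<bar>\<beta> j\<bar>) + real p * C0"
        using sum_abs[of "bh \<omega>" "{1..p}"] by linarith
      then have "\<bar>1 - (\<Sum>i=1..p. bh \<omega> i)\<bar> * \<bar>sqrt (real n) * (mh \<omega> - \<mu>)\<bar>
          \<le> (1 + (\<Sum>j=1..p. \<bar>\<beta> j\<bar>) + real p * C0) * C0"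
        using m B(2) by (intro mult_mono) (auto intro!: add_nonneg_nonneg sum_nonneg)
      then show ?thesis using B(4) True by (simp add: \<tau>_def abs_mult mult.commute)
    qed
  qed
  have "measure M {\<omega> \<in> space M. \<bar>?stat \<omega>\<bar> > \<delta>}
      \<le> measure M (?bad1 \<union> ?bad2 \<union> {\<omega> \<in> space M. envelope B \<eta> \<omega> > \<delta>})"
  proof (rule finite_measure_mono_AE)
    show "AE \<omega> in M. \<omega> \<in> {\<omega> \<in> space M. \<bar>?stat \<omega>\<bar> > \<delta>}
        \<longrightarrow> \<omega> \<in> ?bad1 \<union> ?bad2 \<union> {\<omega> \<in> space M. envelope B \<eta> \<omega> > \<delta>}"
      using AEstat
    proof eventually_elim
      case (elim \<omega>)
      show ?case
      proof (intro impI, rule ccontr)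
        assume st: "\<omega> \<in> {\<omega> \<in> space M. \<bar>?stat \<omega>\<bar> > \<delta>}"
          and nb: "\<omega> \<notin> ?bad1 \<union> ?bad2 \<union> {\<omega> \<in> space M. envelope B \<eta> \<omega> > \<delta>}"
        have sp: "\<omega> \<in> space M" and gt: "\<bar>?stat \<omega>\<bar> > \<delta>" using st by auto
        have "\<bar>increment (\<tau> \<omega>) 0 \<omega> - g * \<tau> \<omega> 0 - real n * h * q * (\<Sum>j\<le>p. psi_mean j)\<bar> \<le> envelope B \<eta> \<omega>"
        proof (rule increment_le_envelope[OF \<eta>])
          show "\<bar>\<tau> \<omega> j\<bar> \<le> B" if "j \<le> p" for j
            by (rule small[OF _ _ that]) (use nb sp in auto)
        qed
        then have "\<bar>?stat \<omega>\<bar> \<le> envelope B \<eta> \<omega>" unfolding elim .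
        with gt nb sp show False by auto
      qed
    qed
  qed (use bad1 bad2 bad3 in auto)
  also have "\<dots> \<le> measure M (?bad1 \<union> ?bad2) + measure M {\<omega> \<in> space M. envelope B \<eta> \<omega> > \<delta>}"
    by (rule measure_Un_le) (use bad1 bad2 bad3 in auto)
  also have "\<dots> \<le> (measure M ?bad1 + measure M ?bad2) + ?bound"
  proof (rule add_mono)
    show "measure M (?bad1 \<union> ?bad2) \<le> measure M ?bad1 + measure M ?bad2"
      by (rule measure_Un_le[OF bad1 bad2])
    have "(\<Sum>\<theta>\<in>grid B \<eta>. 2 * deviation_rate (kap p \<theta> \<eta>))
       \<le> (\<Sum>\<theta>\<in>grid B \<eta>. 2 * asymptotic_rate p L Kc \<Gamma> R Q (kap p \<theta> \<eta>) (1 / sqrt (real n)))"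
    proof (intro sum_mono mult_left_mono)
      fix \<theta>
      show "deviation_rate (kap p \<theta> \<eta>) \<le> asymptotic_rate p L Kc \<Gamma> R Q (kap p \<theta> \<eta>) (1 / sqrt (real n))"
        using deviation_rate_le[of \<Gamma> R "kap p \<theta> \<eta>"] q kap(1) by (simp add: h_def K)
    qed simp
    then show "measure M {\<omega> \<in> space M. envelope B \<eta> \<omega> > \<delta>} \<le> ?bound"
      unfolding K using \<delta>
      by (intro order.trans[OF prob_envelope[OF B(1) \<eta> \<delta>]] divide_right_mono add_right_mono) auto
  qed
  finally show ?thesis .
qed

section \<open>Passage to the limit, uniformly in the contamination and mixing parameters\<close>

theorem corollary2p1:
  fixes p :: nat and \<beta> :: "nat \<Rightarrow> real" and \<nu> \<mu> :: real
    and P0 PH Q :: "real measure" and G0 H g0 :: "real \<Rightarrow> real"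
    and M :: "nat \<Rightarrow> real \<Rightarrow> real \<Rightarrow> 'w measure"
    and \<epsilon> z \<xi> v y :: "nat \<Rightarrow> real \<Rightarrow> real \<Rightarrow> int \<Rightarrow> 'w \<Rightarrow> real"
    and mu_est :: "nat \<Rightarrow> (int \<Rightarrow> real) \<Rightarrow> real"
    and beta_est :: "nat \<Rightarrow> (int \<Rightarrow> real) \<Rightarrow> nat \<Rightarrow> real"
    and \<mu>h :: "nat \<Rightarrow> real \<Rightarrow> real \<Rightarrow> 'w \<Rightarrow> real"
    and \<beta>h :: "nat \<Rightarrow> real \<Rightarrow> real \<Rightarrow> 'w \<Rightarrow> nat \<Rightarrow> real"
  assumes p: "p \<ge> 1"
    and roots: "roots_inside_unit_disc p \<beta>"
    and mu: "\<nu> = (1 - (\<Sum>j=1..p. \<beta> j)) * \<mu>"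
    and P0: "real_distribution P0" "zero_mean_finite_variance P0"
    and PH: "real_distribution PH" "zero_mean_finite_variance PH"
    and Q: "real_distribution Q"
    and G0: "G0 = cdf P0" "twice_diff_bounded G0"
    and H: "H = cdf PH" "twice_diff_bounded H"
    and g0: "g0 = deriv G0"
    and model: "\<And>n \<gamma> \<rho>. n \<ge> 1 \<Longrightarrow> \<gamma> \<ge> 0 \<Longrightarrow> \<rho> \<ge> 0 \<Longrightarrow>
        contaminated_ar p \<beta> \<nu> (mixture_cdf G0 H (rate \<rho> n)) (rate \<gamma> n) Q
          (M n \<gamma> \<rho>) (\<epsilon> n \<gamma> \<rho>) (z n \<gamma> \<rho>) (\<xi> n \<gamma> \<rho>) (v n \<gamma> \<rho>)"
    and y: "\<And>n \<gamma> \<rho> t \<omega>. y n \<gamma> \<rho> t \<omega> = v n \<gamma> \<rho> t \<omega> + z n \<gamma> \<rho> t \<omega> * \<xi> n \<gamma> \<rho> t \<omega>"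
    and mu_est: "\<And>n. n \<ge> 1 \<Longrightarrow>
        mu_est n \<in> borel_measurable (\<Pi>\<^sub>M t\<in>{1 - int p..int n}. borel)"
    and beta_est: "\<And>n j. n \<ge> 1 \<Longrightarrow> j \<in> {1..p} \<Longrightarrow>
        (\<lambda>w. beta_est n w j) \<in> borel_measurable (\<Pi>\<^sub>M t\<in>{1 - int p..int n}. borel)"
    and \<mu>h: "\<And>n \<gamma> \<rho> \<omega>. \<mu>h n \<gamma> \<rho> \<omega> = mu_est n (sample p n (y n \<gamma> \<rho>) \<omega>)"
    and \<beta>h: "\<And>n \<gamma> \<rho> \<omega>. \<beta>h n \<gamma> \<rho> \<omega> = beta_est n (sample p n (y n \<gamma> \<rho>) \<omega>)"
    and mu_rate: "\<And>\<Gamma> R. \<Gamma> \<ge> 0 \<Longrightarrow> R \<ge> 0 \<Longrightarrow>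
        OP1_uniformly M (\<lambda>n \<gamma> \<rho> \<omega>. sqrt (real n) * (\<mu>h n \<gamma> \<rho> \<omega> - \<mu>)) \<Gamma> R"
    and beta_rate: "\<And>\<Gamma> R. \<Gamma> \<ge> 0 \<Longrightarrow> R \<ge> 0 \<Longrightarrow>
        OP1_uniformly M
          (\<lambda>n \<gamma> \<rho> \<omega>. L2_set (\<lambda>j. sqrt (real n) * (\<beta>h n \<gamma> \<rho> \<omega> j - \<beta> j)) {1..p}) \<Gamma> R"
  shows "\<forall>\<Gamma>\<ge>0. \<forall>R\<ge>0. \<forall>x. \<forall>\<delta>>0.
    sup_prob_gt M
      (\<lambda>n \<gamma> \<rho> \<omega>.
         sqrt (real n) *
           (edf n (residual p (\<mu>h n \<gamma> \<rho> \<omega>) (\<beta>h n \<gamma> \<rho> \<omega>) (\<lambda>t. y n \<gamma> \<rho> t \<omega>)) x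
            - edf n (\<lambda>t. \<epsilon> n \<gamma> \<rho> t \<omega>) x)
         - g0 x * (1 - (\<Sum>j=1..p. \<beta>h n \<gamma> \<rho> \<omega> j)) * (sqrt (real n) * (\<mu>h n \<gamma> \<rho> \<omega> - \<mu>))
         - \<gamma> * Delta p \<beta> G0 x Q)
      \<Gamma> R \<delta> \<longlonglongrightarrow> 0"
proof (intro allI impI)
  fix \<Gamma> R x \<delta> :: real
  assume \<Gamma>: "\<Gamma> \<ge> 0" and R: "R \<ge> 0" and \<delta>: "\<delta> > 0"
  interpret P0: real_distribution P0 by fact
  interpret PH: real_distribution PH by fact
  obtain c where c: "\<And>k. k < 0 \<Longrightarrow> c k = 0" "c 0 = 1"
    "\<And>k. k > 0 \<Longrightarrow> c k = (\<Sum>j=1..p. \<beta> j * c (k - int j))"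
    "summable (\<lambda>k. \<bar>c (int k)\<bar>)"
    using ar_impulse_response[OF roots] by blast
  have G01: "0 \<le> G0 u" "G0 u \<le> 1" and H01: "0 \<le> H u" "H u \<le> 1" for u
    using P0.cdf_nonneg P0.cdf_bounded_prob PH.cdf_nonneg PH.cdf_bounded_prob by (auto simp: G0(1) H(1))
  have G0_borel: "G0 \<in> borel_measurable borel"
    unfolding G0(1) by (intro borel_measurable_mono) (auto simp: mono_def P0.cdf_nondecreasing)
  obtain L1 where L1: "L1 \<ge> 0" "\<And>x. \<bar>deriv G0 x\<bar> \<le> L1" "\<And>x y. \<bar>G0 x - G0 y\<bar> \<le> L1 * \<bar>x - y\<bar>"
    "\<And>x d. \<bar>G0 (x + d) - G0 x - deriv G0 x * d\<bar> \<le> L1 * d\<^sup>2"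
    using twice_diff_bounded_cdf_bounds[OF G0(2) G01] by blast
  obtain L2 where L2: "L2 \<ge> 0" "\<And>x. \<bar>deriv H x\<bar> \<le> L2" "\<And>x y. \<bar>H x - H y\<bar> \<le> L2 * \<bar>x - y\<bar>"
    "\<And>x d. \<bar>H (x + d) - H x - deriv H x * d\<bar> \<le> L2 * d\<^sup>2"
    using twice_diff_bounded_cdf_bounds[OF H(2) H01] by blast
  define L where "L = L1 + L2"
  have L: "L \<ge> 0" using L1(1) L2(1) by (simp add: L_def)
  define S where "S = (\<integral>u. u\<^sup>2 \<partial>P0) + (\<integral>u. u\<^sup>2 \<partial>PH)"
  define K where "K = outlier_ar.K p (\<lambda>k. c (int k)) S"
  define X where "X = (\<lambda>n \<gamma> \<rho> \<omega>.
         sqrt (real n) *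
           (edf n (residual p (\<mu>h n \<gamma> \<rho> \<omega>) (\<beta>h n \<gamma> \<rho> \<omega>) (\<lambda>t. y n \<gamma> \<rho> t \<omega>)) x
            - edf n (\<lambda>t. \<epsilon> n \<gamma> \<rho> t \<omega>) x)
         - g0 x * (1 - (\<Sum>j=1..p. \<beta>h n \<gamma> \<rho> \<omega> j)) * (sqrt (real n) * (\<mu>h n \<gamma> \<rho> \<omega> - \<mu>))
         - \<gamma> * Delta p \<beta> G0 x Q)"
  define X1 where "X1 = (\<lambda>n \<gamma> \<rho> \<omega>. sqrt (real n) * (\<mu>h n \<gamma> \<rho> \<omega> - \<mu>))"
  define X2 where "X2 = (\<lambda>n \<gamma> \<rho> \<omega>. L2_set (\<lambda>j. sqrt (real n) * (\<beta>h n \<gamma> \<rho> \<omega> j - \<beta> j)) {1..p})"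
  define bnd where "bnd B \<eta> n = ((\<Sum>\<theta>\<in>outlier_ar.grid p B \<eta>.
          2 * asymptotic_rate p L K \<Gamma> R Q (kap p \<theta> \<eta>) (1 / sqrt (real n)))
        + L * (\<eta> + (B + \<eta>) * (real p * sqrt (outlier_ar.C (\<lambda>k. c (int k)) S / real n)) + \<eta> * K)) / \<delta>"
    for B \<eta> and n :: nat
  have prob: "prob_space (M n \<gamma> \<rho>)" if "n \<ge> 1" "\<gamma> \<ge> 0" "\<rho> \<ge> 0" for n \<gamma> \<rho>
    using model[OF that] by (simp add: contaminated_ar_def)
  have sup_upper: "measure (M n \<gamma> \<rho>) {\<omega> \<in> space (M n \<gamma> \<rho>). \<bar>F n \<gamma> \<rho> \<omega>\<bar> > b} \<le> sup_prob_gt M F \<Gamma> R b n"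
    if "n \<ge> 1" "\<gamma> \<in> {0..\<Gamma>}" "\<rho> \<in> {0..R}" for F n \<gamma> \<rho> b
  proof -
    \<comment> \<open>Probabilities are at most 1, so the real supremum is a genuine upper bound of
      the family.\<close>
    have bdd: "bdd_above ((\<lambda>(\<gamma>, \<rho>). measure (M n \<gamma> \<rho>) {\<omega> \<in> space (M n \<gamma> \<rho>). \<bar>F n \<gamma> \<rho> \<omega>\<bar> > b}) ` ({0..\<Gamma>} \<times> {0..R}))"
      by (rule bdd_aboveI[of _ 1]) (use \<open>n \<ge> 1\<close> in \<open>auto intro!: prob_space.prob_le_1 prob\<close>)
    have "(\<gamma>, \<rho>) \<in> {0..\<Gamma>} \<times> {0..R}" using that by simp
    from cSUP_upper[OF this bdd] show ?thesis by (simp add: sup_prob_gt_def)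
  qed
  \<comment> \<open>\<Gamma> \<le> sqrt n makes the minimum in \<open>rate \<gamma> n\<close>
    inactive, so sqrt n times the contamination probability is exactly \<gamma>. For the mixing
    weight the upper bound R / sqrt n suffices.\<close>
  have key: "sup_prob_gt M X \<Gamma> R \<delta> n \<le> sup_prob_gt M X1 \<Gamma> R C0 n + sup_prob_gt M X2 \<Gamma> R C0 n + bnd B \<eta> n"
    if n: "n \<ge> 1" "\<Gamma> \<le> sqrt (real n)" and \<eta>: "\<eta> > 0"
      and B: "B \<ge> 0" "C0 \<ge> 0" "C0 \<le> B" "C0 * (1 + (\<Sum>j=1..p. \<bar>\<beta> j\<bar>) + real p * C0) \<le> B"
    for n B C0 \<eta>
    unfolding sup_prob_gt_def[of M X]
  proof (rule cSUP_least)
    show "{0..\<Gamma>} \<times> {0..R} \<noteq> {}" using \<Gamma> R by simp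
    fix \<gamma>\<rho> assume "\<gamma>\<rho> \<in> {0..\<Gamma>} \<times> {0..R}"
    then obtain \<gamma> \<rho> where \<gamma>\<rho>: "\<gamma>\<rho> = (\<gamma>, \<rho>)" and \<gamma>: "\<gamma> \<in> {0..\<Gamma>}" and \<rho>: "\<rho> \<in> {0..R}" by auto
    define s where "s = rate \<rho> n"
    have sn: "sqrt (real n) > 0" using n(1) by simp
    have s: "0 \<le> s" "s \<le> 1" "s \<le> R * (1 / sqrt (real n))"
      using \<rho> sn by (auto simp: s_def rate_def min_le_iff_disj divide_right_mono)
    have q: "rate \<gamma> n = \<gamma> / sqrt (real n)"
      using \<gamma> n(2) sn by (simp add: rate_def)
    have qn: "sqrt (real n) * rate \<gamma> n = \<gamma>" using sn by (simp add: q)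
    have m: "contaminated_ar p \<beta> \<nu> (mixture_cdf G0 H s) (rate \<gamma> n) Q
          (M n \<gamma> \<rho>) (\<epsilon> n \<gamma> \<rho>) (z n \<gamma> \<rho>) (\<xi> n \<gamma> \<rho>) (v n \<gamma> \<rho>)"
      unfolding s_def by (rule model) (use n \<gamma> \<rho> in auto)
    interpret prob_space "M n \<gamma> \<rho>" using m by (simp add: contaminated_ar_def)
    have "z n \<gamma> \<rho> t \<in> borel_measurable (M n \<gamma> \<rho>)" "\<xi> n \<gamma> \<rho> t \<in> borel_measurable (M n \<gamma> \<rho>)"
      "v n \<gamma> \<rho> t \<in> borel_measurable (M n \<gamma> \<rho>)" for t
      using m by (auto simp: contaminated_ar_def iid_def indep_vars_def2 stationary_ar_solution_def strictly_stationary_def)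
    note [measurable] = this
    have "(\<lambda>\<omega>. y n \<gamma> \<rho> t \<omega>) \<in> borel_measurable (M n \<gamma> \<rho>)" for t
      unfolding y by measurable
    then have samp: "sample p n (y n \<gamma> \<rho>) \<in> M n \<gamma> \<rho> \<rightarrow>\<^sub>M (\<Pi>\<^sub>M t\<in>{1 - int p..int n}. borel)"
      unfolding sample_def[abs_def] by (intro measurable_restrict)
    have \<mu>h_borel: "\<mu>h n \<gamma> \<rho> \<in> borel_measurable (M n \<gamma> \<rho>)"
      unfolding \<mu>h[abs_def] by (rule measurable_compose[OF samp mu_est[OF n(1)]])
    have \<beta>h_borel: "(\<lambda>\<omega>. \<beta>h n \<gamma> \<rho> \<omega> j) \<in> borel_measurable (M n \<gamma> \<rho>)" if "j \<in> {1..p}" for j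
      unfolding \<beta>h by (rule measurable_compose[OF samp beta_est[OF n(1) that]])
    note mix = mixture_cdf_bounds[of G0 L1 "deriv G0 x" x H L2 "deriv H x", OF G01 L1(3,2,4) H01 L2(3,2,4) s, folded L_def g0]
    have S: "(\<integral>\<omega>. (\<epsilon> n \<gamma> \<rho> t \<omega>)\<^sup>2 \<partial>M n \<gamma> \<rho>) \<le> S" for t
      unfolding S_def by (rule contaminated_ar_second_moment[OF m[unfolded G0(1) H(1)] P0 PH s(1,2)])
    have g0L: "\<bar>g0 x\<bar> \<le> L" using L1(2)[of x] L2(1) by (simp add: g0 L_def)
    have qle: "rate \<gamma> n \<le> \<Gamma> * (1 / sqrt (real n))"
      using \<gamma> sn by (simp add: q divide_right_mono)
    have yv: "(\<lambda>t. y n \<gamma> \<rho> t \<omega>) = (\<lambda>t. v n \<gamma> \<rho> t \<omega> + z n \<gamma> \<rho> t \<omega> * \<xi> n \<gamma> \<rho> t \<omega>)" for \<omega>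
      by (simp add: y)
    have "measure (M n \<gamma> \<rho>) {\<omega> \<in> space (M n \<gamma> \<rho>). \<bar>X n \<gamma> \<rho> \<omega>\<bar> > \<delta>}
      \<le> measure (M n \<gamma> \<rho>) {\<omega> \<in> space (M n \<gamma> \<rho>). \<bar>X1 n \<gamma> \<rho> \<omega>\<bar> > C0}
        + measure (M n \<gamma> \<rho>) {\<omega> \<in> space (M n \<gamma> \<rho>). \<bar>X2 n \<gamma> \<rho> \<omega>\<bar> > C0} + bnd B \<eta> n"
      using prob_statistic_le[OF m n(1) mu c Q S G0_borel G01 mix(1,2) g0L mix(3) R qle \<mu>h_borel \<beta>h_borel B \<eta> \<delta>]
      unfolding X_def X1_def X2_def bnd_def K_def yv qn .
    also have "\<dots> \<le> sup_prob_gt M X1 \<Gamma> R C0 n + sup_prob_gt M X2 \<Gamma> R C0 n + bnd B \<eta> n"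
      by (intro add_mono sup_upper order.refl n(1) \<gamma> \<rho>)
    finally show "(case \<gamma>\<rho> of (\<gamma>, \<rho>) \<Rightarrow> measure (M n \<gamma> \<rho>) {\<omega> \<in> space (M n \<gamma> \<rho>). \<bar>X n \<gamma> \<rho> \<omega>\<bar> > \<delta>})
      \<le> sup_prob_gt M X1 \<Gamma> R C0 n + sup_prob_gt M X2 \<Gamma> R C0 n + bnd B \<eta> n"
      by (simp add: \<gamma>\<rho>)
  qed
  have "sup_prob_gt M X \<Gamma> R \<delta> \<longlonglongrightarrow> 0"
  proof (rule order_tendstoI)
    fix a :: real assume a: "a < 0"
    show "\<forall>\<^sub>F n in sequentially. a < sup_prob_gt M X \<Gamma> R \<delta> n"
      using eventually_ge_at_top[of 1]
    proof eventually_elim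
      case (elim n)
      \<comment> \<open>The supremum dominates its member at zero parameters, hence is
        nonnegative.\<close>
      have "0 \<le> measure (M n 0 0) {\<omega> \<in> space (M n 0 0). \<bar>X n 0 0 \<omega>\<bar> > \<delta>}" by simp
      also have "\<dots> \<le> sup_prob_gt M X \<Gamma> R \<delta> n" by (rule sup_upper) (use elim \<Gamma> R in auto)
      finally show ?case using a by linarith
    qed
  next
    fix a :: real assume a: "0 < a"
    \<comment> \<open>One radius C0 has to serve both estimators; each contributes at most a / 4
      eventually, which leaves a / 2 for \<open>bnd\<close>.\<close>
    have "\<forall>\<^sub>F b in at_top. limsup (\<lambda>n. ereal (sup_prob_gt M X1 \<Gamma> R b n)) < ereal (a / 4)"
      "\<forall>\<^sub>F b in at_top. limsup (\<lambda>n. ereal (sup_prob_gt M X2 \<Gamma> R b n)) < ereal (a / 4)"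
      using order_tendstoD(2)[OF mu_rate[OF \<Gamma> R, unfolded OP1_uniformly_def], of "ereal (a / 4)"]
        order_tendstoD(2)[OF beta_rate[OF \<Gamma> R, unfolded OP1_uniformly_def], of "ereal (a / 4)"] a
      by (simp_all add: X1_def X2_def)
    then have "\<forall>\<^sub>F b in at_top. 0 \<le> b \<and> limsup (\<lambda>n. ereal (sup_prob_gt M X1 \<Gamma> R b n)) < ereal (a / 4)
        \<and> limsup (\<lambda>n. ereal (sup_prob_gt M X2 \<Gamma> R b n)) < ereal (a / 4)"
      using eventually_ge_at_top[of "0 :: real"] by eventually_elim auto
    then obtain C0 where C0: "0 \<le> C0" "limsup (\<lambda>n. ereal (sup_prob_gt M X1 \<Gamma> R C0 n)) < ereal (a / 4)"
      "limsup (\<lambda>n. ereal (sup_prob_gt M X2 \<Gamma> R C0 n)) < ereal (a / 4)"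
      using eventually_happens'[OF trivial_limit_at_top_linorder] by blast
    define B where "B = max C0 (C0 * (1 + (\<Sum>j=1..p. \<bar>\<beta> j\<bar>) + real p * C0))"
    have B: "B \<ge> 0" "C0 \<ge> 0" "C0 \<le> B" "C0 * (1 + (\<Sum>j=1..p. \<bar>\<beta> j\<bar>) + real p * C0) \<le> B"
      using C0(1) by (auto simp: B_def)
    \<comment> \<open>With B and \<eta> fixed, \<open>bnd\<close> tends to
      \<open>L * (\<eta> + \<eta> * K) / \<delta>\<close>, and this choice of \<eta> makes that at
      most a / 4. The modulus of K makes D nonnegative, and D + 1 keeps the denominator positive
      when L = 0.\<close>
    define D where "D = L * (1 + \<bar>K\<bar>)"
    have D: "D \<ge> 0" using L by (simp add: D_def)
    define \<eta> where "\<eta> = a * \<delta> / (4 * (D + 1))"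
    have \<eta>: "\<eta> > 0" using a \<delta> D by (simp add: \<eta>_def)
    have "(\<lambda>n. bnd B \<eta> n) \<longlonglongrightarrow> ((\<Sum>\<theta>\<in>outlier_ar.grid p B \<eta>. 2 * 0)
        + L * (\<eta> + (B + \<eta>) * (real p * sqrt 0) + \<eta> * K)) / \<delta>"
      unfolding bnd_def
      by (intro tendsto_intros asymptotic_rate_tendsto_0 Q L kap(1) lim_const_over_n) (use \<delta> in auto)
    moreover have "((\<Sum>\<theta>\<in>outlier_ar.grid p B \<eta>. 2 * 0)
        + L * (\<eta> + (B + \<eta>) * (real p * sqrt 0) + \<eta> * K)) / \<delta> < a / 2"
    proof -
      have "L * (\<eta> + \<eta> * K) \<le> \<eta> * D"
        using mult_left_mono[of K "\<bar>K\<bar>" "L * \<eta>"] L \<eta> by (simp add: D_def algebra_simps)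
      also have "\<dots> \<le> \<eta> * (D + 1)" using \<eta> by simp
      also have "\<dots> = a * \<delta> / 4"
      proof -
        have "a * \<delta> / (4 * d) * d = a * \<delta> / 4" if "d \<noteq> 0" for d using that by simp
        from this[of "D + 1"] show ?thesis using D by (simp only: \<eta>_def)
      qed
      also have "\<dots> < a / 2 * \<delta>" using a \<delta> by simp
      finally show ?thesis using \<delta> by (simp add: pos_divide_less_eq)
    qed
    ultimately have "\<forall>\<^sub>F n in sequentially. bnd B \<eta> n < a / 2"
      by (rule order_tendstoD(2))
    moreover have "\<forall>\<^sub>F n in sequentially. \<Gamma> \<le> sqrt (real n)"
      using filterlim_compose[OF sqrt_at_top filterlim_real_sequentially]
      by (simp add: filterlim_at_top)
    ultimately show "\<forall>\<^sub>F n in sequentially. sup_prob_gt M X \<Gamma> R \<delta> n < a"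
      using Limsup_lessD[OF C0(2)] Limsup_lessD[OF C0(3)] eventually_ge_at_top[of 1]
    proof eventually_elim
      case (elim n)
      then show ?case using key[OF elim(5) elim(2) \<eta> B] by simp
    qed
  qed
  then show "sup_prob_gt M
      (\<lambda>n \<gamma> \<rho> \<omega>.
         sqrt (real n) *
           (edf n (residual p (\<mu>h n \<gamma> \<rho> \<omega>) (\<beta>h n \<gamma> \<rho> \<omega>) (\<lambda>t. y n \<gamma> \<rho> t \<omega>)) x
            - edf n (\<lambda>t. \<epsilon> n \<gamma> \<rho> t \<omega>) x)
         - g0 x * (1 - (\<Sum>j=1..p. \<beta>h n \<gamma> \<rho> \<omega> j)) * (sqrt (real n) * (\<mu>h n \<gamma> \<rho> \<omega> - \<mu>))
         - \<gamma> * Delta p \<beta> G0 x Q)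
      \<Gamma> R \<delta> \<longlonglongrightarrow> 0"
    by (simp only: X_def)
qed

end
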